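(* For every bounded Lipschitz domain $\Omega\subset\mathbb{R}^N$ and every $1<p<2^*-1$, \[ \hat\rho_3(\Omega,p)\ \ge\ 2\, D_{N,p}\,\lambda_3(\Omega)^{\frac{2}{p-1}-\frac N2}. \]
   Context: $2^*=2N/(N-2)$ if $N\ge3$, $2^*=+\infty$ if $N=1,2$. $\lambda_3(\Omega)$ is the third Dirichlet eigenvalue of $-\Delta$ in $H^1_0(\Omega)$, counted with multiplicity. Threshold: let $\mathcal{M}=\{u\in H^1_0(\Omega):\int_\Omega u^2=1\}$ and $\overline{\mathcal{B}}_\alpha=\{u\in\mathcal{M}:\int_\Omega|\nabla u|^2\le\alpha\}$. For a closed symmetric set $A\subset H^1_0(\Omega)$ let $\gamma(A)=\sup\{m:\exists h\in C(\mathbb{S}^{m-1};A),\ h(-x)=-h(x)\}$, and let $\Sigma_\alpha^{(3)}$ be the family of closed $A\subset\overline{\mathcal{B}}_\alpha$ with $-A=A$, $\gamma(A)\ge3$. For $\alpha>\lambda_3(\Omega)$ put $M_{\alpha,3}=\sup_{A\in\Sigma_\alpha^{(3)}}\inf_{u\in A}\int_\Omega|u|^{p+1}dx$, and \[ \hat\mu_3=\sup_{\alpha>\lambda_3(\Omega)}\frac{p+1}{2}\,\frac{\alpha-\lambda_3(\Omega)}{M_{\alpha,3}-|\Omega|^{-\frac{p-1}2}}\in(0,+\infty],\qquad \hat\rho_3(\Omega,p)=\hat\mu_3^{2/(p-1)}. \] Constant: $C_{N,p}$ is the best constant in $\|v\|_{L^{p+1}}^{p+1}\le C_{N,p}\|\nabla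 v\|_{L^2}^{N(p-1)/2}\|v\|_{L^2}^{(p+1)-N(p-1)/2}$ on $H^1(\mathbb{R}^N)$. With $\beta=N(p-1)/4$, for $\beta\ge1$, \[ D_{N,p}=\left[\frac{p+1}{2C_{N,p}}\,\frac{(\beta-1)^{\beta-1}}{\beta^\beta}\right]^{\frac{2}{p-1}}\quad(\text{with }0^0=1), \] and $D_{N,p}=+\infty$ for $\beta<1$ (i.e. $p<1+4/N$), so that in that case the claim reads $\hat\rho_3(\Omega,p)=+\infty$. *)

theory Defs
  imports "HOL-Analysis.Analysis" "HOL-Homology.Homology"
begin

text \<open>The unit vector \<open>e\<close> plays the role of the last axis after a rotation, and \<open>g\<close> is a function
  on the hyperplane orthogonal to \<open>e\<close>: near each boundary point the set is the part above the
  graph of \<open>g\<close>.\<close>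

definition lipschitz_boundary :: "'a::euclidean_space set \<Rightarrow> bool" where
  "lipschitz_boundary \<Omega> \<longleftrightarrow>
     (\<forall>z\<in>frontier \<Omega>. \<exists>r>0. \<exists>e g L. norm e = 1 \<and> L-lipschitz_on {y. y \<bullet> e = 0} g \<and>
        \<Omega> \<inter> ball z r = {y \<in> ball z r. g (y - (y \<bullet> e) *\<^sub>R e) < y \<bullet> e})"

definition lipschitz_domain :: "'a::euclidean_space set \<Rightarrow> bool" where
  "lipschitz_domain \<Omega> \<longleftrightarrow> open \<Omega> \<and> connected \<Omega> \<and> \<Omega> \<noteq> {} \<and> lipschitz_boundary \<Omega>"

definition critical_exponent :: "nat \<Rightarrow> ereal" where
  "critical_exponent N = (if N \<ge> 3 then ereal (2 * real N / (real N - 2)) else \<infinity>)"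

text \<open>Elements of the function spaces on \<open>\<Omega>\<close> are represented by functions on the whole space,
  of which only the values on \<open>\<Omega>\<close> up to null sets matter. No quotient is taken: the spaces carry
  the topology of a seminorm, in which almost everywhere equal functions are indistinguishable.\<close>

primrec C_k :: "nat \<Rightarrow> ('a::euclidean_space \<Rightarrow> real) \<Rightarrow> bool" where
  "C_k 0 f \<longleftrightarrow> continuous_on UNIV f"
| "C_k (Suc k) f \<longleftrightarrow>
     (\<exists>g. (\<forall>x. GDERIV f x :> g x) \<and> (\<forall>b\<in>Basis. C_k k (\<lambda>x. g x \<bullet> b)))"

definition test_functions :: "'a::euclidean_space set \<Rightarrow> ('a \<Rightarrow> real) set" where
  "test_functions \<Omega> = {\<phi>. (\<forall>k. C_k k \<phi>) \<and>
     compact (closure {x. \<phi> x \<noteq> 0}) \<and> closure {x. \<phi> x \<noteq> 0} \<subseteq> \<Omega>}"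

definition L2 :: "'a::euclidean_space set \<Rightarrow> ('a \<Rightarrow> 'b::euclidean_space) set" where
  "L2 \<Omega> = {f \<in> borel_measurable (lebesgue_on \<Omega>).
     integrable (lebesgue_on \<Omega>) (\<lambda>x. (norm (f x))\<^sup>2)}"

definition is_weak_gradient ::
    "'a::euclidean_space set \<Rightarrow> ('a \<Rightarrow> real) \<Rightarrow> ('a \<Rightarrow> 'a) \<Rightarrow> bool" where
  "is_weak_gradient \<Omega> u g \<longleftrightarrow> (\<forall>\<phi>\<in>test_functions \<Omega>. \<forall>b\<in>Basis.
     (LINT x|lebesgue_on \<Omega>. u x * frechet_derivative \<phi> (at x) b) =
     - (LINT x|lebesgue_on \<Omega>. (g x \<bullet> b) * \<phi> x))"

definition H1 :: "'a::euclidean_space set \<Rightarrow> ('a \<Rightarrow> real) set" where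
  "H1 \<Omega> = {u \<in> L2 \<Omega>. \<exists>g\<in>L2 \<Omega>. is_weak_gradient \<Omega> u g}"

definition weak_grad :: "'a::euclidean_space set \<Rightarrow> ('a \<Rightarrow> real) \<Rightarrow> 'a \<Rightarrow> 'a" where
  "weak_grad \<Omega> u = (SOME g. g \<in> L2 \<Omega> \<and> is_weak_gradient \<Omega> u g)"

definition mass :: "'a::euclidean_space set \<Rightarrow> ('a \<Rightarrow> real) \<Rightarrow> real" where
  "mass \<Omega> u = (LINT x|lebesgue_on \<Omega>. (u x)\<^sup>2)"

definition energy :: "'a::euclidean_space set \<Rightarrow> ('a \<Rightarrow> real) \<Rightarrow> real" where
  "energy \<Omega> u = (LINT x|lebesgue_on \<Omega>. (norm (weak_grad \<Omega> u x))\<^sup>2)"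

definition H1_norm :: "'a::euclidean_space set \<Rightarrow> ('a \<Rightarrow> real) \<Rightarrow> real" where
  "H1_norm \<Omega> u = sqrt (mass \<Omega> u + energy \<Omega> u)"

definition H1_topology :: "'a::euclidean_space set \<Rightarrow> ('a \<Rightarrow> real) topology" where
  "H1_topology \<Omega> = topology (\<lambda>U. U \<subseteq> H1 \<Omega> \<and>
     (\<forall>u\<in>U. \<exists>\<epsilon>>0. \<forall>v\<in>H1 \<Omega>. H1_norm \<Omega> (\<lambda>x. v x - u x) < \<epsilon> \<longrightarrow> v \<in> U))"

lemma openin_H1_topology:
  "openin (H1_topology \<Omega>) U \<longleftrightarrow> U \<subseteq> H1 \<Omega> \<and>
     (\<forall>u\<in>U. \<exists>\<epsilon>>0. \<forall>v\<in>H1 \<Omega>. H1_norm \<Omega> (\<lambda>x. v x - u x) < \<epsilon> \<longrightarrow> v \<in> U)"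
proof -
  have "istopology (\<lambda>U. U \<subseteq> H1 \<Omega> \<and>
     (\<forall>u\<in>U. \<exists>\<epsilon>>0. \<forall>v\<in>H1 \<Omega>. H1_norm \<Omega> (\<lambda>x. v x - u x) < \<epsilon> \<longrightarrow> v \<in> U))" (is "istopology ?P")
    unfolding istopology_def
  proof (intro conjI allI impI)
    fix S T assume S: "?P S" and T: "?P T"
    show "S \<inter> T \<subseteq> H1 \<Omega>" using S by blast
    show "\<forall>u\<in>S \<inter> T. \<exists>\<epsilon>>0. \<forall>v\<in>H1 \<Omega>. H1_norm \<Omega> (\<lambda>x. v x - u x) < \<epsilon> \<longrightarrow> v \<in> S \<inter> T"
    proof
      fix u assume u: "u \<in> S \<inter> T"
      obtain a where a: "a > 0" "\<forall>v\<in>H1 \<Omega>. H1_norm \<Omega> (\<lambda>x. v x - u x) < a \<longrightarrow> v \<in> S"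
        using S u by blast
      obtain b where b: "b > 0" "\<forall>v\<in>H1 \<Omega>. H1_norm \<Omega> (\<lambda>x. v x - u x) < b \<longrightarrow> v \<in> T"
        using T u by blast
      show "\<exists>\<epsilon>>0. \<forall>v\<in>H1 \<Omega>. H1_norm \<Omega> (\<lambda>x. v x - u x) < \<epsilon> \<longrightarrow> v \<in> S \<inter> T"
        using a b by (intro exI[of _ "min a b"]) auto
    qed
  next
    fix K assume K: "\<forall>S\<in>K. ?P S"
    show "\<Union>K \<subseteq> H1 \<Omega>" using K by blast
    show "\<forall>u\<in>\<Union>K. \<exists>\<epsilon>>0. \<forall>v\<in>H1 \<Omega>. H1_norm \<Omega> (\<lambda>x. v x - u x) < \<epsilon> \<longrightarrow> v \<in> \<Union>K"
      using K by (meson UnionE UnionI)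
  qed
  then show ?thesis
    unfolding H1_topology_def by (simp add: topology_inverse')
qed

lemma topspace_H1_topology [simp]: "topspace (H1_topology \<Omega>) = H1 \<Omega>"
proof -
  have "openin (H1_topology \<Omega>) (H1 \<Omega>)"
    unfolding openin_H1_topology using zero_less_one by blast
  then show ?thesis
    by (metis openin_H1_topology openin_subset openin_topspace subset_antisym)
qed

definition H10 :: "'a::euclidean_space set \<Rightarrow> ('a \<Rightarrow> real) set" where
  "H10 \<Omega> = H1_topology \<Omega> closure_of test_functions \<Omega>"

definition H10_topology :: "'a::euclidean_space set \<Rightarrow> ('a \<Rightarrow> real) topology" where
  "H10_topology \<Omega> = subtopology (H1_topology \<Omega>) (H10 \<Omega>)"

text \<open>A nonnegative integral, so that no integrability has to be known beforehand.\<close>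

definition Lq_power :: "'a::euclidean_space set \<Rightarrow> real \<Rightarrow> ('a \<Rightarrow> real) \<Rightarrow> ennreal" where
  "Lq_power \<Omega> q u = (\<integral>\<^sup>+x. ennreal (\<bar>u x\<bar> powr q) \<partial>lebesgue_on \<Omega>)"

definition dirichlet_eigenspace :: "'a::euclidean_space set \<Rightarrow> real \<Rightarrow> ('a \<Rightarrow> real) set" where
  "dirichlet_eigenspace \<Omega> \<mu> = {u \<in> H10 \<Omega>. \<forall>v\<in>H10 \<Omega>.
     (LINT x|lebesgue_on \<Omega>. weak_grad \<Omega> u x \<bullet> weak_grad \<Omega> v x) =
     \<mu> * (LINT x|lebesgue_on \<Omega>. u x * v x)}"

definition dirichlet_eigenvalues :: "'a::euclidean_space set \<Rightarrow> real set" where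
  "dirichlet_eigenvalues \<Omega> =
     {\<mu>. \<exists>u\<in>dirichlet_eigenspace \<Omega> \<mu>. \<not> (AE x in lebesgue_on \<Omega>. u x = 0)}"

definition ae_independent ::
    "'a::euclidean_space set \<Rightarrow> nat \<Rightarrow> (nat \<Rightarrow> 'a \<Rightarrow> real) \<Rightarrow> bool" where
  "ae_independent \<Omega> m f \<longleftrightarrow> (\<forall>c :: nat \<Rightarrow> real.
     (AE x in lebesgue_on \<Omega>. (\<Sum>i<m. c i * f i x) = 0) \<longrightarrow> (\<forall>i<m. c i = 0))"

definition dirichlet_multiplicity :: "'a::euclidean_space set \<Rightarrow> real \<Rightarrow> enat" where
  "dirichlet_multiplicity \<Omega> \<mu> =
     Sup {enat m | m. \<exists>f. (\<forall>i<m. f i \<in> dirichlet_eigenspace \<Omega> \<mu>) \<and> ae_independent \<Omega> m f}"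

text \<open>The number of eigenvalues not exceeding \<open>t\<close>, each counted with its multiplicity; the
  supremum over finite sets is the (possibly infinite) sum of the multiplicities.\<close>

definition dirichlet_counting :: "'a::euclidean_space set \<Rightarrow> real \<Rightarrow> enat" where
  "dirichlet_counting \<Omega> t =
     (SUP F\<in>{F. finite F \<and> F \<subseteq> dirichlet_eigenvalues \<Omega> \<inter> {..t}}.
        \<Sum>\<mu>\<in>F. dirichlet_multiplicity \<Omega> \<mu>)"

text \<open>The \<open>k\<close>-th element, for \<open>k \<ge> 1\<close>, of the nondecreasing list of eigenvalues in which each one
  is repeated according to its multiplicity.\<close>

definition dirichlet_eigenvalue :: "nat \<Rightarrow> 'a::euclidean_space set \<Rightarrow> real" where
  "dirichlet_eigenvalue k \<Omega> = Inf {t. enat k \<le> dirichlet_counting \<Omega> t}"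

definition mass_sphere :: "'a::euclidean_space set \<Rightarrow> ('a \<Rightarrow> real) set" where
  "mass_sphere \<Omega> = {u \<in> H10 \<Omega>. mass \<Omega> u = 1}"

definition energy_ball :: "'a::euclidean_space set \<Rightarrow> real \<Rightarrow> ('a \<Rightarrow> real) set" where
  "energy_ball \<Omega> \<alpha> = {u \<in> mass_sphere \<Omega>. energy \<Omega> u \<le> \<alpha>}"

text \<open>The sphere in \<open>m\<close>-dimensional space is the library's \<open>nsphere (m - 1)\<close>, whose points are
  functions \<open>nat \<Rightarrow> real\<close> vanishing from \<open>m\<close> on. Oddness is required almost everywhere, that is,
  as an identity in the Sobolev space.\<close>

definition genus :: "'a::euclidean_space set \<Rightarrow> ('a \<Rightarrow> real) set \<Rightarrow> enat" where
  "genus \<Omega> A = Sup {enat m | m. 1 \<le> m \<and>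
     (\<exists>h. continuous_map (nsphere (m - 1)) (subtopology (H10_topology \<Omega>) A) h \<and>
          (\<forall>x\<in>topspace (nsphere (m - 1)).
             AE y in lebesgue_on \<Omega>. h (\<lambda>i. - x i) y = - h x y))}"

definition genus_family ::
    "nat \<Rightarrow> 'a::euclidean_space set \<Rightarrow> real \<Rightarrow> ('a \<Rightarrow> real) set set" where
  "genus_family k \<Omega> \<alpha> = {A. closedin (H10_topology \<Omega>) A \<and> A \<subseteq> energy_ball \<Omega> \<alpha> \<and>
     (\<lambda>u x. - u x) ` A = A \<and> enat k \<le> genus \<Omega> A}"

definition M_level :: "nat \<Rightarrow> 'a::euclidean_space set \<Rightarrow> real \<Rightarrow> real \<Rightarrow> ennreal" where
  "M_level k \<Omega> p \<alpha> = (SUP A\<in>genus_family k \<Omega> \<alpha>. INF u\<in>A. Lq_power \<Omega> (p + 1) u)"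

text \<open>For bounded \<open>\<Omega>\<close> and \<open>\<alpha>\<close> above the \<open>k\<close>-th eigenvalue the family is nonempty (it contains the unit
  sphere of the span of the first \<open>k\<close> eigenfunctions), and by Hoelder's inequality \<open>M_level\<close>
  exceeds the subtrahend below; so the subtraction in \<^typ>\<open>ennreal\<close> is not truncated.\<close>

definition mu_hat :: "nat \<Rightarrow> 'a::euclidean_space set \<Rightarrow> real \<Rightarrow> ennreal" where
  "mu_hat k \<Omega> p = (SUP \<alpha>\<in>{dirichlet_eigenvalue k \<Omega> <..}.
     ennreal ((p + 1) / 2) * (ennreal (\<alpha> - dirichlet_eigenvalue k \<Omega>) /
       (M_level k \<Omega> p \<alpha> - ennreal (measure lebesgue \<Omega> powr (- ((p - 1) / 2))))))"

text \<open>Real powers in \<open>[0, \<infinity>]\<close>, intended for positive exponents only.\<close>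

definition ennpowr :: "ennreal \<Rightarrow> real \<Rightarrow> ennreal" where
  "ennpowr x s = (if x = \<infinity> then \<infinity> else ennreal (enn2real x powr s))"

definition rho_hat :: "nat \<Rightarrow> 'a::euclidean_space set \<Rightarrow> real \<Rightarrow> ennreal" where
  "rho_hat k \<Omega> p = ennpowr (mu_hat k \<Omega> p) (2 / (p - 1))"

text \<open>The type argument stands for Euclidean space of dimension \<open>N = DIM('a)\<close>. The powers of the
  norms are those of \<open>sqrt (energy UNIV v)\<close> and \<open>sqrt (mass UNIV v)\<close>.\<close>

definition gn_constant :: "'a::euclidean_space itself \<Rightarrow> real \<Rightarrow> ennreal" where
  "gn_constant _ p = Inf {C. \<forall>v\<in>H1 (UNIV :: 'a set).
     Lq_power UNIV (p + 1) v \<le>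
       C * ennreal (sqrt (energy UNIV v) powr (real DIM('a) * (p - 1) / 2) *
                    sqrt (mass UNIV v) powr ((p + 1) - real DIM('a) * (p - 1) / 2))}"

text \<open>The case \<open>\<beta> = 1\<close> is separate because \<open>0 powr 0 = 0\<close>, whereas the convention here is
  \<open>0\<^sup>0 = 1\<close>.\<close>

definition D_constant :: "'a::euclidean_space itself \<Rightarrow> real \<Rightarrow> ennreal" where
  "D_constant T p =
     (let \<beta> = real DIM('a) * (p - 1) / 4;
          w = (if \<beta> = 1 then 1 else (\<beta> - 1) powr (\<beta> - 1)) / \<beta> powr \<beta>
      in if \<beta> < 1 then \<infinity>
         else ennpowr (ennreal (p + 1) / (2 * gn_constant T p) * ennreal w) (2 / (p - 1)))"

end

(*
Let A have genus at least 3. The two odd functionals comparing the masses and the Dirichlet energies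
of the positive and negative parts of u have a common zero on A, by the Borsuk-Ulam theorem on the
2-sphere. For such a u both parts have mass 1/2 and energy at most alpha/2, and the
Gagliardo-Nirenberg inequality, applied to each part, bounds the integral of |u|^(p+1) by
2^(-(p-1)/2) C alpha^beta. Optimising (alpha - lambda) / alpha^beta over alpha > lambda gives the
claim when beta >= 1.

When beta < 1 one needs M_alpha = o(alpha). For a test function f and a radius r, the square of f at
points where it exceeds four times the mean value mass / |B_r| is dominated by the mean square
oscillation over B_r, whose integral is at most r^2 times the energy. Summing over dyadic levels of
|f| bounds the integral of |f|^(p+1) by K(eps) + eps * energy for every eps > 0.

No spectral theory enters: lambda = dirichlet_eigenvalue 3 is just a real number. If it is negative
then M_alpha = 0 for alpha between lambda and 0, because the family is empty, and the threshold is
infinite; if it is 0 then the right-hand side is 0, since 0 powr s = 0.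
*)
theory Submission
  imports Defs
begin

section \<open>Square integrable functions\<close>

text \<open>The two Gagliardo-Nirenberg exponents add up to p + 1. Halving mass and energy in each
  of two terms therefore gives 2 * 2^(-(p+1)/2) = 2^(-(p-1)/2) whatever the dimension, and the power
  2/(p-1) turns the reciprocal into the factor 2 of the claim.

  The inequality lives on the whole space, so each part of u has to be extended by zero, and its
  weak gradient has to be known. The positive part is therefore replaced by a C^1 function with
  Lipschitz derivative, at a scale that later tends to 0. The balanced element may change with the
  scale: only the infimum over A, a single number, passes to the limit.

  \<open>weak_grad\<close> is an arbitrary representative, so every statement about energies rests
  on almost everywhere uniqueness of weak gradients, that is, on the fundamental lemma of the
  calculus of variations.

  If the Gagliardo-Nirenberg constant is infinite and \<beta> \<ge> 1, then D is 0. For \<beta> < 1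
  the claim does not involve the constant at all, and the growth of \<open>M_level\<close> is
  bounded by a direct estimate instead.\<close>

definition sq_int :: "'a measure \<Rightarrow> ('a \<Rightarrow> 'b::euclidean_space) \<Rightarrow> bool" where
  "sq_int M f \<longleftrightarrow> f \<in> borel_measurable M \<and> integrable M (\<lambda>x. (norm (f x))\<^sup>2)"

text \<open>The measure is a parameter because the same inequalities serve on
  \<open>lebesgue_on \<Omega>\<close>, on the whole space and on a segment of the real line; the
  values are vectors so that gradients and pairs of a function with its gradient are
  covered.\<close>

definition l2norm :: "'a measure \<Rightarrow> ('a \<Rightarrow> 'b::euclidean_space) \<Rightarrow> real" where
  "l2norm M f = sqrt (LINT x|M. (norm (f x))\<^sup>2)"

lemma L2_iff_sq_int: "f \<in> L2 \<Omega> \<longleftrightarrow> sq_int (lebesgue_on \<Omega>) f"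
  by (simp add: L2_def sq_int_def)

lemma sq_int_measurable [measurable_dest]: "sq_int M f \<Longrightarrow> f \<in> borel_measurable M"
  by (simp add: sq_int_def)

lemma sq_int_integrable: "sq_int M f \<Longrightarrow> integrable M (\<lambda>x. (norm (f x))\<^sup>2)"
  by (simp add: sq_int_def)

lemma l2norm_nonneg [simp]: "l2norm M f \<ge> 0"
  by (simp add: l2norm_def)

lemma l2norm_squared: "(l2norm M f)\<^sup>2 = (LINT x|M. (norm (f x))\<^sup>2)"
  by (simp add: l2norm_def)

lemma sq_int_bound:
  assumes "sq_int M f" "g \<in> borel_measurable M" "\<And>x. x \<in> space M \<Longrightarrow> norm (g x) \<le> C * norm (f x)"
  shows "sq_int M g"
proof -
  have "integrable M (\<lambda>x. (norm (g x))\<^sup>2)"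
  proof (rule Bochner_Integration.integrable_bound)
    show "integrable M (\<lambda>x. C\<^sup>2 * (norm (f x))\<^sup>2)"
      using assms(1) by (simp add: sq_int_def)
    show "AE x in M. norm ((norm (g x))\<^sup>2) \<le> norm (C\<^sup>2 * (norm (f x))\<^sup>2)"
    proof (rule AE_I2)
      fix x assume "x \<in> space M"
      then have "(norm (g x))\<^sup>2 \<le> (C * norm (f x))\<^sup>2"
        using assms(3) by (intro power_mono) auto
      then show "norm ((norm (g x))\<^sup>2) \<le> norm (C\<^sup>2 * (norm (f x))\<^sup>2)"
        by (simp add: power_mult_distrib abs_mult)
    qed
  qed (use assms(2) in measurable)
  with assms(2) show ?thesis by (simp add: sq_int_def)
qed

lemma sq_int_add:
  assumes "sq_int M f" "sq_int M g"
  shows "sq_int M (\<lambda>x. f x + g x)"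
proof -
  have [measurable]: "f \<in> borel_measurable M" "g \<in> borel_measurable M"
    using assms by (simp_all add: sq_int_def)
  have "integrable M (\<lambda>x. (norm (f x + g x))\<^sup>2)"
  proof (rule Bochner_Integration.integrable_bound)
    show "integrable M (\<lambda>x. 2 * (norm (f x))\<^sup>2 + 2 * (norm (g x))\<^sup>2)"
      using assms by (simp add: sq_int_def)
    have "(norm (a + b))\<^sup>2 \<le> 2 * (norm a)\<^sup>2 + 2 * (norm b)\<^sup>2" for a b :: 'b
    proof -
      have "(norm (a + b))\<^sup>2 \<le> (norm a + norm b)\<^sup>2" by (intro power_mono norm_triangle_ineq) auto
      also have "\<dots> \<le> 2 * (norm a)\<^sup>2 + 2 * (norm b)\<^sup>2"
        using sum_squares_bound[of "norm a" "norm b"] by (simp add: power2_sum)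
      finally show ?thesis .
    qed
    then show "AE x in M. norm ((norm (f x + g x))\<^sup>2) \<le> norm (2 * (norm (f x))\<^sup>2 + 2 * (norm (g x))\<^sup>2)"
      by auto
  qed measurable
  then show ?thesis by (simp add: sq_int_def)
qed

lemma sq_int_minus: "sq_int M f \<Longrightarrow> sq_int M (\<lambda>x. - f x)"
  by (simp add: sq_int_def)

lemma sq_int_diff: "sq_int M f \<Longrightarrow> sq_int M g \<Longrightarrow> sq_int M (\<lambda>x. f x - g x)"
  using sq_int_add[OF _ sq_int_minus, of M f g] by simp

lemma sq_int_inner_const: "sq_int M f \<Longrightarrow> sq_int M (\<lambda>x. f x \<bullet> b)"
  by (rule sq_int_bound[where C = "norm b"])
     (auto simp: sq_int_def Cauchy_Schwarz_ineq2 mult.commute[of "norm b"])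

lemma sq_int_mult_bounded:
  fixes k :: "'a \<Rightarrow> real"
  assumes "sq_int M f" "k \<in> borel_measurable M" "\<And>x. x \<in> space M \<Longrightarrow> \<bar>k x\<bar> \<le> C"
  shows "sq_int M (\<lambda>x. k x *\<^sub>R f x)"
proof (rule sq_int_bound[OF assms(1), where C = C])
  have [measurable]: "f \<in> borel_measurable M" "k \<in> borel_measurable M"
    using assms by (simp_all add: sq_int_def)
  show "(\<lambda>x. k x *\<^sub>R f x) \<in> borel_measurable M" by measurable
qed (use assms(3) in \<open>simp add: mult_right_mono\<close>)

lemma sq_int_Pair: "sq_int M f \<Longrightarrow> sq_int M g \<Longrightarrow> sq_int M (\<lambda>x. (f x, g x))"
  by (auto simp: sq_int_def norm_Pair)

text \<open>Presents the H1 norm of a difference as the L2 norm of a pair, so that its triangle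
  inequality is the one of \<open>l2norm\<close>.\<close>

lemma l2norm_Pair:
  assumes "sq_int M f" "sq_int M g"
  shows "(l2norm M (\<lambda>x. (f x, g x)))\<^sup>2 = (l2norm M f)\<^sup>2 + (l2norm M g)\<^sup>2"
  using assms by (simp add: l2norm_squared norm_Pair sq_int_def)

lemma sq_int_norm_mult:
  assumes "sq_int M f" "sq_int M g"
  shows "integrable M (\<lambda>x. norm (f x) * norm (g x))"
proof (rule Bochner_Integration.integrable_bound)
  have [measurable]: "f \<in> borel_measurable M" "g \<in> borel_measurable M"
    using assms by (simp_all add: sq_int_def)
  show "integrable M (\<lambda>x. (norm (f x))\<^sup>2 + (norm (g x))\<^sup>2)"
    using assms by (simp add: sq_int_def)
  have "a * b \<le> a\<^sup>2 + b\<^sup>2" if "a \<ge> 0" "b \<ge> 0" for a b :: real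
    using sum_squares_bound[of a b] that mult_nonneg_nonneg[OF that] by linarith
  then show "AE x in M. norm (norm (f x) * norm (g x)) \<le> norm ((norm (f x))\<^sup>2 + (norm (g x))\<^sup>2)"
    by auto
  show "(\<lambda>x. norm (f x) * norm (g x)) \<in> borel_measurable M" by measurable
qed

lemma sq_int_inner:
  assumes "sq_int M f" "sq_int M g"
  shows "integrable M (\<lambda>x. f x \<bullet> g x)"
proof (rule Bochner_Integration.integrable_bound[OF sq_int_norm_mult[OF assms]])
  have [measurable]: "f \<in> borel_measurable M" "g \<in> borel_measurable M"
    using assms by (simp_all add: sq_int_def)
  show "(\<lambda>x. f x \<bullet> g x) \<in> borel_measurable M" by measurable
qed (auto simp: Cauchy_Schwarz_ineq2)

text \<open>Integrating 2xy \<le> x*x + y*y with free weights s and t gives \<open>key\<close>. The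
  weights s = b, t = a settle the case of positive norms; if one norm vanishes, its weight can be
  made arbitrarily large, which forces the integral to be 0.\<close>

lemma l2norm_Cauchy_Schwarz:
  assumes "sq_int M f" "sq_int M g"
  shows "(LINT x|M. norm (f x) * norm (g x)) \<le> l2norm M f * l2norm M g"
proof -
  define a b where "a = l2norm M f" and "b = l2norm M g"
  let ?I = "LINT x|M. norm (f x) * norm (g x)"
  have key: "2 * s * t * ?I \<le> s\<^sup>2 * a\<^sup>2 + t\<^sup>2 * b\<^sup>2" for s t :: real
  proof -
    have "2 * s * t * ?I = (LINT x|M. 2 * s * t * (norm (f x) * norm (g x)))" by simp
    also have "\<dots> \<le> (LINT x|M. s\<^sup>2 * (norm (f x))\<^sup>2 + t\<^sup>2 * (norm (g x))\<^sup>2)"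
    proof (rule integral_mono)
      show "integrable M (\<lambda>x. 2 * s * t * (norm (f x) * norm (g x)))"
        using sq_int_norm_mult[OF assms] by simp
      show "integrable M (\<lambda>x. s\<^sup>2 * (norm (f x))\<^sup>2 + t\<^sup>2 * (norm (g x))\<^sup>2)"
        using assms by (simp add: sq_int_def)
      show "2 * s * t * (norm (f x) * norm (g x)) \<le> s\<^sup>2 * (norm (f x))\<^sup>2 + t\<^sup>2 * (norm (g x))\<^sup>2" for x
        using sum_squares_bound[of "s * norm (f x)" "t * norm (g x)"]
        by (simp add: power_mult_distrib mult_ac)
    qed
    also have "\<dots> = s\<^sup>2 * a\<^sup>2 + t\<^sup>2 * b\<^sup>2"
      using assms by (simp add: sq_int_def a_def b_def l2norm_squared)
    finally show ?thesis .
  qed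
  have I0: "?I \<ge> 0" by (intro Bochner_Integration.integral_nonneg) auto
  have ab: "a \<ge> 0" "b \<ge> 0" by (simp_all add: a_def b_def)
  have "?I \<le> a * b"
  proof (cases "a = 0 \<or> b = 0")
    case False
    then have p: "a > 0" "b > 0" using ab by auto
    have "2 * b * a * ?I \<le> b\<^sup>2 * a\<^sup>2 + a\<^sup>2 * b\<^sup>2" by (rule key)
    then have "(a * b) * ?I \<le> (a * b) * (a * b)" by (simp add: power2_eq_square mult_ac)
    then show ?thesis using p by (simp add: mult_le_cancel_left_pos)
  next
    case True
    have "?I \<le> 0"
    proof (rule ccontr)
      assume "\<not> ?I \<le> 0"
      then have I: "?I > 0" by simp
      show False
      proof (cases "a = 0")
        case True
        \<comment> \<open>The weight is chosen to make the left side 2 * (b*b + 1), which exceeds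
          b*b.\<close>
        have "2 * ((b\<^sup>2 + 1) / ?I) * 1 * ?I \<le> 1\<^sup>2 * b\<^sup>2"
          using key[of "(b\<^sup>2 + 1) / ?I" 1] True by simp
        then have "2 * (b\<^sup>2 + 1) \<le> b\<^sup>2" using I by simp
        moreover have "b\<^sup>2 \<ge> 0" by simp
        ultimately show False by argo
      next
        case False
        with \<open>a = 0 \<or> b = 0\<close> have "b = 0" by simp
        have "2 * 1 * ((a\<^sup>2 + 1) / ?I) * ?I \<le> 1\<^sup>2 * a\<^sup>2"
          using key[of 1 "(a\<^sup>2 + 1) / ?I"] \<open>b = 0\<close> by simp
        then have "2 * (a\<^sup>2 + 1) \<le> a\<^sup>2" using I by simp
        moreover have "a\<^sup>2 \<ge> 0" by simp
        ultimately show False by argo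
      qed
    qed
    then show ?thesis using ab by (meson mult_nonneg_nonneg order_trans)
  qed
  then show ?thesis by (simp add: a_def b_def)
qed

lemma l2norm_inner_le:
  assumes "sq_int M f" "sq_int M g"
  shows "\<bar>LINT x|M. f x \<bullet> g x\<bar> \<le> l2norm M f * l2norm M g"
proof -
  have "\<bar>LINT x|M. f x \<bullet> g x\<bar> \<le> (LINT x|M. \<bar>f x \<bullet> g x\<bar>)"
    by (rule integral_abs_bound)
  also have "\<dots> \<le> (LINT x|M. norm (f x) * norm (g x))"
    using sq_int_inner[OF assms] sq_int_norm_mult[OF assms]
    by (intro integral_mono) (auto simp: Cauchy_Schwarz_ineq2)
  finally show ?thesis using l2norm_Cauchy_Schwarz[OF assms] by simp
qed

lemma l2norm_triangle:
  assumes "sq_int M f" "sq_int M g"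
  shows "l2norm M (\<lambda>x. f x + g x) \<le> l2norm M f + l2norm M g"
proof -
  have i: "integrable M (\<lambda>x. (norm (f x))\<^sup>2)" "integrable M (\<lambda>x. (norm (g x))\<^sup>2)"
    "integrable M (\<lambda>x. f x \<bullet> g x)"
    using assms sq_int_inner[OF assms] by (auto simp: sq_int_def)
  have "(l2norm M (\<lambda>x. f x + g x))\<^sup>2
      = (LINT x|M. (norm (f x))\<^sup>2 + (norm (g x))\<^sup>2 + 2 * (f x \<bullet> g x))"
    unfolding l2norm_squared
    by (intro Bochner_Integration.integral_cong)
       (auto simp: power2_norm_eq_inner inner_add inner_commute algebra_simps)
  also have "\<dots> = (l2norm M f)\<^sup>2 + (l2norm M g)\<^sup>2 + 2 * (LINT x|M. f x \<bullet> g x)"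
    using i by (simp add: l2norm_squared)
  also have "\<dots> \<le> (l2norm M f + l2norm M g)\<^sup>2"
    using l2norm_inner_le[OF assms] by (simp add: power2_sum)
  finally show ?thesis by (rule power2_le_imp_le) simp
qed

lemma l2norm_cong_AE:
  assumes "f \<in> borel_measurable M" "g \<in> borel_measurable M" "AE x in M. f x = g x"
  shows "l2norm M f = l2norm M g"
  unfolding l2norm_def using assms
  by (intro arg_cong[where f = sqrt] integral_cong_AE) auto

lemma l2norm_uminus [simp]: "l2norm M (\<lambda>x. - f x) = l2norm M f"
  by (simp add: l2norm_def)

lemma l2norm_triangle_diff:
  assumes "sq_int M f" "sq_int M g"
  shows "\<bar>l2norm M f - l2norm M g\<bar> \<le> l2norm M (\<lambda>x. f x - g x)"
proof -
  have "l2norm M f \<le> l2norm M (\<lambda>x. f x - g x) + l2norm M g"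
    using l2norm_triangle[OF sq_int_diff[OF assms] assms(2)] by simp
  moreover have "l2norm M g \<le> l2norm M (\<lambda>x. g x - f x) + l2norm M f"
    using l2norm_triangle[OF sq_int_diff[OF assms(2,1)] assms(1)] by simp
  moreover have "l2norm M (\<lambda>x. g x - f x) = l2norm M (\<lambda>x. f x - g x)"
    by (simp add: l2norm_def norm_minus_commute)
  ultimately show ?thesis by linarith
qed

lemma l2norm_mono:
  assumes "sq_int M f" "g \<in> borel_measurable M" "\<And>x. x \<in> space M \<Longrightarrow> norm (g x) \<le> norm (f x)"
  shows "l2norm M g \<le> l2norm M f"
proof -
  have "sq_int M g" using sq_int_bound[of M f g 1] assms by simp
  then show ?thesis unfolding l2norm_def using assms
    by (intro real_sqrt_le_mono integral_mono) (auto simp: sq_int_def intro: power_mono)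
qed

section \<open>Integration by parts\<close>

text \<open>The gradient and a compact set containing the support are parameters: no derivative has
  to be chosen, and products and compositions keep the compact set of the first factor.\<close>

definition C1_compact :: "('a::euclidean_space \<Rightarrow> real) \<Rightarrow> ('a \<Rightarrow> 'a) \<Rightarrow> 'a set \<Rightarrow> bool" where
  "C1_compact f g S \<longleftrightarrow> (\<forall>x. GDERIV f x :> g x) \<and> continuous_on UNIV g \<and> compact S \<and>
     (\<forall>x. x \<notin> S \<longrightarrow> f x = 0)"

text \<open>Mediates between \<open>frechet_derivative\<close>, in which
  \<open>is_weak_gradient\<close> is phrased, and the gradient vector of
  \<open>GDERIV\<close>.\<close>

definition classical_grad :: "('a::euclidean_space \<Rightarrow> real) \<Rightarrow> 'a \<Rightarrow> 'a" where
  "classical_grad f x = (\<Sum>b\<in>Basis. frechet_derivative f (at x) b *\<^sub>R b)"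

lemma classical_grad_eq:
  assumes "GDERIV f x :> D"
  shows "classical_grad f x = D"
proof -
  have "frechet_derivative f (at x) = (\<lambda>h. h \<bullet> D)"
    using frechet_derivative_at[of f "\<lambda>h. h \<bullet> D" x] assms by (simp add: gderiv_def)
  then show ?thesis
    by (simp add: classical_grad_def inner_commute[of _ D] euclidean_representation)
qed

lemma frechet_derivative_GDERIV:
  assumes "GDERIV f x :> D"
  shows "frechet_derivative f (at x) h = D \<bullet> h"
  using fun_cong[OF frechet_derivative_at[of f "\<lambda>h. h \<bullet> D" x], of h] assms
  by (simp add: gderiv_def inner_commute)

lemma GDERIV_continuous: "GDERIV f x :> D \<Longrightarrow> isCont f x"
  unfolding gderiv_def by (rule has_derivative_continuous)

lemma C1_compact_continuous:
  assumes "C1_compact f g S"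
  shows "continuous_on UNIV f"
proof (rule continuous_at_imp_continuous_on, rule ballI)
  fix x
  have "GDERIV f x :> g x" using assms by (simp add: C1_compact_def)
  then show "isCont f x" by (rule GDERIV_continuous)
qed

text \<open>The complement of \<open>S\<close> is open, so \<open>f\<close> vanishes near
  \<open>x\<close> and its derivative is that of the constant 0.\<close>

lemma C1_compact_grad_zero:
  assumes "C1_compact f g S" "x \<notin> S"
  shows "g x = 0"
proof -
  have f: "GDERIV f x :> g x" and S: "compact S" "\<And>x. x \<notin> S \<Longrightarrow> f x = 0"
    using assms by (auto simp: C1_compact_def)
  have "open (- S)" using S(1) compact_imp_closed by blast
  then have "((\<lambda>x. 0) has_derivative (\<lambda>h. h \<bullet> g x)) (at x)"
    using f S(2) assms(2) unfolding gderiv_def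
    by (elim has_derivative_transform_within_open[where s = "- S"]) auto
  then have "(\<lambda>h. h \<bullet> g x) = (\<lambda>h. 0)"
    using has_derivative_unique has_derivative_const by blast
  then have "g x \<bullet> g x = 0" by (rule fun_cong)
  then show ?thesis by simp
qed

lemma continuous_compact_support_bounded:
  fixes f :: "'a::euclidean_space \<Rightarrow> 'b::euclidean_space"
  assumes "continuous_on UNIV f" "compact S" "\<And>x. x \<notin> S \<Longrightarrow> f x = 0"
  obtains B where "B \<ge> 0" "\<And>x. norm (f x) \<le> B"
proof -
  have "bounded (f ` S)"
    using assms(1,2) by (meson compact_continuous_image compact_imp_bounded continuous_on_subset subset_UNIV)
  then obtain B where "\<And>x. x \<in> S \<Longrightarrow> norm (f x) \<le> B" by (auto simp: bounded_iff)
  then have "norm (f x) \<le> max B 0" for x using assms(3)[of x] by (cases "x \<in> S") (auto simp: le_max_iff_disj)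
  then show ?thesis using that[of "max B 0"] by auto
qed

lemma continuous_compact_support_integrable:
  fixes f :: "'a::euclidean_space \<Rightarrow> 'b::euclidean_space"
  assumes "continuous_on UNIV f" "compact S" "\<And>x. x \<notin> S \<Longrightarrow> f x = 0"
  shows "integrable lborel f"
proof -
  have "integrable lborel (\<lambda>x. indicator S x *\<^sub>R f x)"
    using assms by (intro borel_integrable_compact) (auto intro: continuous_on_subset)
  moreover have "(\<lambda>x. indicator S x *\<^sub>R f x) = f"
    using assms(3) by (auto simp: indicator_def fun_eq_iff)
  ultimately show ?thesis by simp
qed

lemma measurable_lebesgue_on_continuous:
  fixes f :: "'a::euclidean_space \<Rightarrow> 'b::euclidean_space"
  assumes "continuous_on UNIV f"
  shows "f \<in> borel_measurable (lebesgue_on \<Omega>)"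
  using assms by (intro measurable_restrict_space1 measurable_completion) (simp add: borel_measurable_continuous_onI)

lemma integrable_lebesgue_on:
  fixes f :: "'a::euclidean_space \<Rightarrow> 'b::euclidean_space"
  assumes "integrable lborel f" "\<Omega> \<in> sets lebesgue"
  shows "integrable (lebesgue_on \<Omega>) f"
proof -
  have "integrable lebesgue f"
    using assms(1) by (simp add: integrable_completion borel_measurable_integrable)
  then show ?thesis using assms(2)
    by (simp add: integrable_restrict_space integrable_mult_indicator)
qed

lemma continuous_compact_support_sq_int:
  fixes f :: "'a::euclidean_space \<Rightarrow> 'b::euclidean_space"
  assumes "continuous_on UNIV f" "compact S" "\<And>x. x \<notin> S \<Longrightarrow> f x = 0" "\<Omega> \<in> sets lebesgue"
  shows "sq_int (lebesgue_on \<Omega>) f"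
proof -
  have "integrable lborel (\<lambda>x. (norm (f x))\<^sup>2)"
    using assms by (intro continuous_compact_support_integrable[of _ S] continuous_intros) auto
  then show ?thesis
    using assms by (simp add: sq_int_def measurable_lebesgue_on_continuous integrable_lebesgue_on)
qed

lemma integral_translate_lborel:
  fixes f :: "'a::euclidean_space \<Rightarrow> 'b::euclidean_space"
  assumes "f \<in> borel_measurable borel"
  shows "(LINT x|lborel. f (c + x)) = (LINT x|lborel. f x)"
  using integral_distr[of "(+) c" lborel borel f] assms by (simp add: lborel_distr_plus)

lemma integrable_translate_lborel:
  fixes f :: "'a::euclidean_space \<Rightarrow> 'b::euclidean_space"
  assumes "integrable lborel f"
  shows "integrable lborel (\<lambda>x. f (c + x))"
  using integrable_distr[of "(+) c" lborel borel f] assms by (simp add: lborel_distr_plus)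

lemma C1_compact_Lipschitz:
  assumes "C1_compact f g S" "\<And>x. norm (g x) \<le> B"
  shows "\<bar>f x - f y\<bar> \<le> B * norm (x - y)"
proof -
  have "norm (f x - f y) \<le> B * norm (x - y)"
  proof (rule differentiable_bound[where f' = "\<lambda>x h. h \<bullet> g x" and S = UNIV])
    show "(f has_derivative (\<lambda>h. h \<bullet> g x)) (at x)" for x
      using assms(1) by (simp add: C1_compact_def gderiv_def)
    show "onorm (\<lambda>h. h \<bullet> g x) \<le> B" for x
    proof (rule onorm_bound)
      show "0 \<le> B" using assms(2)[of x] norm_ge_zero[of "g x"] by linarith
      show "norm (h \<bullet> g x) \<le> B * norm h" for h
        using Cauchy_Schwarz_ineq2[of h "g x"] mult_left_mono[OF assms(2)[of x], of "norm h"]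
        by (simp add: mult.commute)
    qed
  qed auto
  then show ?thesis by simp
qed

text \<open>Lebesgue measure is translation invariant, so every difference quotient in direction
  \<open>b\<close> has integral 0; dominated convergence carries this over to the directional
  derivative.\<close>

lemma integral_gradient_zero:
  assumes f: "C1_compact f g S"
  shows "(LINT x|lborel. g x \<bullet> b) = 0"
proof -
  have S: "compact S" and f0: "\<And>x. x \<notin> S \<Longrightarrow> f x = 0" and df: "\<And>x. GDERIV f x :> g x"
    and cg: "continuous_on UNIV g"
    using f by (auto simp: C1_compact_def)
  have cf: "continuous_on UNIV f" using C1_compact_continuous[OF f] .
  have mf [measurable]: "f \<in> borel_measurable borel" using cf by (rule borel_measurable_continuous_onI)
  have mg [measurable]: "g \<in> borel_measurable borel" using cg by (rule borel_measurable_continuous_onI)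
  obtain B where B: "B \<ge> 0" "\<And>x. norm (g x) \<le> B"
    using continuous_compact_support_bounded[OF cg S C1_compact_grad_zero[OF f]] by blast
  have fi: "integrable lborel f"
    using continuous_compact_support_integrable[OF cf S f0] .
  define t where "t n = 1 / real (Suc n)" for n
  have t: "t n > 0" "t n \<le> 1" for n by (auto simp: t_def)
  have t0: "t \<longlonglongrightarrow> 0" unfolding t_def by (rule LIMSEQ_Suc[OF lim_1_over_n])
  \<comment> \<open>All points from which a step of length at most 1 along \<open>b\<close> can
    reach \<open>S\<close>: every difference quotient vanishes outside this compact set, whose
    indicator gives the dominating function.\<close>
  define T where "T = (\<lambda>p. fst p - snd p *\<^sub>R b) ` (S \<times> {0..1::real})"
  have T: "compact T" unfolding T_def
    by (intro compact_continuous_image compact_Times S compact_Icc continuous_intros)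
  let ?s = "\<lambda>n x. (f (t n *\<^sub>R b + x) - f x) / t n"
  have "(\<lambda>n. LINT x|lborel. ?s n x) \<longlonglongrightarrow> (LINT x|lborel. g x \<bullet> b)"
  proof (rule integral_dominated_convergence[where w = "\<lambda>x. B * norm b * indicator T x"])
    show "integrable lborel (\<lambda>x. B * norm b * indicator T x)"
      using T by (auto intro!: integrable_mult_right integrable_real_indicator emeasure_compact_finite borel_compact)
    show "AE x in lborel. (\<lambda>n. ?s n x) \<longlonglongrightarrow> g x \<bullet> b"
    proof (rule AE_I2)
      fix x
      have "((\<lambda>s. f (x + s *\<^sub>R b)) has_derivative (\<lambda>s. (s *\<^sub>R b) \<bullet> g x)) (at 0)"
      proof (rule has_derivative_compose[where g = f, of _ "\<lambda>s. s *\<^sub>R b"])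
        show "((\<lambda>s. x + s *\<^sub>R b) has_derivative (\<lambda>s. s *\<^sub>R b)) (at 0)"
          by (auto intro!: derivative_eq_intros)
        show "(f has_derivative (\<lambda>h. h \<bullet> g x)) (at (x + 0 *\<^sub>R b))"
          using df[of x] by (simp add: gderiv_def)
      qed
      then have "((\<lambda>s. f (x + s *\<^sub>R b)) has_real_derivative (b \<bullet> g x)) (at 0)"
        by (rule has_derivative_imp_has_field_derivative) simp
      then have "((\<lambda>h. (f (x + h *\<^sub>R b) - f x) / h) \<longlongrightarrow> b \<bullet> g x) (at 0)"
        by (simp add: DERIV_def)
      moreover have "filterlim t (at 0) sequentially"
        unfolding filterlim_at using t0 t(1) by (auto simp: less_imp_neq[THEN not_sym] intro!: always_eventually)
      ultimately have "(\<lambda>n. (f (x + t n *\<^sub>R b) - f x) / t n) \<longlonglongrightarrow> b \<bullet> g x"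
        by (rule filterlim_compose)
      then show "(\<lambda>n. ?s n x) \<longlonglongrightarrow> g x \<bullet> b" by (simp add: add.commute inner_commute)
    qed
    show "AE x in lborel. norm (?s n x) \<le> B * norm b * indicator T x" for n
    proof (rule AE_I2)
      fix x
      have "\<bar>f (t n *\<^sub>R b + x) - f x\<bar> \<le> B * norm (t n *\<^sub>R b + x - x)"
        by (rule C1_compact_Lipschitz[OF f B(2)])
      then have 1: "\<bar>f (t n *\<^sub>R b + x) - f x\<bar> / t n \<le> B * norm b"
        using t(1)[of n] by (simp add: field_simps)
      show "norm (?s n x) \<le> B * norm b * indicator T x"
      proof (cases "x \<in> T")
        case True
        then show ?thesis using 1 t(1)[of n] by simp
      next
        case False
        have "x \<notin> S"
        proof
          assume "x \<in> S"
          then have "x - 0 *\<^sub>R b \<in> T" unfolding T_def by (intro image_eqI[of _ _ "(x, 0)"]) auto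
          with False show False by simp
        qed
        moreover have "t n *\<^sub>R b + x \<notin> S"
        proof
          assume "t n *\<^sub>R b + x \<in> S"
          then have "x \<in> T" unfolding T_def using t[of n]
            by (intro image_eqI[of _ _ "(t n *\<^sub>R b + x, t n)"]) auto
          with False show False by simp
        qed
        ultimately show ?thesis using f0 False by simp
      qed
    qed
  qed measurable
  moreover have "(LINT x|lborel. ?s n x) = 0" for n
  proof -
    have "(LINT x|lborel. f (t n *\<^sub>R b + x) - f x) = 0"
      using integral_translate_lborel[OF mf, of "t n *\<^sub>R b"] fi integrable_translate_lborel[OF fi, of "t n *\<^sub>R b"]
      by simp
    then show ?thesis by simp
  qed
  ultimately have "(\<lambda>n::nat. 0) \<longlonglongrightarrow> (LINT x|lborel. g x \<bullet> b)" by (simp only:)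
  then show ?thesis by (simp add: LIMSEQ_const_iff)
qed

lemma C1_compact_mult:
  assumes "C1_compact f g S" "C1_compact h k T"
  shows "C1_compact (\<lambda>x. f x * h x) (\<lambda>x. f x *\<^sub>R k x + h x *\<^sub>R g x) S"
  using assms C1_compact_continuous[OF assms(1)] C1_compact_continuous[OF assms(2)]
  unfolding C1_compact_def by (auto intro!: GDERIV_mult continuous_intros)

lemma integration_by_parts_C1_compact:
  assumes f: "C1_compact f g S" and h: "C1_compact h k T"
  shows "(LINT x|lborel. f x * (k x \<bullet> b)) = - (LINT x|lborel. (g x \<bullet> b) * h x)"
proof -
  have c: "continuous_on UNIV f" "continuous_on UNIV h" "continuous_on UNIV g" "continuous_on UNIV k"
    using f h C1_compact_continuous by (auto simp: C1_compact_def)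
  have z: "compact S" "\<And>x. x \<notin> S \<Longrightarrow> f x = 0" "\<And>x. x \<notin> S \<Longrightarrow> g x = 0"
    using f C1_compact_grad_zero[OF f] by (auto simp: C1_compact_def)
  have i: "integrable lborel (\<lambda>x. f x * (k x \<bullet> b))" "integrable lborel (\<lambda>x. (g x \<bullet> b) * h x)"
    using c z by (auto intro!: continuous_compact_support_integrable[of _ S] continuous_intros)
  have "0 = (LINT x|lborel. (f x *\<^sub>R k x + h x *\<^sub>R g x) \<bullet> b)"
    using integral_gradient_zero[OF C1_compact_mult[OF f h]] by simp
  also have "\<dots> = (LINT x|lborel. f x * (k x \<bullet> b) + (g x \<bullet> b) * h x)"
    by (simp add: inner_add_left mult.commute)
  also have "\<dots> = (LINT x|lborel. f x * (k x \<bullet> b)) + (LINT x|lborel. (g x \<bullet> b) * h x)"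
    using i by simp
  finally show ?thesis by simp
qed

lemma C1_compact_compose:
  assumes f: "C1_compact f g S"
    and G: "\<And>s. (G has_real_derivative G' s) (at s)" "continuous_on UNIV G'" "G 0 = 0"
  shows "C1_compact (\<lambda>x. G (f x)) (\<lambda>x. G' (f x) *\<^sub>R g x) S"
  unfolding C1_compact_def
proof (intro conjI allI impI)
  show "GDERIV (\<lambda>x. G (f x)) x :> G' (f x) *\<^sub>R g x" for x
    using f G(1) by (intro GDERIV_DERIV_compose) (auto simp: C1_compact_def)
  have "continuous_on UNIV (G' \<circ> f)"
    using C1_compact_continuous[OF f] G(2) by (intro continuous_on_compose) (auto intro: continuous_on_subset)
  then show "continuous_on UNIV (\<lambda>x. G' (f x) *\<^sub>R g x)"
    using f by (auto simp: C1_compact_def o_def intro!: continuous_intros)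
qed (use f G(3) in \<open>auto simp: C1_compact_def\<close>)

lemma test_function_C1_compact:
  assumes "\<phi> \<in> test_functions \<Omega>"
  shows "C1_compact \<phi> (classical_grad \<phi>) (closure {x. \<phi> x \<noteq> 0})"
proof -
  have "C_k (Suc 0) \<phi>" using assms by (auto simp: test_functions_def)
  then obtain g where g: "\<And>x. GDERIV \<phi> x :> g x" "\<And>b. b \<in> Basis \<Longrightarrow> continuous_on UNIV (\<lambda>x. g x \<bullet> b)"
    by auto
  have "classical_grad \<phi> = g" using classical_grad_eq[OF g(1)] by (simp add: fun_eq_iff)
  moreover have "continuous_on UNIV g" using g(2) by (rule continuous_on_componentwise[THEN iffD2, rule_format])
  ultimately show ?thesis using g(1) assms closure_subset[of "{x. \<phi> x \<noteq> 0}"]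
    by (auto simp: C1_compact_def test_functions_def)
qed

lemma test_function_frechet_derivative:
  assumes "\<phi> \<in> test_functions \<Omega>"
  shows "frechet_derivative \<phi> (at x) h = classical_grad \<phi> x \<bullet> h"
  using test_function_C1_compact[OF assms] by (intro frechet_derivative_GDERIV) (simp add: C1_compact_def)

lemma test_function_zero:
  assumes "\<phi> \<in> test_functions \<Omega>" "x \<notin> \<Omega>"
  shows "\<phi> x = 0" "classical_grad \<phi> x = 0"
proof -
  have x: "x \<notin> closure {x. \<phi> x \<noteq> 0}" using assms by (auto simp: test_functions_def)
  show "\<phi> x = 0"
    using x closure_subset[of "{x. \<phi> x \<noteq> 0}"] by blast
  show "classical_grad \<phi> x = 0"
    by (rule C1_compact_grad_zero[OF test_function_C1_compact[OF assms(1)] x])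
qed

lemma test_function_sq_int:
  assumes "\<phi> \<in> test_functions U" "\<Omega> \<in> sets lebesgue"
  shows "sq_int (lebesgue_on \<Omega>) \<phi>" "sq_int (lebesgue_on \<Omega>) (classical_grad \<phi>)"
proof -
  note t = test_function_C1_compact[OF assms(1)]
  let ?S = "closure {x. \<phi> x \<noteq> 0}"
  have S: "compact ?S" "continuous_on UNIV (classical_grad \<phi>)" "\<And>x. x \<notin> ?S \<Longrightarrow> \<phi> x = 0"
    using t unfolding C1_compact_def by blast+
  show "sq_int (lebesgue_on \<Omega>) \<phi>"
    by (rule continuous_compact_support_sq_int[OF C1_compact_continuous[OF t] S(1) S(3) assms(2)])
  show "sq_int (lebesgue_on \<Omega>) (classical_grad \<phi>)"
    by (rule continuous_compact_support_sq_int[OF S(2) S(1) C1_compact_grad_zero[OF t] assms(2)])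
qed

lemma integral_lebesgue_on_eq_lborel:
  fixes f :: "'a::euclidean_space \<Rightarrow> real"
  assumes "f \<in> borel_measurable borel" "\<Omega> \<in> sets lebesgue" "\<And>x. x \<notin> \<Omega> \<Longrightarrow> f x = 0"
  shows "(LINT x|lebesgue_on \<Omega>. f x) = (LINT x|lborel. f x)"
proof -
  have "(LINT x|lebesgue_on \<Omega>. f x) = (LINT x|lebesgue. indicator \<Omega> x *\<^sub>R f x)"
    using assms(2) by (subst integral_restrict_space) auto
  also have "(\<lambda>x. indicator \<Omega> x *\<^sub>R f x) = f" using assms(3) by (auto simp: indicator_def fun_eq_iff)
  finally show ?thesis using assms(1) by (simp add: integral_completion)
qed

section \<open>The fundamental lemma of the calculus of variations\<close>

definition flat_fun :: "nat \<Rightarrow> real \<Rightarrow> real" where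
  "flat_fun m t = (if t > 0 then exp (- inverse t) * inverse t ^ m else 0)"

lemma flat_fun_at_right_0: "(flat_fun m \<longlongrightarrow> 0) (at_right 0)"
proof -
  have "((\<lambda>t. (inverse t) ^ m / exp (inverse t)) \<longlongrightarrow> 0) (at_right (0::real))"
    by (rule filterlim_compose[OF tendsto_power_div_exp_0 filterlim_inverse_at_top_right])
  then show ?thesis
    by (rule Lim_transform_eventually)
       (auto simp: eventually_at_right_less flat_fun_def exp_minus field_simps
          intro!: eventually_mono[OF eventually_at_right_less[of 0]])
qed

text \<open>The factor 1/t^m in \<open>flat_fun\<close> makes the family closed under
  differentiation up to linear combinations, so smoothness of exp (-1/t) becomes an induction that
  generalises over \<open>m\<close>.\<close>

lemma flat_fun_DERIV:
  "(flat_fun m has_real_derivative flat_fun (m + 2) t - real m * flat_fun (m + 1) t) (at t)"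
proof -
  consider "t > 0" | "t < 0" | "t = 0" by linarith
  then show ?thesis
  proof cases
    case 1
    have "((\<lambda>t. exp (- inverse t) * inverse t ^ m) has_real_derivative
        flat_fun (m + 2) t - real m * flat_fun (m + 1) t) (at t)"
    proof -
      have i: "(inverse has_real_derivative - (inverse t)\<^sup>2) (at t)"
        using DERIV_inverse[of t UNIV] 1 by (simp add: power2_eq_square)
      have e: "((\<lambda>t. exp (- inverse t)) has_real_derivative exp (- inverse t) * (inverse t)\<^sup>2) (at t)"
        using DERIV_fun_exp[OF DERIV_minus[OF i]] by simp
      show ?thesis
      proof (cases m)
        case 0
        with 1 e show ?thesis by (simp add: flat_fun_def power2_eq_square)
      next
        case (Suc k)
        show ?thesis unfolding Suc
          by (rule DERIV_cong[OF DERIV_mult[OF e DERIV_power_Suc[OF i]]])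
             (use 1 in \<open>simp add: flat_fun_def power2_eq_square algebra_simps\<close>)
      qed
    qed
    then show ?thesis
      by (rule DERIV_cong_ev[THEN iffD1, rotated -1, OF _ refl _ refl])
         (use 1 in \<open>auto simp: flat_fun_def intro!: eventually_nhds_in_open[of "{0<..}", THEN eventually_mono]\<close>)
  next
    case 2
    have "((\<lambda>t. 0) has_real_derivative flat_fun (m + 2) t - real m * flat_fun (m + 1) t) (at t)"
      using 2 by (simp add: flat_fun_def)
    then show ?thesis
      by (rule DERIV_cong_ev[THEN iffD1, rotated -1, OF _ refl _ refl])
         (use 2 in \<open>auto simp: flat_fun_def intro!: eventually_nhds_in_open[of "{..<0}", THEN eventually_mono]\<close>)
  next
    case 3
    \<comment> \<open>For h > 0 the difference quotient at 0 is \<open>flat_fun (Suc m) h\<close>,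
      so the one limit lemma for all indices gives the derivative 0.\<close>
    have R: "((\<lambda>h. flat_fun m h / h) \<longlongrightarrow> 0) (at_right 0)"
      by (rule Lim_transform_eventually[OF flat_fun_at_right_0[of "Suc m"]])
         (auto simp: flat_fun_def field_simps intro!: eventually_mono[OF eventually_at_right_less[of 0]])
    have L: "((\<lambda>h. flat_fun m h / h) \<longlongrightarrow> 0) (at_left 0)"
      by (rule tendsto_eventually)
         (auto simp: flat_fun_def eventually_at_left_field intro!: exI[of _ "-1"])
    have "((\<lambda>h. flat_fun m h / h) \<longlongrightarrow> 0) (at 0)"
      using L R by (simp add: filterlim_split_at)
    then show ?thesis using 3 by (simp add: DERIV_def flat_fun_def)
  qed
qed

lemma C_k_SucI:
  "(\<And>x. GDERIV f x :> f' x) \<Longrightarrow> (\<And>b. b \<in> Basis \<Longrightarrow> C_k k (\<lambda>x. f' x \<bullet> b)) \<Longrightarrow> C_k (Suc k) f"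
  by (simp only: C_k.simps(2)) blast

lemma C_k_SucE:
  assumes "C_k (Suc k) f"
  obtains f' where "\<And>x. GDERIV f x :> f' x" "\<And>b. b \<in> Basis \<Longrightarrow> C_k k (\<lambda>x. f' x \<bullet> b)"
  using assms by (simp only: C_k.simps(2)) blast

lemma C_k_const: "C_k k (\<lambda>x. c)"
proof (induction k arbitrary: c)
  case (Suc k)
  show ?case using Suc[of 0] by (auto intro!: exI[of _ "\<lambda>x. 0"] GDERIV_const)
qed simp

lemma C_k_add: "C_k k f \<Longrightarrow> C_k k g \<Longrightarrow> C_k k (\<lambda>x. f x + g x)"
proof (induction k arbitrary: f g)
  case 0
  then show ?case by (auto intro: continuous_intros)
next
  case (Suc k)
  obtain f' where f: "\<And>x. GDERIV f x :> f' x" "\<And>b. b \<in> Basis \<Longrightarrow> C_k k (\<lambda>x. f' x \<bullet> b)"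
    using Suc.prems C_k_SucE by blast
  obtain g' where g: "\<And>x. GDERIV g x :> g' x" "\<And>b. b \<in> Basis \<Longrightarrow> C_k k (\<lambda>x. g' x \<bullet> b)"
    using Suc.prems C_k_SucE by blast
  show ?case
    by (rule C_k_SucI[OF GDERIV_add[OF f(1) g(1)]]) (simp add: inner_add_left Suc.IH f(2) g(2))
qed

lemma C_k_Suc_imp: "C_k (Suc k) f \<Longrightarrow> C_k k f"
proof (induction k arbitrary: f)
  case 0
  then obtain f' where "\<And>x. GDERIV f x :> f' x" by auto
  then have "isCont f x" for x using GDERIV_continuous by blast
  then show ?case by (simp add: continuous_at_imp_continuous_on)
next
  case (Suc k)
  obtain f' where f: "\<And>x. GDERIV f x :> f' x" "\<And>b. b \<in> Basis \<Longrightarrow> C_k (Suc k) (\<lambda>x. f' x \<bullet> b)"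
    using Suc.prems C_k_SucE by blast
  then show ?case using Suc.IH[OF f(2)] by (intro C_k_SucI)
qed

lemma C_k_mult: "C_k k f \<Longrightarrow> C_k k g \<Longrightarrow> C_k k (\<lambda>x. f x * g x)"
proof (induction k arbitrary: f g)
  case 0
  then show ?case by (auto intro: continuous_intros)
next
  case (Suc k)
  obtain f' where f: "\<And>x. GDERIV f x :> f' x" "\<And>b. b \<in> Basis \<Longrightarrow> C_k k (\<lambda>x. f' x \<bullet> b)"
    using Suc.prems C_k_SucE by blast
  obtain g' where g: "\<And>x. GDERIV g x :> g' x" "\<And>b. b \<in> Basis \<Longrightarrow> C_k k (\<lambda>x. g' x \<bullet> b)"
    using Suc.prems C_k_SucE by blast
  have k: "C_k k f" "C_k k g" using Suc.prems C_k_Suc_imp by blast+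
  have "GDERIV (\<lambda>x. f x * g x) x :> f x *\<^sub>R g' x + g x *\<^sub>R f' x" for x
    using f(1) g(1) by (rule GDERIV_mult)
  moreover have "C_k k (\<lambda>x. (f x *\<^sub>R g' x + g x *\<^sub>R f' x) \<bullet> b)" if "b \<in> Basis" for b
    using Suc.IH[OF k(1) g(2)[OF that]] Suc.IH[OF k(2) f(2)[OF that]]
    by (simp add: inner_add_left C_k_add)
  ultimately show ?case by (intro C_k_SucI)
qed

lemma C_k_prod: "(\<And>i. i \<in> I \<Longrightarrow> C_k k (f i)) \<Longrightarrow> C_k k (\<lambda>x. \<Prod>i\<in>I. f i x)"
  by (induction I rule: infinite_finite_induct) (auto intro: C_k_mult C_k_const)

text \<open>A box is an intersection of half-spaces, so composition with an affine functional is the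
  form that its bumps are built from.\<close>

lemma C_k_flat_fun: "C_k k (\<lambda>x. flat_fun m (x \<bullet> v + d))"
proof (induction k arbitrary: m)
  case 0
  have "continuous_on UNIV (flat_fun m)"
    by (intro continuous_at_imp_continuous_on ballI DERIV_isCont[OF flat_fun_DERIV])
  then have "continuous_on UNIV (flat_fun m \<circ> (\<lambda>x. x \<bullet> v + d))"
    by (intro continuous_on_compose continuous_intros) (auto intro: continuous_on_subset)
  then show ?case by (simp add: o_def)
next
  case (Suc k)
  let ?d = "\<lambda>x. flat_fun (m + 2) (x \<bullet> v + d) - real m * flat_fun (m + 1) (x \<bullet> v + d)"
  have "GDERIV (\<lambda>x. flat_fun m (x \<bullet> v + d)) x :> ?d x *\<^sub>R v" for x
  proof (rule GDERIV_DERIV_compose[where g = "flat_fun m"])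
    show "GDERIV (\<lambda>x. x \<bullet> v + d) x :> v"
      by (auto simp: gderiv_def intro!: derivative_eq_intros)
  qed (rule flat_fun_DERIV)
  moreover have "C_k k (\<lambda>x. (?d x *\<^sub>R v) \<bullet> b)" for b
  proof -
    have "C_k k (\<lambda>x. flat_fun (m + 2) (x \<bullet> v + d) * (v \<bullet> b)
        + flat_fun (m + 1) (x \<bullet> v + d) * (- real m * (v \<bullet> b)))"
      by (intro C_k_add C_k_mult C_k_const Suc.IH)
    then show ?thesis by (simp add: algebra_simps)
  qed
  ultimately show ?case by (intro C_k_SucI)
qed

text \<open>A product of one flat function per face. The factor \<open>n\<close> steepens them: exp
  (-1/(n t)) tends to 1 for every t > 0, so the bumps stay below the indicator of the open box and
  converge to it.\<close>

definition box_bump :: "'a::euclidean_space \<Rightarrow> 'a \<Rightarrow> nat \<Rightarrow> 'a \<Rightarrow> real" where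
  "box_bump a c n x = (\<Prod>b\<in>Basis. flat_fun 0 (real n * (x \<bullet> b - a \<bullet> b)) *
     flat_fun 0 (real n * (c \<bullet> b - x \<bullet> b)))"

lemma flat_fun_0_bounds: "0 \<le> flat_fun 0 t" "flat_fun 0 t \<le> 1"
  by (auto simp: flat_fun_def)

lemma box_bump_bounds: "0 \<le> box_bump a c n x" "box_bump a c n x \<le> 1"
  unfolding box_bump_def using flat_fun_0_bounds
  by (auto intro!: prod_nonneg prod_le_1 mult_le_one)

lemma box_bump_outside:
  assumes "x \<notin> box a c"
  shows "box_bump a c n x = 0"
proof -
  obtain b where "b \<in> Basis" "x \<bullet> b \<le> a \<bullet> b \<or> c \<bullet> b \<le> x \<bullet> b"
    using assms by (auto simp: mem_box not_less)
  then have "flat_fun 0 (real n * (x \<bullet> b - a \<bullet> b)) * flat_fun 0 (real n * (c \<bullet> b - x \<bullet> b)) = 0"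
    by (auto simp: flat_fun_def zero_less_mult_iff)
  with \<open>b \<in> Basis\<close> show ?thesis unfolding box_bump_def by (auto intro: prod_zero)
qed

lemma box_bump_tendsto: "(\<lambda>n. box_bump a c n x) \<longlonglongrightarrow> indicator (box a c) x"
proof (cases "x \<in> box a c")
  case False
  then show ?thesis by (simp add: box_bump_outside)
next
  case True
  have 1: "(\<lambda>n. flat_fun 0 (real n * t)) \<longlonglongrightarrow> 1" if "t > 0" for t
  proof -
    have "(\<lambda>n. exp (- (inverse t * inverse (real n)))) \<longlonglongrightarrow> exp (- (inverse t * 0))"
      by (intro tendsto_intros LIMSEQ_inverse_real_of_nat[THEN LIMSEQ_imp_Suc])
    then have "(\<lambda>n. exp (- (inverse t * inverse (real n)))) \<longlonglongrightarrow> 1" by simp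
    then show ?thesis
      by (rule Lim_transform_eventually)
         (auto simp: flat_fun_def that eventually_sequentially mult.commute intro!: exI[of _ 1])
  qed
  have "(\<lambda>n. box_bump a c n x) \<longlonglongrightarrow> (\<Prod>b\<in>(Basis::'a set). 1 * 1)"
    unfolding box_bump_def using True by (intro tendsto_prod tendsto_mult 1) (auto simp: mem_box)
  then show ?thesis using True by simp
qed

lemma box_bump_test_function:
  assumes "cbox a c \<subseteq> \<Omega>"
  shows "box_bump a c n \<in> test_functions \<Omega>"
proof -
  have eq: "box_bump a c n = (\<lambda>x. \<Prod>b\<in>Basis. flat_fun 0 (x \<bullet> (real n *\<^sub>R b) + (- real n * (a \<bullet> b))) *
      flat_fun 0 (x \<bullet> (- real n *\<^sub>R b) + real n * (c \<bullet> b)))"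
    by (simp add: box_bump_def fun_eq_iff algebra_simps)
  have "C_k k (box_bump a c n)" for k
    unfolding eq by (intro C_k_prod C_k_mult C_k_flat_fun)
  moreover have "{x. box_bump a c n x \<noteq> 0} \<subseteq> cbox a c"
    using box_bump_outside box_subset_cbox by blast
  then have "closure {x. box_bump a c n x \<noteq> 0} \<subseteq> cbox a c"
    by (rule closure_minimal) (rule closed_cbox)
  then have "compact (closure {x. box_bump a c n x \<noteq> 0})" "closure {x. box_bump a c n x \<noteq> 0} \<subseteq> \<Omega>"
    using assms by (auto simp: compact_eq_bounded_closed intro: bounded_subset[OF bounded_cbox])
  ultimately show ?thesis by (simp add: test_functions_def)
qed

text \<open>Boxes are stable under intersection and generate the Borel sets, and the sets over which
  \<open>f\<close> integrates to 0 form a Dynkin system. A density is determined almost everywhere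
  by its integrals over Borel sets.\<close>

lemma integral_zero_on_boxes_AE:
  fixes f :: "'a::euclidean_space \<Rightarrow> real"
  assumes f: "integrable lborel f" and box: "\<And>a b. (LINT x:box a b|lborel. f x) = 0"
  shows "AE x in lborel. f x = 0"
proof (rule density_unique_real[where f' = "\<lambda>_. 0", OF f])
  have si: "set_integrable lborel A f" if "A \<in> sets borel" for A
    using f that unfolding set_integrable_def by (intro integrable_mult_indicator) auto
  \<comment> \<open>The whole space is not a box but a limit of growing ones; its integral is needed
    for complements.\<close>
  have univ: "(LINT x|lborel. f x) = 0"
  proof -
    have "(\<lambda>n::nat. LINT x|lborel. indicator (box (- (real n *\<^sub>R One)) (real n *\<^sub>R One)) x *\<^sub>R f x)
        \<longlonglongrightarrow> (LINT x|lborel. f x)"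
    proof (rule integral_dominated_convergence[where w = "\<lambda>x. norm (f x)"])
      show "AE x in lborel. (\<lambda>n::nat. indicator (box (- (real n *\<^sub>R One)) (real n *\<^sub>R One)) x *\<^sub>R f x)
          \<longlonglongrightarrow> f x"
      proof (rule AE_I2)
        fix x :: 'a
        obtain N :: nat where N: "norm x < real N" using reals_Archimedean2 by blast
        have "x \<in> box (- (real n *\<^sub>R One)) (real n *\<^sub>R One)" if "n \<ge> N" for n
          unfolding mem_box
        proof
          fix i :: 'a assume i: "i \<in> Basis"
          have "\<bar>x \<bullet> i\<bar> < real n" using Basis_le_norm[OF i, of x] N that by linarith
          then show "- (real n *\<^sub>R One) \<bullet> i < x \<bullet> i \<and> x \<bullet> i < real n *\<^sub>R One \<bullet> i"
            using i by auto
        qed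
        then show "(\<lambda>n::nat. indicator (box (- (real n *\<^sub>R One)) (real n *\<^sub>R One)) x *\<^sub>R f x) \<longlonglongrightarrow> f x"
          by (intro tendsto_eventually) (auto simp: eventually_sequentially intro!: exI[of _ N])
      qed
    qed (use f in \<open>auto simp: indicator_def\<close>)
    moreover have "(LINT x|lborel. indicator (box (- (real n *\<^sub>R One)) (real n *\<^sub>R One)) x *\<^sub>R f x) = 0" for n :: nat
      using box unfolding set_lebesgue_integral_def by blast
    ultimately have "(\<lambda>n::nat. 0) \<longlonglongrightarrow> (LINT x|lborel. f x)" by (simp only:)
    then show ?thesis by (simp add: LIMSEQ_const_iff)
  qed
  fix A assume "A \<in> sets (lborel :: 'a measure)"
  then have A: "A \<in> sigma_sets UNIV (range (\<lambda>(a, b). box a b :: 'a set))"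
    by (simp add: borel_eq_box)
  have sb: "X \<in> sets borel" if "X \<in> sigma_sets UNIV (range (\<lambda>(a, b). box a b :: 'a set))" for X
    using that by (simp add: borel_eq_box)
  have "(LINT x:A|lborel. f x) = 0"
  proof (rule sigma_sets_induct_disjoint[OF _ _ A])
    show "Int_stable (range (\<lambda>(a, b). box a b :: 'a set))"
      by (auto simp: Int_stable_def box_Int_box)
    show "(LINT x:X|lborel. f x) = 0" if "X \<in> range (\<lambda>(a, b). box a b)" for X
      using that box by auto
    show "(LINT x:UNIV - X|lborel. f x) = 0"
      if X: "X \<in> sigma_sets UNIV (range (\<lambda>(a, b). box a b))" and 0: "(LINT x:X|lborel. f x) = 0" for X
    proof -
      have "(LINT x:(UNIV - X) \<union> X|lborel. f x) = (LINT x:UNIV - X|lborel. f x) + (LINT x:X|lborel. f x)"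
        using sb[OF X] by (intro set_integral_Un si) auto
      then show ?thesis using 0 univ by (simp add: set_lebesgue_integral_def)
    qed
    show "(LINT x:(\<Union>i. X i)|lborel. f x) = 0"
      if "disjoint_family X" "range X \<subseteq> sigma_sets UNIV (range (\<lambda>(a, b). box a b))"
        and 0: "\<And>i. (LINT x:X i|lborel. f x) = 0" for X :: "nat \<Rightarrow> 'a set"
    proof -
      have X: "X i \<in> sets borel" for i using that(2) sb by blast
      have "(LINT x:(\<Union>i. X i)|lborel. f x) = suminf (\<lambda>i. LINT x:X i|lborel. f x)"
        using X that(1) by (intro lebesgue_integral_countable_add si) (auto simp: disjoint_family_on_def)
      then show ?thesis using 0 by simp
    qed
  qed (auto simp: set_lebesgue_integral_def)
  then show "(LINT x:A|lborel. f x) = (LINT x:A|lborel. 0)"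
    by (simp add: set_lebesgue_integral_def)
qed simp

text \<open>Bumps on a box whose closure lies in \<Omega> are test functions, so \<open>f\<close>
  integrates to 0 over all such boxes. This gives vanishing almost everywhere inside each of them,
  and countably many exhaust \<Omega> up to a null set.\<close>

lemma fundamental_lemma_variations:
  fixes f :: "'a::euclidean_space \<Rightarrow> real"
  assumes \<Omega>: "open \<Omega>" and f: "sq_int (lebesgue_on \<Omega>) f"
    and zero: "\<And>\<phi>. \<phi> \<in> test_functions \<Omega> \<Longrightarrow> (LINT x|lebesgue_on \<Omega>. f x * \<phi> x) = 0"
  shows "AE x in lebesgue_on \<Omega>. f x = 0"
proof -
  have \<Omega>m: "\<Omega> \<in> sets lebesgue" using \<Omega> by simp
  have mf [measurable]: "f \<in> borel_measurable (lebesgue_on \<Omega>)" using f by (simp add: sq_int_def)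
  have ibox: "integrable (lebesgue_on \<Omega>) (\<lambda>x. indicator (box a c) x * f x)" for a c :: 'a
  proof -
    have "sq_int (lebesgue_on \<Omega>) (\<lambda>x. indicator (box a c) x :: real)"
    proof -
      have "integrable lborel (indicator (box a c) :: 'a \<Rightarrow> real)"
        by (intro integrable_real_indicator emeasure_bounded_finite bounded_box) auto
      then have i: "integrable (lebesgue_on \<Omega>) (indicator (box a c) :: 'a \<Rightarrow> real)"
        by (rule integrable_lebesgue_on[OF _ \<Omega>m])
      moreover have "(\<lambda>x. (norm (indicator (box a c) x :: real))\<^sup>2) = indicator (box a c)"
        by (auto simp: indicator_def)
      ultimately show ?thesis unfolding sq_int_def by (simp only: borel_measurable_integrable)
    qed
    from sq_int_inner[OF this f] show ?thesis by simp
  qed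
  have box0: "(LINT x|lebesgue_on \<Omega>. indicator (box a c) x * f x) = 0" if ac: "cbox a c \<subseteq> \<Omega>" for a c
  proof -
    have "(\<lambda>n. LINT x|lebesgue_on \<Omega>. f x * box_bump a c n x) \<longlonglongrightarrow>
        (LINT x|lebesgue_on \<Omega>. indicator (box a c) x * f x)"
    proof (rule integral_dominated_convergence[where w = "\<lambda>x. norm (indicator (box a c) x * f x)"])
      show "AE x in lebesgue_on \<Omega>. (\<lambda>n. f x * box_bump a c n x) \<longlonglongrightarrow> indicator (box a c) x * f x"
      proof (rule AE_I2)
        fix x
        have "(\<lambda>n. f x * box_bump a c n x) \<longlonglongrightarrow> f x * indicator (box a c) x"
          by (intro tendsto_mult tendsto_const box_bump_tendsto)
        then show "(\<lambda>n. f x * box_bump a c n x) \<longlonglongrightarrow> indicator (box a c) x * f x"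
          by (subst mult.commute[of "indicator (box a c) x"])
      qed
      show "AE x in lebesgue_on \<Omega>. norm (f x * box_bump a c n x) \<le> norm (indicator (box a c) x * f x)" for n
      proof (rule AE_I2)
        fix x
        show "norm (f x * box_bump a c n x) \<le> norm (indicator (box a c) x * f x)"
          using box_bump_bounds[of a c n x] box_bump_outside[of x a c n]
          by (auto simp: indicator_def abs_mult mult_left_le)
      qed
      show "(\<lambda>x. f x * box_bump a c n x) \<in> borel_measurable (lebesgue_on \<Omega>)" for n
        using test_function_sq_int(1)[OF box_bump_test_function[OF ac] \<Omega>m]
        by (intro borel_measurable_times mf sq_int_measurable)
    qed (use ibox in auto)
    moreover have "(LINT x|lebesgue_on \<Omega>. f x * box_bump a c n x) = 0" for n
      using zero[OF box_bump_test_function[OF ac]] .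
    ultimately have "(\<lambda>n::nat. 0) \<longlonglongrightarrow> (LINT x|lebesgue_on \<Omega>. indicator (box a c) x * f x)"
      by (simp only:)
    then show ?thesis by (simp add: LIMSEQ_const_iff)
  qed
  have loc: "AE x in lebesgue. x \<in> box a c \<longrightarrow> f x = 0" if ac: "cbox a c \<subseteq> \<Omega>" for a c
  proof -
    define h where "h x = indicator (box a c) x * f x" for x
    have sub: "box a c \<subseteq> \<Omega>" using ac box_subset_cbox by blast
    have hI: "(\<lambda>x. indicator \<Omega> x *\<^sub>R h x) = h" using sub by (auto simp: h_def indicator_def fun_eq_iff)
    have "integrable lebesgue h"
      using ibox[of a c] \<Omega>m hI by (simp add: integrable_restrict_space flip: h_def)
    then have hm: "h \<in> borel_measurable (completion lborel)" and hi: "integrable (completion lborel) h" by auto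
    \<comment> \<open>\<open>h\<close> is merely Lebesgue measurable; the argument over boxes is
      carried out for a Borel representative.\<close>
    obtain k where k [measurable]: "k \<in> borel_measurable lborel" and hk: "AE x in lborel. h x = k x"
      using completion_ex_borel_measurable_real[OF hm] by blast
    have hk': "AE x in lebesgue. h x = k x" using hk by (rule AE_completion)
    have kc: "k \<in> borel_measurable lebesgue" using k by (rule measurable_completion)
    have "integrable lebesgue k"
      using hi hk' kc integrable_cong_AE[OF hm kc] by simp
    then have ki: "integrable lborel k" using k by (simp add: integrable_completion)
    have "AE x in lborel. k x = 0"
    proof (rule integral_zero_on_boxes_AE[OF ki])
      fix u v :: 'a
      \<comment> \<open>Multiplying by the indicator of the inner box reduces an arbitrary box to
        its intersection with the inner one, which is empty or again a box with closure in
        \<Omega>.\<close>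
      obtain a' c' where b: "box u v \<inter> box a c = box a' c'" using box_Int_box[of u v a c] by blast
      have "(LINT x|lebesgue_on \<Omega>. indicator (box a' c') x * f x) = 0"
      proof (cases "box a' c' = {}")
        case True
        then show ?thesis by simp
      next
        case False
        have "cbox a' c' = closure (box a' c')" using False by (simp add: closure_box)
        also have "\<dots> \<subseteq> cbox a c" using b box_subset_cbox[of a c]
          by (intro closure_minimal closed_cbox) blast
        finally show ?thesis using box0 ac by blast
      qed
      moreover have "(LINT x|lebesgue_on \<Omega>. indicator (box a' c') x * f x)
          = (LINT x|lebesgue. indicator \<Omega> x *\<^sub>R (indicator (box a' c') x * f x))"
        using \<Omega>m by (subst integral_restrict_space) auto
      moreover have "(\<lambda>x. indicator \<Omega> x *\<^sub>R (indicator (box a' c') x * f x)) = (\<lambda>x. indicator (box u v) x * h x)"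
        using sub unfolding b[symmetric] by (auto simp: h_def indicator_def fun_eq_iff)
      moreover have "(LINT x|lebesgue. indicator (box u v) x * h x) = (LINT x|lebesgue. indicator (box u v) x * k x)"
      proof (rule integral_cong_AE)
        have [measurable]: "box u v \<in> sets lebesgue" by simp
        show "(\<lambda>x. indicator (box u v) x * h x) \<in> borel_measurable lebesgue"
          "(\<lambda>x. indicator (box u v) x * k x) \<in> borel_measurable lebesgue"
          using hm kc by measurable
      qed (use hk' in auto)
      moreover have "(LINT x|lebesgue. indicator (box u v) x * k x) = (LINT x|lborel. indicator (box u v) x * k x)"
        by (rule integral_completion) measurable
      ultimately show "(LINT x:box u v|lborel. k x) = 0" by (simp add: set_lebesgue_integral_def)
    qed
    then have "AE x in lebesgue. k x = 0" by (rule AE_completion)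
    with hk' show ?thesis by eventually_elim (auto simp: h_def)
  qed
  \<comment> \<open>The open set is a countable union of closed boxes; passing to their interiors
    loses only faces, which are null sets.\<close>
  obtain \<D> where D: "countable \<D>" "\<D> \<subseteq> Pow \<Omega>" "\<And>X. X \<in> \<D> \<Longrightarrow> \<exists>a b. X = cbox a b" "\<Union>\<D> = \<Omega>"
    by (rule open_countable_Union_open_cbox[OF \<Omega>]) blast
  have "AE x in lebesgue. x \<in> X \<longrightarrow> f x = 0" if X: "X \<in> \<D>" for X
  proof -
    obtain a b where ab: "X = cbox a b" using D(3)[OF X] by blast
    have "AE x in lebesgue. x \<in> box a b \<longrightarrow> f x = 0" using D(2) X ab by (intro loc) blast
    moreover have "AE x in lebesgue. x \<notin> cbox a b - box a b"
    proof (rule AE_not_in)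
      have "negligible (cbox a b - box a b)" by (rule negligible_frontier_interval)
      then show "cbox a b - box a b \<in> null_sets lebesgue" by (simp add: negligible_iff_null_sets)
    qed
    ultimately show ?thesis unfolding ab by eventually_elim blast
  qed
  then have "AE x in lebesgue. \<forall>X\<in>\<D>. x \<in> X \<longrightarrow> f x = 0"
    unfolding AE_ball_countable[OF D(1)] by blast
  then have "AE x in lebesgue. x \<in> \<Omega> \<longrightarrow> f x = 0"
    using D(4) by (auto elim: eventually_mono)
  then show ?thesis using \<Omega>m by (subst AE_restrict_space_iff) auto
qed

section \<open>Weak gradients and the Sobolev topology\<close>

text \<open>\<open>weak_grad\<close> is chosen by \<open>SOME\<close>; this uniqueness is what
  allows an energy to be computed from any explicit weak gradient, as in
  \<open>H1_weak_gradI\<close>. Each coordinate of the difference is orthogonal to all test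
  functions.\<close>

lemma is_weak_gradient_unique:
  assumes \<Omega>: "open \<Omega>" and g: "g \<in> L2 \<Omega>" "is_weak_gradient \<Omega> u g"
    and h: "h \<in> L2 \<Omega>" "is_weak_gradient \<Omega> u h"
  shows "AE x in lebesgue_on \<Omega>. g x = h x"
proof -
  have gs: "sq_int (lebesgue_on \<Omega>) g" and hs: "sq_int (lebesgue_on \<Omega>) h"
    using g h by (simp_all add: L2_iff_sq_int)
  have "AE x in lebesgue_on \<Omega>. (g x - h x) \<bullet> b = 0" if b: "b \<in> Basis" for b
  proof (rule fundamental_lemma_variations[OF \<Omega>])
    show "sq_int (lebesgue_on \<Omega>) (\<lambda>x. (g x - h x) \<bullet> b)"
      by (intro sq_int_inner_const sq_int_diff gs hs)
    fix \<phi> assume \<phi>: "\<phi> \<in> test_functions \<Omega>"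
    have \<phi>s: "sq_int (lebesgue_on \<Omega>) \<phi>" using test_function_sq_int[OF \<phi>] \<Omega> by simp
    have i: "integrable (lebesgue_on \<Omega>) (\<lambda>x. (g x \<bullet> b) * \<phi> x)" "integrable (lebesgue_on \<Omega>) (\<lambda>x. (h x \<bullet> b) * \<phi> x)"
      using sq_int_inner[OF sq_int_inner_const[OF gs] \<phi>s] sq_int_inner[OF sq_int_inner_const[OF hs] \<phi>s]
      by simp_all
    have "(LINT x|lebesgue_on \<Omega>. (g x \<bullet> b) * \<phi> x) = (LINT x|lebesgue_on \<Omega>. (h x \<bullet> b) * \<phi> x)"
      using g(2) h(2) \<phi> b by (simp add: is_weak_gradient_def)
    then show "(LINT x|lebesgue_on \<Omega>. ((g x - h x) \<bullet> b) * \<phi> x) = 0"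
      using i by (simp add: inner_diff_left left_diff_distrib)
  qed
  then have "AE x in lebesgue_on \<Omega>. \<forall>b\<in>Basis. (g x - h x) \<bullet> b = 0"
    by (simp add: AE_finite_all)
  then show ?thesis
    by eventually_elim (auto simp: inner_diff_left intro: euclidean_eqI)
qed

lemma H1_sq_int:
  assumes "u \<in> H1 \<Omega>"
  shows "sq_int (lebesgue_on \<Omega>) u" "sq_int (lebesgue_on \<Omega>) (weak_grad \<Omega> u)"
    and "is_weak_gradient \<Omega> u (weak_grad \<Omega> u)"
proof -
  show "sq_int (lebesgue_on \<Omega>) u" using assms by (simp add: H1_def L2_iff_sq_int)
  have "\<exists>g. g \<in> L2 \<Omega> \<and> is_weak_gradient \<Omega> u g" using assms by (auto simp: H1_def)
  then have "weak_grad \<Omega> u \<in> L2 \<Omega> \<and> is_weak_gradient \<Omega> u (weak_grad \<Omega> u)"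
    unfolding weak_grad_def by (rule someI_ex)
  then show "sq_int (lebesgue_on \<Omega>) (weak_grad \<Omega> u)" "is_weak_gradient \<Omega> u (weak_grad \<Omega> u)"
    by (simp_all add: L2_iff_sq_int)
qed

lemma H1_weak_gradI:
  assumes "open \<Omega>" "sq_int (lebesgue_on \<Omega>) u" "sq_int (lebesgue_on \<Omega>) g" "is_weak_gradient \<Omega> u g"
  shows "u \<in> H1 \<Omega>" "AE x in lebesgue_on \<Omega>. weak_grad \<Omega> u x = g x"
    "energy \<Omega> u = (l2norm (lebesgue_on \<Omega>) g)\<^sup>2"
proof -
  show u: "u \<in> H1 \<Omega>" using assms by (auto simp: H1_def L2_iff_sq_int)
  show ae: "AE x in lebesgue_on \<Omega>. weak_grad \<Omega> u x = g x"
    using is_weak_gradient_unique[OF assms(1), of "weak_grad \<Omega> u" u g] H1_sq_int[OF u] assms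
    by (simp add: L2_iff_sq_int)
  have "energy \<Omega> u = (l2norm (lebesgue_on \<Omega>) (weak_grad \<Omega> u))\<^sup>2"
    by (simp add: energy_def l2norm_squared)
  also have "l2norm (lebesgue_on \<Omega>) (weak_grad \<Omega> u) = l2norm (lebesgue_on \<Omega>) g"
    using H1_sq_int(2)[OF u] assms(3) ae by (intro l2norm_cong_AE) (auto simp: sq_int_def)
  finally show "energy \<Omega> u = (l2norm (lebesgue_on \<Omega>) g)\<^sup>2" .
qed

lemma mass_eq_l2norm: "mass \<Omega> u = (l2norm (lebesgue_on \<Omega>) u)\<^sup>2"
  by (simp add: mass_def l2norm_squared)

lemma energy_eq_l2norm: "energy \<Omega> u = (l2norm (lebesgue_on \<Omega>) (weak_grad \<Omega> u))\<^sup>2"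
  by (simp add: energy_def l2norm_squared)

lemma is_weak_gradient_diff:
  assumes \<Omega>: "open \<Omega>" and u: "sq_int (lebesgue_on \<Omega>) u" "sq_int (lebesgue_on \<Omega>) g" "is_weak_gradient \<Omega> u g"
    and v: "sq_int (lebesgue_on \<Omega>) v" "sq_int (lebesgue_on \<Omega>) h" "is_weak_gradient \<Omega> v h"
  shows "is_weak_gradient \<Omega> (\<lambda>x. u x - v x) (\<lambda>x. g x - h x)"
  unfolding is_weak_gradient_def
proof (intro ballI)
  fix \<phi> :: "'a \<Rightarrow> real" and b :: 'a assume \<phi>: "\<phi> \<in> test_functions \<Omega>" and b: "b \<in> Basis"
  have \<phi>s: "sq_int (lebesgue_on \<Omega>) \<phi>" "sq_int (lebesgue_on \<Omega>) (\<lambda>x. classical_grad \<phi> x \<bullet> b)"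
    using test_function_sq_int[OF \<phi>] \<Omega> by (auto intro: sq_int_inner_const)
  note f = test_function_frechet_derivative[OF \<phi>]
  have i: "integrable (lebesgue_on \<Omega>) (\<lambda>x. (g x \<bullet> b) * \<phi> x)" "integrable (lebesgue_on \<Omega>) (\<lambda>x. (h x \<bullet> b) * \<phi> x)"
    "integrable (lebesgue_on \<Omega>) (\<lambda>x. u x * (classical_grad \<phi> x \<bullet> b))"
    "integrable (lebesgue_on \<Omega>) (\<lambda>x. v x * (classical_grad \<phi> x \<bullet> b))"
    using sq_int_inner[OF sq_int_inner_const[OF u(2)] \<phi>s(1)] sq_int_inner[OF sq_int_inner_const[OF v(2)] \<phi>s(1)]
      sq_int_inner[OF u(1) \<phi>s(2)] sq_int_inner[OF v(1) \<phi>s(2)]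
    by simp_all
  have "(LINT x|lebesgue_on \<Omega>. u x * (classical_grad \<phi> x \<bullet> b)) = - (LINT x|lebesgue_on \<Omega>. (g x \<bullet> b) * \<phi> x)"
    "(LINT x|lebesgue_on \<Omega>. v x * (classical_grad \<phi> x \<bullet> b)) = - (LINT x|lebesgue_on \<Omega>. (h x \<bullet> b) * \<phi> x)"
    using u(3) v(3) \<phi> b unfolding is_weak_gradient_def f[symmetric] by blast+
  then show "(LINT x|lebesgue_on \<Omega>. (u x - v x) * frechet_derivative \<phi> (at x) b)
      = - (LINT x|lebesgue_on \<Omega>. ((g x - h x) \<bullet> b) * \<phi> x)"
    using i by (simp add: f inner_diff_left left_diff_distrib)
qed

lemma H1_diff:
  assumes \<Omega>: "open \<Omega>" and u: "u \<in> H1 \<Omega>" and v: "v \<in> H1 \<Omega>"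
  shows "(\<lambda>x. u x - v x) \<in> H1 \<Omega>"
    "AE x in lebesgue_on \<Omega>. weak_grad \<Omega> (\<lambda>x. u x - v x) x = weak_grad \<Omega> u x - weak_grad \<Omega> v x"
    "energy \<Omega> (\<lambda>x. u x - v x) = (l2norm (lebesgue_on \<Omega>) (\<lambda>x. weak_grad \<Omega> u x - weak_grad \<Omega> v x))\<^sup>2"
  using H1_weak_gradI[OF \<Omega> sq_int_diff[OF H1_sq_int(1)[OF u] H1_sq_int(1)[OF v]]
      sq_int_diff[OF H1_sq_int(2)[OF u] H1_sq_int(2)[OF v]]
      is_weak_gradient_diff[OF \<Omega> H1_sq_int[OF u] H1_sq_int[OF v]]] by blast+

lemma H1_norm_diff:
  assumes "open \<Omega>" "u \<in> H1 \<Omega>" "v \<in> H1 \<Omega>"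
  shows "H1_norm \<Omega> (\<lambda>x. u x - v x) =
    l2norm (lebesgue_on \<Omega>) (\<lambda>x. (u x - v x, weak_grad \<Omega> u x - weak_grad \<Omega> v x))"
proof -
  have "sq_int (lebesgue_on \<Omega>) (\<lambda>x. u x - v x)" "sq_int (lebesgue_on \<Omega>) (\<lambda>x. weak_grad \<Omega> u x - weak_grad \<Omega> v x)"
    by (intro sq_int_diff H1_sq_int assms)+
  from l2norm_Pair[OF this] show ?thesis
    unfolding H1_norm_def H1_diff(3)[OF assms] mass_eq_l2norm
    by (simp add: real_sqrt_unique)
qed

lemma H1_norm_diff_bounds:
  assumes "open \<Omega>" "u \<in> H1 \<Omega>" "v \<in> H1 \<Omega>"
  shows "l2norm (lebesgue_on \<Omega>) (\<lambda>x. u x - v x) \<le> H1_norm \<Omega> (\<lambda>x. u x - v x)"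
    "l2norm (lebesgue_on \<Omega>) (\<lambda>x. weak_grad \<Omega> u x - weak_grad \<Omega> v x) \<le> H1_norm \<Omega> (\<lambda>x. u x - v x)"
  unfolding H1_norm_def H1_diff(3)[OF assms] mass_eq_l2norm
  by (auto intro!: real_le_rsqrt)

lemma H1_norm_triangle:
  assumes \<Omega>: "open \<Omega>" and "u \<in> H1 \<Omega>" "v \<in> H1 \<Omega>" "w \<in> H1 \<Omega>"
  shows "H1_norm \<Omega> (\<lambda>x. u x - w x) \<le> H1_norm \<Omega> (\<lambda>x. u x - v x) + H1_norm \<Omega> (\<lambda>x. v x - w x)"
proof -
  have s: "sq_int (lebesgue_on \<Omega>) (\<lambda>x. (u x - v x, weak_grad \<Omega> u x - weak_grad \<Omega> v x))"
    if "u \<in> H1 \<Omega>" "v \<in> H1 \<Omega>" for u v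
    using that by (intro sq_int_Pair sq_int_diff H1_sq_int)
  show ?thesis using l2norm_triangle[OF s[OF assms(2,3)] s[OF assms(3,4)]]
    by (simp add: H1_norm_diff assms)
qed

text \<open>Needed because membership in the closure \<open>H10\<close> is tested against open sets,
  and the topology is given by its open sets rather than by a metric.\<close>

lemma openin_H1_ball:
  assumes "open \<Omega>" "u \<in> H1 \<Omega>"
  shows "openin (H1_topology \<Omega>) {v \<in> H1 \<Omega>. H1_norm \<Omega> (\<lambda>x. v x - u x) < \<epsilon>}"
  unfolding openin_H1_topology
proof (intro conjI ballI)
  fix w assume "w \<in> {v \<in> H1 \<Omega>. H1_norm \<Omega> (\<lambda>x. v x - u x) < \<epsilon>}"
  then have w: "w \<in> H1 \<Omega>" "H1_norm \<Omega> (\<lambda>x. w x - u x) < \<epsilon>" by auto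
  show "\<exists>\<delta>>0. \<forall>v\<in>H1 \<Omega>. H1_norm \<Omega> (\<lambda>x. v x - w x) < \<delta> \<longrightarrow> v \<in> {v \<in> H1 \<Omega>. H1_norm \<Omega> (\<lambda>x. v x - u x) < \<epsilon>}"
  proof (intro exI[of _ "\<epsilon> - H1_norm \<Omega> (\<lambda>x. w x - u x)"] conjI ballI impI)
    fix v assume v: "v \<in> H1 \<Omega>" "H1_norm \<Omega> (\<lambda>x. v x - w x) < \<epsilon> - H1_norm \<Omega> (\<lambda>x. w x - u x)"
    then show "v \<in> {v \<in> H1 \<Omega>. H1_norm \<Omega> (\<lambda>x. v x - u x) < \<epsilon>}"
      using H1_norm_triangle[OF assms(1) v(1) w(1) assms(2)] by simp
  qed (use w in simp)
qed blast

lemma test_function_H1: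
  assumes \<Omega>: "open \<Omega>" and \<phi>: "\<phi> \<in> test_functions \<Omega>"
  shows "\<phi> \<in> H1 \<Omega>" "AE x in lebesgue_on \<Omega>. weak_grad \<Omega> \<phi> x = classical_grad \<phi> x"
    "energy \<Omega> \<phi> = (l2norm (lebesgue_on \<Omega>) (classical_grad \<phi>))\<^sup>2"
proof -
  have \<Omega>m: "\<Omega> \<in> sets lebesgue" using \<Omega> by simp
  note t = test_function_C1_compact[OF \<phi>]
  have "is_weak_gradient \<Omega> \<phi> (classical_grad \<phi>)"
    unfolding is_weak_gradient_def
  proof (intro ballI)
    fix \<psi> :: "'a \<Rightarrow> real" and b :: 'a assume \<psi>: "\<psi> \<in> test_functions \<Omega>" and b: "b \<in> Basis"
    note s = test_function_C1_compact[OF \<psi>]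
    have c: "continuous_on UNIV \<phi>" "continuous_on UNIV \<psi>" "continuous_on UNIV (classical_grad \<phi>)"
      "continuous_on UNIV (classical_grad \<psi>)"
      using t s C1_compact_continuous[OF t] C1_compact_continuous[OF s] unfolding C1_compact_def by blast+
    have "(LINT x|lebesgue_on \<Omega>. \<phi> x * (classical_grad \<psi> x \<bullet> b)) = (LINT x|lborel. \<phi> x * (classical_grad \<psi> x \<bullet> b))"
      using c test_function_zero[OF \<phi>] \<Omega>m
      by (intro integral_lebesgue_on_eq_lborel borel_measurable_continuous_onI continuous_intros) auto
    also have "\<dots> = - (LINT x|lborel. (classical_grad \<phi> x \<bullet> b) * \<psi> x)"
      by (rule integration_by_parts_C1_compact[OF t s])
    also have "(LINT x|lborel. (classical_grad \<phi> x \<bullet> b) * \<psi> x) = (LINT x|lebesgue_on \<Omega>. (classical_grad \<phi> x \<bullet> b) * \<psi> x)"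
      using c test_function_zero[OF \<phi>] \<Omega>m
      by (intro integral_lebesgue_on_eq_lborel[symmetric] borel_measurable_continuous_onI continuous_intros) auto
    finally show "(LINT x|lebesgue_on \<Omega>. \<phi> x * frechet_derivative \<psi> (at x) b)
        = - (LINT x|lebesgue_on \<Omega>. (classical_grad \<phi> x \<bullet> b) * \<psi> x)"
      by (simp add: test_function_frechet_derivative[OF \<psi>])
  qed
  from H1_weak_gradI[OF \<Omega> test_function_sq_int[OF \<phi> \<Omega>m] this]
  show "\<phi> \<in> H1 \<Omega>" "AE x in lebesgue_on \<Omega>. weak_grad \<Omega> \<phi> x = classical_grad \<phi> x"
    "energy \<Omega> \<phi> = (l2norm (lebesgue_on \<Omega>) (classical_grad \<phi>))\<^sup>2" by blast+
qed

section \<open>Approximation by test functions and sequential continuity\<close>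

lemma H10_imp_H1: "u \<in> H10 \<Omega> \<Longrightarrow> u \<in> H1 \<Omega>"
  using closure_of_subset_topspace[of "H1_topology \<Omega>" "test_functions \<Omega>"] by (auto simp: H10_def)

text \<open>The balls of radius 1/(n+1) around \<open>u\<close> are open, so each of them meets the
  test functions.\<close>

lemma H10_approx:
  assumes \<Omega>: "open \<Omega>" and u: "u \<in> H10 \<Omega>"
  obtains \<phi> where "\<And>n::nat. \<phi> n \<in> test_functions \<Omega>" "(\<lambda>n. H1_norm \<Omega> (\<lambda>x. \<phi> n x - u x)) \<longlonglongrightarrow> 0"
proof -
  have u1: "u \<in> H1 \<Omega>" using H10_imp_H1[OF u] .
  have "\<exists>\<psi>. \<psi> \<in> test_functions \<Omega> \<and> H1_norm \<Omega> (\<lambda>x. \<psi> x - u x) < inverse (real (Suc n))" for n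
  proof -
    let ?T = "{v \<in> H1 \<Omega>. H1_norm \<Omega> (\<lambda>x. v x - u x) < inverse (real (Suc n))}"
    have "H1_norm \<Omega> (\<lambda>x. u x - u x) = 0"
      using H1_norm_diff[OF \<Omega> u1 u1] by (simp add: l2norm_def norm_Pair)
    then have "u \<in> ?T" using u1 by simp
    moreover have "\<forall>T. u \<in> T \<and> openin (H1_topology \<Omega>) T \<longrightarrow> (\<exists>y. y \<in> test_functions \<Omega> \<and> y \<in> T)"
      using u unfolding H10_def in_closure_of by (rule conjunct2)
    ultimately obtain \<psi> where "\<psi> \<in> test_functions \<Omega>" "\<psi> \<in> ?T"
      using openin_H1_ball[OF \<Omega> u1, of "inverse (real (Suc n))"] by meson
    then show ?thesis by blast
  qed
  then obtain \<phi> where \<phi>: "\<And>n. \<phi> n \<in> test_functions \<Omega>"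
    "\<And>n. H1_norm \<Omega> (\<lambda>x. \<phi> n x - u x) < inverse (real (Suc n))" by metis
  have "(\<lambda>n. H1_norm \<Omega> (\<lambda>x. \<phi> n x - u x)) \<longlonglongrightarrow> 0"
  proof (rule tendsto_sandwich[OF _ _ tendsto_const LIMSEQ_inverse_real_of_nat])
    show "\<forall>\<^sub>F n in sequentially. 0 \<le> H1_norm \<Omega> (\<lambda>x. \<phi> n x - u x)"
      by (simp add: H1_norm_def mass_eq_l2norm energy_eq_l2norm)
    show "\<forall>\<^sub>F n in sequentially. H1_norm \<Omega> (\<lambda>x. \<phi> n x - u x) \<le> inverse (real (Suc n))"
      using \<phi>(2) by (intro always_eventually allI less_imp_le)
  qed
  with \<phi>(1) that show ?thesis by blast
qed

text \<open>The topology comes from a seminorm and is therefore first countable: if no ball around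
  \<open>u\<close> is mapped into \<open>U\<close>, bad points in the balls of radius 1/(n+1) form a
  sequence converging to \<open>u\<close>.\<close>

lemma continuous_map_H1_sequentially:
  fixes F :: "('a::euclidean_space \<Rightarrow> real) \<Rightarrow> real"
  assumes seq: "\<And>u v. u \<in> H1 \<Omega> \<Longrightarrow> (\<And>n::nat. v n \<in> H1 \<Omega>) \<Longrightarrow>
      (\<lambda>n. H1_norm \<Omega> (\<lambda>x. v n x - u x)) \<longlonglongrightarrow> 0 \<Longrightarrow> (\<lambda>n. F (v n)) \<longlonglongrightarrow> F u"
  shows "continuous_map (H1_topology \<Omega>) euclideanreal F"
  unfolding continuous_map_def topspace_H1_topology openin_H1_topology
proof (intro conjI allI impI ballI)
  fix U :: "real set" and u assume U: "openin euclideanreal U" and "u \<in> {x \<in> H1 \<Omega>. F x \<in> U}"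
  then have u: "u \<in> H1 \<Omega>" "F u \<in> U" and oU: "open U" by auto
  show "\<exists>\<epsilon>>0. \<forall>v\<in>H1 \<Omega>. H1_norm \<Omega> (\<lambda>x. v x - u x) < \<epsilon> \<longrightarrow> v \<in> {x \<in> H1 \<Omega>. F x \<in> U}"
  proof (rule ccontr)
    assume neg: "\<not> ?thesis"
    have "\<exists>v. v \<in> H1 \<Omega> \<and> H1_norm \<Omega> (\<lambda>x. v x - u x) < inverse (real (Suc n)) \<and> F v \<notin> U" for n
    proof -
      have "inverse (real (Suc n)) > 0" by simp
      with neg have "\<not> (\<forall>v\<in>H1 \<Omega>. H1_norm \<Omega> (\<lambda>x. v x - u x) < inverse (real (Suc n)) \<longrightarrow>
          v \<in> {x \<in> H1 \<Omega>. F x \<in> U})" by meson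
      then show ?thesis by simp blast
    qed
    then obtain v where v: "\<And>n. v n \<in> H1 \<Omega>" "\<And>n. H1_norm \<Omega> (\<lambda>x. v n x - u x) < inverse (real (Suc n))"
      "\<And>n. F (v n) \<notin> U" by metis
    have "(\<lambda>n. H1_norm \<Omega> (\<lambda>x. v n x - u x)) \<longlonglongrightarrow> 0"
    proof (rule tendsto_sandwich[OF _ _ tendsto_const LIMSEQ_inverse_real_of_nat])
      show "\<forall>\<^sub>F n in sequentially. 0 \<le> H1_norm \<Omega> (\<lambda>x. v n x - u x)"
        by (simp add: H1_norm_def mass_eq_l2norm energy_eq_l2norm)
      show "\<forall>\<^sub>F n in sequentially. H1_norm \<Omega> (\<lambda>x. v n x - u x) \<le> inverse (real (Suc n))"
        using v(2) by (intro always_eventually allI less_imp_le)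
    qed
    then have "(\<lambda>n. F (v n)) \<longlonglongrightarrow> F u" using seq[of u v] u(1) v(1) by blast
    from topological_tendstoD[OF this oU u(2)] show False using v(3) by simp
  qed
qed auto

section \<open>Truncations\<close>

text \<open>Being 1-Lipschitz with \<open>G 0 = 0\<close> keeps L2 bounds and compact supports under
  composition. The Lipschitz condition on \<open>G'\<close> lets the chain-rule gradients converge
  in L2 directly, without passing to subsequences.\<close>

definition C11_contraction :: "real \<Rightarrow> (real \<Rightarrow> real) \<Rightarrow> (real \<Rightarrow> real) \<Rightarrow> bool" where
  "C11_contraction L G G' \<longleftrightarrow> L \<ge> 0 \<and> (\<forall>s. (G has_real_derivative G' s) (at s)) \<and> (\<forall>s. \<bar>G' s\<bar> \<le> 1) \<and>
     (\<forall>s t. \<bar>G' s - G' t\<bar> \<le> L * \<bar>s - t\<bar>) \<and> G 0 = 0"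

lemma C11_contractionD:
  assumes "C11_contraction L G G'"
  shows "L \<ge> 0" "(G has_real_derivative G' s) (at s)" "\<bar>G' s\<bar> \<le> 1" "\<bar>G' s - G' t\<bar> \<le> L * \<bar>s - t\<bar>"
    "G 0 = 0" "\<bar>G s - G t\<bar> \<le> \<bar>s - t\<bar>" "\<bar>G s\<bar> \<le> \<bar>s\<bar>" "continuous_on UNIV G" "continuous_on UNIV G'"
proof -
  show a: "L \<ge> 0" "(G has_real_derivative G' s) (at s)" "\<bar>G' s\<bar> \<le> 1" "\<bar>G' s - G' t\<bar> \<le> L * \<bar>s - t\<bar>"
    "G 0 = 0" for s t using assms by (simp_all add: C11_contraction_def)
  show l: "\<bar>G s - G t\<bar> \<le> \<bar>s - t\<bar>" for s t
    using field_differentiable_bound[of UNIV G G' 1 s t] a by simp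
  show "\<bar>G s\<bar> \<le> \<bar>s\<bar>" using l[of s 0] a(5) by simp
  show "continuous_on UNIV G"
    by (intro continuous_at_imp_continuous_on ballI DERIV_isCont[OF a(2)])
  have "L-lipschitz_on UNIV G'"
    using a(1,4) by (intro lipschitz_onI) (auto simp: dist_real_def)
  then show "continuous_on UNIV G'" by (rule lipschitz_on_continuous_on)
qed

text \<open>Carries every statement about \<open>G (u x)\<close> over to \<open>G (- u x)\<close>,
  which for \<open>pos_reg\<close> is the smoothed negative part; the derivative acquires a minus
  sign that norms do not see.\<close>

lemma C11_contraction_reflect:
  assumes "C11_contraction L G G'"
  shows "C11_contraction L (\<lambda>s. G (- s)) (\<lambda>s. - G' (- s))"
proof -
  note D = C11_contractionD[OF assms]
  have "((\<lambda>s. G (- s)) has_real_derivative - G' (- s)) (at s)" for s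
    using DERIV_chain2[where f = G and g = uminus and x = s and s = UNIV, OF D(2)[of "- s"] DERIV_minus[OF DERIV_ident]]
    by simp
  moreover have "\<bar>- G' (- s) - - G' (- t)\<bar> \<le> L * \<bar>s - t\<bar>" for s t
    using D(4)[of "- t" "- s"] by (simp add: abs_minus_commute)
  ultimately show ?thesis using D by (simp add: C11_contraction_def)
qed

text \<open>A \<open>C\<^sup>1\<close> approximation of the positive part from below, whose derivative is the ramp from
  \<open>0\<close> to \<open>1\<close> on \<open>[0, \<delta>]\<close>. Using it instead of the positive part itself makes the chain rule and the
  continuity of the truncated energy on the Sobolev space elementary.\<close>

definition pos_reg :: "real \<Rightarrow> real \<Rightarrow> real" where
  "pos_reg \<delta> s = ((max 0 s)\<^sup>2 - (max 0 (s - \<delta>))\<^sup>2) / (2 * \<delta>)"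

definition pos_reg' :: "real \<Rightarrow> real \<Rightarrow> real" where
  "pos_reg' \<delta> s = (max 0 s - max 0 (s - \<delta>)) / \<delta>"

text \<open>With y = s - c, the squared positive part is (y*y + |y|*y) / 2, and |y|*y has derivative
  2|y| everywhere, including at 0.\<close>

lemma DERIV_max_0_square: "((\<lambda>s::real. (max 0 (s - c))\<^sup>2) has_real_derivative 2 * max 0 (s - c)) (at s)"
proof -
  have "((\<lambda>x::real. \<bar>x\<bar> * x) has_real_derivative 2 * \<bar>y\<bar>) (at y)" for y
  proof -
    consider "y > 0" | "y < 0" | "y = 0" by linarith
    then show ?thesis
    proof cases
      case 1
      have "((\<lambda>x. x * x) has_real_derivative 2 * \<bar>y\<bar>) (at y)"
        using 1 by (auto intro!: derivative_eq_intros)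
      then show ?thesis
        by (rule has_field_derivative_transform_within_open[of _ _ _ "{0<..}"]) (use 1 in auto)
    next
      case 2
      have "((\<lambda>x. - (x * x)) has_real_derivative 2 * \<bar>y\<bar>) (at y)"
        using 2 by (auto intro!: derivative_eq_intros)
      then show ?thesis
        by (rule has_field_derivative_transform_within_open[of _ _ _ "{..<0}"]) (use 2 in auto)
    next
      case 3
      have "((\<lambda>h::real. \<bar>h\<bar>) \<longlongrightarrow> 0) (at 0)" by (intro tendsto_eq_intros | simp)+
      then have "((\<lambda>h::real. (\<bar>h\<bar> * h) / h) \<longlongrightarrow> 0) (at 0)"
        by (rule Lim_transform_eventually) (simp add: eventually_at_filter)
      then show ?thesis using 3 by (simp add: DERIV_def)
    qed
  qed
  from DERIV_chain2[where f = "\<lambda>x. \<bar>x\<bar> * x" and g = "\<lambda>s. s - c" and x = s and s = UNIV,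
      OF this[of "s - c"] DERIV_diff[OF DERIV_ident DERIV_const]]
  have "((\<lambda>s. \<bar>s - c\<bar> * (s - c)) has_real_derivative 2 * \<bar>s - c\<bar>) (at s)"
    by simp
  moreover have "((\<lambda>s. (s - c)\<^sup>2) has_real_derivative 2 * (s - c)) (at s)"
    by (auto intro!: derivative_eq_intros)
  ultimately have "((\<lambda>s. ((s - c)\<^sup>2 + \<bar>s - c\<bar> * (s - c)) / 2) has_real_derivative (2 * (s - c) + 2 * \<bar>s - c\<bar>) / 2) (at s)"
    by (intro DERIV_cdivide DERIV_add)
  moreover have "(\<lambda>s. ((s - c)\<^sup>2 + \<bar>s - c\<bar> * (s - c)) / 2) = (\<lambda>s. (max 0 (s - c))\<^sup>2)"
    by (auto simp: fun_eq_iff max_def power2_eq_square abs_if algebra_simps)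
  moreover have "(2 * (s - c) + 2 * \<bar>s - c\<bar>) / 2 = 2 * max 0 (s - c)" by (auto simp: max_def)
  ultimately show ?thesis by simp
qed

text \<open>The constant 2/\<delta> estimates the two positive parts in \<open>pos_reg'\<close>
  separately, each being 1-Lipschitz before the division by \<delta>.\<close>

lemma C11_contraction_pos_reg:
  assumes "\<delta> > 0"
  shows "C11_contraction (2 / \<delta>) (pos_reg \<delta>) (pos_reg' \<delta>)"
  unfolding C11_contraction_def
proof (intro conjI allI)
  fix s t :: real
  have "((\<lambda>s. ((max 0 (s - 0))\<^sup>2 - (max 0 (s - \<delta>))\<^sup>2) / (2 * \<delta>)) has_real_derivative
      (2 * max 0 (s - 0) - 2 * max 0 (s - \<delta>)) / (2 * \<delta>)) (at s)"
    by (intro DERIV_cdivide DERIV_diff DERIV_max_0_square)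
  moreover have "(2 * max 0 (s - 0) - 2 * max 0 (s - \<delta>)) / (2 * \<delta>) = pos_reg' \<delta> s"
    using assms by (simp add: pos_reg'_def field_simps)
  ultimately show "(pos_reg \<delta> has_real_derivative pos_reg' \<delta> s) (at s)"
    by (simp add: pos_reg_def[abs_def])
  show "\<bar>pos_reg' \<delta> s\<bar> \<le> 1" using assms by (auto simp: pos_reg'_def max_def field_simps)
  have "pos_reg' \<delta> s - pos_reg' \<delta> t = ((max 0 s - max 0 t) - (max 0 (s - \<delta>) - max 0 (t - \<delta>))) / \<delta>"
    by (simp add: pos_reg'_def diff_divide_distrib)
  also have "\<bar>\<dots>\<bar> \<le> (2 * \<bar>s - t\<bar>) / \<delta>"
  proof -
    have "\<bar>max 0 a - max 0 b\<bar> \<le> \<bar>a - b\<bar>" for a b :: real by (auto simp: max_def)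
    note m = this
    have "\<bar>(max 0 s - max 0 t) - (max 0 (s - \<delta>) - max 0 (t - \<delta>))\<bar>
        \<le> \<bar>max 0 s - max 0 t\<bar> + \<bar>max 0 (s - \<delta>) - max 0 (t - \<delta>)\<bar>"
      by (rule abs_triangle_ineq4)
    also have "\<dots> \<le> \<bar>s - t\<bar> + \<bar>(s - \<delta>) - (t - \<delta>)\<bar>" by (intro add_mono m)
    also have "\<dots> = 2 * \<bar>s - t\<bar>" by (simp only: diff_diff_eq2 diff_add_eq diff_add_cancel mult_2)
    finally show ?thesis unfolding abs_divide abs_of_pos[OF assms] by (rule divide_right_mono) (rule less_imp_le[OF assms])
  qed
  finally show "\<bar>pos_reg' \<delta> s - pos_reg' \<delta> t\<bar> \<le> 2 / \<delta> * \<bar>s - t\<bar>" by simp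
  show "0 \<le> 2 / \<delta>" using assms by simp
qed (use assms in \<open>simp add: pos_reg_def\<close>)

lemma pos_reg_nonpos: "\<delta> > 0 \<Longrightarrow> s \<le> 0 \<Longrightarrow> pos_reg \<delta> s = 0" "\<delta> > 0 \<Longrightarrow> s \<le> 0 \<Longrightarrow> pos_reg' \<delta> s = 0"
  by (simp_all add: pos_reg_def pos_reg'_def)

lemma pos_reg_nonneg: "\<delta> > 0 \<Longrightarrow> pos_reg \<delta> s \<ge> 0"
  by (auto simp: pos_reg_def intro!: divide_nonneg_pos power_mono)

lemma pos_reg_lower:
  assumes "\<delta> > 0"
  shows "s \<le> pos_reg \<delta> s + \<delta>"
proof -
  consider "s \<le> \<delta>" | "s > \<delta>" by linarith
  then show ?thesis
  proof cases
    case 1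
    then show ?thesis using pos_reg_nonneg[OF assms, of s] by linarith
  next
    case 2
    \<comment> \<open>Past the ramp the difference of squares is linear: s*s - (s - \<delta>)*(s -
      \<delta>) = 2*\<delta>*s - \<delta>*\<delta>.\<close>
    have "pos_reg \<delta> s = s - \<delta> / 2"
      using 2 assms by (simp add: pos_reg_def power2_eq_square field_simps)
    then show ?thesis using assms by linarith
  qed
qed

section \<open>Continuity of truncated masses and energies\<close>

lemma measurable_compose_continuous:
  fixes G :: "real \<Rightarrow> real"
  assumes "continuous_on UNIV G" "u \<in> borel_measurable M"
  shows "(\<lambda>x. G (u x)) \<in> borel_measurable M"
  using measurable_compose[OF assms(2) borel_measurable_continuous_onI[OF assms(1)]] .

lemma C11_contraction_sq_int:
  assumes G: "C11_contraction L G G'" and u: "sq_int M u" and g: "sq_int M g"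
  shows "sq_int M (\<lambda>x. G (u x))" "sq_int M (\<lambda>x. G' (u x) *\<^sub>R g x)"
proof -
  note D = C11_contractionD[OF G]
  show "sq_int M (\<lambda>x. G (u x))"
    using D(7) by (intro sq_int_bound[OF u, where C = 1] measurable_compose_continuous[OF D(8)] sq_int_measurable[OF u]) auto
  show "sq_int M (\<lambda>x. G' (u x) *\<^sub>R g x)"
    using D(3) by (intro sq_int_mult_bounded[OF g, where C = 1] measurable_compose_continuous[OF D(9)] sq_int_measurable[OF u]) auto
qed

lemma l2norm_contraction_diff:
  assumes G: "C11_contraction L G G'" and u: "sq_int M u" and v: "sq_int M v"
  shows "l2norm M (\<lambda>x. G (u x) - G (v x)) \<le> l2norm M (\<lambda>x. u x - v x)"
proof (rule l2norm_mono[OF sq_int_diff[OF u v]])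
  show "(\<lambda>x. G (u x) - G (v x)) \<in> borel_measurable M"
    using C11_contraction_sq_int(1)[OF G _ u] u v by (intro borel_measurable_diff sq_int_measurable) auto
qed (use C11_contractionD(6)[OF G] in simp)

lemma sq_int_tail:
  assumes "sq_int M g"
  shows "(\<lambda>n::nat. LINT x|M. (if norm (g x) > real n then (norm (g x))\<^sup>2 else 0)) \<longlonglongrightarrow> 0"
proof -
  have [measurable]: "g \<in> borel_measurable M" using sq_int_measurable[OF assms] .
  have "(\<lambda>n::nat. LINT x|M. (if norm (g x) > real n then (norm (g x))\<^sup>2 else 0)) \<longlonglongrightarrow> (LINT x|M. 0)"
  proof (rule integral_dominated_convergence[where w = "\<lambda>x. (norm (g x))\<^sup>2"])
    show "AE x in M. (\<lambda>n::nat. if norm (g x) > real n then (norm (g x))\<^sup>2 else 0) \<longlonglongrightarrow> 0"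
    proof (rule AE_I2)
      fix x
      obtain N :: nat where "norm (g x) \<le> real N" using real_arch_simple by blast
      then have "\<forall>n\<ge>N. (if norm (g x) > real n then (norm (g x))\<^sup>2 else 0) = 0" by auto
      then show "(\<lambda>n::nat. if norm (g x) > real n then (norm (g x))\<^sup>2 else 0) \<longlonglongrightarrow> 0"
        by (intro tendsto_eventually) (simp only: eventually_sequentially, blast)
    qed
  qed (use sq_int_integrable[OF assms] in auto)
  then show ?thesis by simp
qed

text \<open>The domain is split according to the size of \<open>g\<close>. Where |g| \<le> R, one
  factor of the squared difference is bounded by L |v n - u| and the other by 2, and Cauchy-Schwarz
  applies; where |g| > R, both are bounded by 2 and the tail of \<open>g\<close> is small for large
  R.\<close>

lemma l2norm_derivative_diff_tendsto:
  fixes g :: "'a \<Rightarrow> 'b::euclidean_space"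
  assumes G: "C11_contraction L G G'" and u: "sq_int M u" and v: "\<And>n::nat. sq_int M (v n)" and g: "sq_int M g"
    and lim: "(\<lambda>n. l2norm M (\<lambda>x. v n x - u x)) \<longlonglongrightarrow> 0"
  shows "(\<lambda>n. l2norm M (\<lambda>x. (G' (v n x) - G' (u x)) *\<^sub>R g x)) \<longlonglongrightarrow> 0"
proof -
  note D = C11_contractionD[OF G]
  have [measurable]: "g \<in> borel_measurable M" using sq_int_measurable[OF g] .
  have m: "(\<lambda>x. G' (v n x) - G' (u x)) \<in> borel_measurable M" for n
    by (intro borel_measurable_diff measurable_compose_continuous[OF D(9)] sq_int_measurable u v)
  have b2: "\<bar>G' (v n x) - G' (u x)\<bar> \<le> 2" for n x using D(3)[of "v n x"] D(3)[of "u x"] by linarith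
  have s: "sq_int M (\<lambda>x. (G' (v n x) - G' (u x)) *\<^sub>R g x)" for n
    using b2 by (intro sq_int_mult_bounded[OF g m, where C = 2])
  let ?T = "\<lambda>R::nat. LINT x|M. (if norm (g x) > real R then (norm (g x))\<^sup>2 else 0)"
  have key: "(l2norm M (\<lambda>x. (G' (v n x) - G' (u x)) *\<^sub>R g x))\<^sup>2
      \<le> 2 * L * real R * (l2norm M (\<lambda>x. v n x - u x) * l2norm M g) + 4 * ?T R" for n and R :: nat
  proof -
    have i1: "integrable M (\<lambda>x. norm (v n x - u x) * norm (g x))"
      by (intro sq_int_norm_mult sq_int_diff u v g)
    have i2: "integrable M (\<lambda>x. if norm (g x) > real R then (norm (g x))\<^sup>2 else 0)"
      by (rule Bochner_Integration.integrable_bound[OF sq_int_integrable[OF g]]) auto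
    have "(l2norm M (\<lambda>x. (G' (v n x) - G' (u x)) *\<^sub>R g x))\<^sup>2
        = (LINT x|M. (norm ((G' (v n x) - G' (u x)) *\<^sub>R g x))\<^sup>2)" by (rule l2norm_squared)
    also have "\<dots> \<le> (LINT x|M. 2 * L * real R * (norm (v n x - u x) * norm (g x))
        + 4 * (if norm (g x) > real R then (norm (g x))\<^sup>2 else 0))"
    proof (rule integral_mono)
      fix x
      let ?d = "\<bar>G' (v n x) - G' (u x)\<bar>"
      have d: "?d \<le> L * \<bar>v n x - u x\<bar>" "?d \<le> 2" "?d \<ge> 0" using D(4) b2 by auto
      have "?d\<^sup>2 * (norm (g x))\<^sup>2 \<le> 2 * L * real R * (\<bar>v n x - u x\<bar> * norm (g x))
          + 4 * (if norm (g x) > real R then (norm (g x))\<^sup>2 else 0)"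
      proof (cases "norm (g x) > real R")
        case True
        have "?d\<^sup>2 \<le> 4" using power_mono[OF d(2,3), of 2] by simp
        then have "?d\<^sup>2 * (norm (g x))\<^sup>2 \<le> 4 * (norm (g x))\<^sup>2" by (rule mult_right_mono) simp
        moreover have "0 \<le> 2 * L * real R * (\<bar>v n x - u x\<bar> * norm (g x))" using D(1) by simp
        ultimately show ?thesis using True by (simp only: if_True)
      next
        case False
        have "?d\<^sup>2 * (norm (g x))\<^sup>2 = (?d * ?d) * (norm (g x) * norm (g x))" by (simp only: power2_eq_square)
        also have "\<dots> \<le> ((L * \<bar>v n x - u x\<bar>) * 2) * (real R * norm (g x))"
          by (intro mult_mono mult_nonneg_nonneg d order_trans[OF d(3) d(1)] D(1))
             (use False D(1) in simp_all)
        finally show ?thesis using False by (simp add: mult_ac)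
      qed
      then show "(norm ((G' (v n x) - G' (u x)) *\<^sub>R g x))\<^sup>2 \<le> 2 * L * real R * (norm (v n x - u x) * norm (g x))
          + 4 * (if norm (g x) > real R then (norm (g x))\<^sup>2 else 0)"
        by (simp add: power_mult_distrib)
    qed (use sq_int_integrable[OF s] i1 i2 in auto)
    also have "\<dots> = 2 * L * real R * (LINT x|M. norm (v n x - u x) * norm (g x)) + 4 * ?T R"
      using i1 i2 by simp
    also have "\<dots> \<le> 2 * L * real R * (l2norm M (\<lambda>x. v n x - u x) * l2norm M g) + 4 * ?T R"
      using l2norm_Cauchy_Schwarz[OF sq_int_diff[OF v u] g] D(1)
      by (intro add_right_mono mult_left_mono) auto
    finally show ?thesis .
  qed
  show ?thesis
  proof (rule LIMSEQ_I)
    fix e :: real assume e: "e > 0"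
    have "\<forall>\<^sub>F R in sequentially. ?T R < e\<^sup>2 / 8"
      using sq_int_tail[OF g] e by (intro order_tendstoD(2)[of _ 0]) auto
    \<comment> \<open>\<open>R\<close> is fixed before \<open>n\<close>: the tail then costs at most
      half of e*e for all \<open>n\<close>, and the term growing with \<open>R\<close> is made small
      by \<open>n\<close> alone.\<close>
    then obtain R :: nat where R: "?T R < e\<^sup>2 / 8" by (auto simp: eventually_sequentially)
    have "(\<lambda>n. 2 * L * real R * (l2norm M (\<lambda>x. v n x - u x) * l2norm M g)) \<longlonglongrightarrow> 2 * L * real R * (0 * l2norm M g)"
      by (intro tendsto_intros lim)
    then have "\<forall>\<^sub>F n in sequentially. 2 * L * real R * (l2norm M (\<lambda>x. v n x - u x) * l2norm M g) < e\<^sup>2 / 2"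
      using e by (intro order_tendstoD(2)) auto
    then obtain N where N: "\<And>n. n \<ge> N \<Longrightarrow> 2 * L * real R * (l2norm M (\<lambda>x. v n x - u x) * l2norm M g) < e\<^sup>2 / 2"
      by (auto simp: eventually_sequentially)
    show "\<exists>N. \<forall>n\<ge>N. norm (l2norm M (\<lambda>x. (G' (v n x) - G' (u x)) *\<^sub>R g x) - 0) < e"
    proof (intro exI allI impI)
      fix n assume "n \<ge> N"
      then have "(l2norm M (\<lambda>x. (G' (v n x) - G' (u x)) *\<^sub>R g x))\<^sup>2 < e\<^sup>2"
        using key[of n R] N[of n] R by linarith
      then show "norm (l2norm M (\<lambda>x. (G' (v n x) - G' (u x)) *\<^sub>R g x) - 0) < e"
        using e by (simp add: power2_less_imp_less)
    qed
  qed
qed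

text \<open>G'(v) k - G'(u) g = G'(v) (k - g) + (G'(v) - G'(u)) g: the first summand is bounded by
  the norm of k - g, the second is the case of a fixed \<open>g\<close>.\<close>

lemma l2norm_chain_diff_tendsto:
  fixes g :: "'a \<Rightarrow> 'b::euclidean_space"
  assumes G: "C11_contraction L G G'" and u: "sq_int M u" and v: "\<And>n::nat. sq_int M (v n)"
    and g: "sq_int M g" and k: "\<And>n. sq_int M (k n)"
    and lim: "(\<lambda>n. l2norm M (\<lambda>x. v n x - u x)) \<longlonglongrightarrow> 0" "(\<lambda>n. l2norm M (\<lambda>x. k n x - g x)) \<longlonglongrightarrow> 0"
  shows "(\<lambda>n. l2norm M (\<lambda>x. G' (v n x) *\<^sub>R k n x - G' (u x) *\<^sub>R g x)) \<longlonglongrightarrow> 0"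
proof (rule tendsto_sandwich[OF _ _ tendsto_const])
  note D = C11_contractionD[OF G]
  have m: "(\<lambda>x. G' (w x)) \<in> borel_measurable M" if "sq_int M w" for w
    by (intro measurable_compose_continuous[OF D(9)] sq_int_measurable that)
  have b2: "\<bar>G' (v n x) - G' (u x)\<bar> \<le> 2" for n x using D(3)[of "v n x"] D(3)[of "u x"] by linarith
  have s1: "sq_int M (\<lambda>x. (G' (v n x) - G' (u x)) *\<^sub>R g x)" for n
    using b2 by (intro sq_int_mult_bounded[OF g, where C = 2] borel_measurable_diff m u v)
  have s2: "sq_int M (\<lambda>x. G' (v n x) *\<^sub>R (k n x - g x))" for n
    using D(3) by (intro sq_int_mult_bounded[where C = 1] sq_int_diff m g k v)
  have "l2norm M (\<lambda>x. G' (v n x) *\<^sub>R k n x - G' (u x) *\<^sub>R g x)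
      \<le> l2norm M (\<lambda>x. k n x - g x) + l2norm M (\<lambda>x. (G' (v n x) - G' (u x)) *\<^sub>R g x)" for n
  proof -
    have "(\<lambda>x. G' (v n x) *\<^sub>R k n x - G' (u x) *\<^sub>R g x)
        = (\<lambda>x. G' (v n x) *\<^sub>R (k n x - g x) + (G' (v n x) - G' (u x)) *\<^sub>R g x)"
      by (simp add: fun_eq_iff algebra_simps)
    then have "l2norm M (\<lambda>x. G' (v n x) *\<^sub>R k n x - G' (u x) *\<^sub>R g x)
        \<le> l2norm M (\<lambda>x. G' (v n x) *\<^sub>R (k n x - g x)) + l2norm M (\<lambda>x. (G' (v n x) - G' (u x)) *\<^sub>R g x)"
      using l2norm_triangle[OF s2[of n] s1[of n]] by simp
    moreover have "l2norm M (\<lambda>x. G' (v n x) *\<^sub>R (k n x - g x)) \<le> l2norm M (\<lambda>x. k n x - g x)"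
      using D(3) by (intro l2norm_mono sq_int_diff k g sq_int_measurable[OF s2]) (auto intro: mult_left_le_one_le)
    ultimately show ?thesis by linarith
  qed
  then show "\<forall>\<^sub>F n in sequentially. l2norm M (\<lambda>x. G' (v n x) *\<^sub>R k n x - G' (u x) *\<^sub>R g x)
      \<le> l2norm M (\<lambda>x. k n x - g x) + l2norm M (\<lambda>x. (G' (v n x) - G' (u x)) *\<^sub>R g x)" by simp
  show "(\<lambda>n. l2norm M (\<lambda>x. k n x - g x) + l2norm M (\<lambda>x. (G' (v n x) - G' (u x)) *\<^sub>R g x)) \<longlonglongrightarrow> 0"
    using tendsto_add[OF lim(2) l2norm_derivative_diff_tendsto[OF G u v g lim(1)]] by simp
qed simp

lemma l2norm_tendsto:
  assumes "sq_int M f" "\<And>n::nat. sq_int M (h n)" "(\<lambda>n. l2norm M (\<lambda>x. h n x - f x)) \<longlonglongrightarrow> 0"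
  shows "(\<lambda>n. l2norm M (h n)) \<longlonglongrightarrow> l2norm M f"
proof (rule LIM_zero_cancel, rule tendsto_rabs_zero_cancel, rule tendsto_sandwich[OF _ _ tendsto_const assms(3)])
  show "\<forall>\<^sub>F n in sequentially. \<bar>l2norm M (h n) - l2norm M f\<bar> \<le> l2norm M (\<lambda>x. h n x - f x)"
    using l2norm_triangle_diff[OF assms(2,1)] by simp
qed simp

lemma H1_norm_tendsto_components:
  assumes \<Omega>: "open \<Omega>" and "u \<in> H1 \<Omega>" "\<And>n::nat. v n \<in> H1 \<Omega>" "(\<lambda>n. H1_norm \<Omega> (\<lambda>x. v n x - u x)) \<longlonglongrightarrow> 0"
  shows "(\<lambda>n. l2norm (lebesgue_on \<Omega>) (\<lambda>x. v n x - u x)) \<longlonglongrightarrow> 0"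
    "(\<lambda>n. l2norm (lebesgue_on \<Omega>) (\<lambda>x. weak_grad \<Omega> (v n) x - weak_grad \<Omega> u x)) \<longlonglongrightarrow> 0"
proof -
  show "(\<lambda>n. l2norm (lebesgue_on \<Omega>) (\<lambda>x. v n x - u x)) \<longlonglongrightarrow> 0"
    by (rule tendsto_sandwich[OF _ _ tendsto_const assms(4)])
       (simp_all add: H1_norm_diff_bounds(1)[OF \<Omega> assms(3,2)])
  show "(\<lambda>n. l2norm (lebesgue_on \<Omega>) (\<lambda>x. weak_grad \<Omega> (v n) x - weak_grad \<Omega> u x)) \<longlonglongrightarrow> 0"
    by (rule tendsto_sandwich[OF _ _ tendsto_const assms(4)])
       (simp_all add: H1_norm_diff_bounds(2)[OF \<Omega> assms(3,2)])
qed

text \<open>These are the two functionals whose values for \<open>G\<close> and for its reflection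
  are compared in the Borsuk-Ulam argument.\<close>

lemma continuous_map_contraction_norms:
  assumes \<Omega>: "open \<Omega>" and G: "C11_contraction L G G'"
  shows "continuous_map (H1_topology \<Omega>) euclideanreal (\<lambda>u. l2norm (lebesgue_on \<Omega>) (\<lambda>x. G (u x)))"
    "continuous_map (H1_topology \<Omega>) euclideanreal
      (\<lambda>u. l2norm (lebesgue_on \<Omega>) (\<lambda>x. G' (u x) *\<^sub>R weak_grad \<Omega> u x))"
proof -
  let ?M = "lebesgue_on \<Omega>"
  show "continuous_map (H1_topology \<Omega>) euclideanreal (\<lambda>u. l2norm ?M (\<lambda>x. G (u x)))"
  proof (rule continuous_map_H1_sequentially)
    fix u and v :: "nat \<Rightarrow> 'a \<Rightarrow> real"
    assume a: "u \<in> H1 \<Omega>" "\<And>n. v n \<in> H1 \<Omega>" "(\<lambda>n. H1_norm \<Omega> (\<lambda>x. v n x - u x)) \<longlonglongrightarrow> 0"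
    note s = H1_sq_int[OF a(1)] H1_sq_int[OF a(2)]
    show "(\<lambda>n. l2norm ?M (\<lambda>x. G (v n x))) \<longlonglongrightarrow> l2norm ?M (\<lambda>x. G (u x))"
    proof (rule l2norm_tendsto)
      show "(\<lambda>n. l2norm ?M (\<lambda>x. G (v n x) - G (u x))) \<longlonglongrightarrow> 0"
        by (rule tendsto_sandwich[OF _ _ tendsto_const H1_norm_tendsto_components(1)[OF \<Omega> a]])
           (simp_all add: l2norm_contraction_diff[OF G s(4) s(1)])
    qed (use C11_contraction_sq_int[OF G] s in blast)+
  qed
  show "continuous_map (H1_topology \<Omega>) euclideanreal (\<lambda>u. l2norm ?M (\<lambda>x. G' (u x) *\<^sub>R weak_grad \<Omega> u x))"
  proof (rule continuous_map_H1_sequentially)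
    fix u and v :: "nat \<Rightarrow> 'a \<Rightarrow> real"
    assume a: "u \<in> H1 \<Omega>" "\<And>n. v n \<in> H1 \<Omega>" "(\<lambda>n. H1_norm \<Omega> (\<lambda>x. v n x - u x)) \<longlonglongrightarrow> 0"
    note s = H1_sq_int[OF a(1)] H1_sq_int[OF a(2)]
    show "(\<lambda>n. l2norm ?M (\<lambda>x. G' (v n x) *\<^sub>R weak_grad \<Omega> (v n) x)) \<longlonglongrightarrow> l2norm ?M (\<lambda>x. G' (u x) *\<^sub>R weak_grad \<Omega> u x)"
      by (rule l2norm_tendsto[OF _ _ l2norm_chain_diff_tendsto[OF G s(1) s(4) s(2) s(5) H1_norm_tendsto_components[OF \<Omega> a]]])
        (use C11_contraction_sq_int[OF G] s in blast)+
  qed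
qed

section \<open>Extension by zero to the whole space\<close>

lemma integral_zero_extension:
  fixes h :: "'a::euclidean_space \<Rightarrow> real"
  assumes "\<Omega> \<in> sets lebesgue"
  shows "(LINT x|lebesgue_on UNIV. (if x \<in> \<Omega> then h x else 0)) = (LINT x|lebesgue_on \<Omega>. h x)"
proof -
  have "(\<lambda>x. if x \<in> \<Omega> then h x else 0) = (\<lambda>x. indicator \<Omega> x *\<^sub>R h x)"
    by (auto simp: indicator_def fun_eq_iff)
  then show ?thesis using assms by (simp add: lebesgue_on_UNIV_eq integral_restrict_space)
qed

lemma sq_int_zero_extension:
  fixes f :: "'a::euclidean_space \<Rightarrow> 'b::euclidean_space"
  assumes \<Omega>: "\<Omega> \<in> sets lebesgue" and f: "sq_int (lebesgue_on \<Omega>) f"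
  shows "sq_int (lebesgue_on UNIV) (\<lambda>x. if x \<in> \<Omega> then f x else 0)"
    "l2norm (lebesgue_on UNIV) (\<lambda>x. if x \<in> \<Omega> then f x else 0) = l2norm (lebesgue_on \<Omega>) f"
proof -
  have eq: "(\<lambda>x. (norm (if x \<in> \<Omega> then f x else 0))\<^sup>2) = (\<lambda>x. indicator \<Omega> x *\<^sub>R (norm (f x))\<^sup>2)"
    by (auto simp: indicator_def fun_eq_iff)
  have "integrable lebesgue (\<lambda>x. indicator \<Omega> x *\<^sub>R (norm (f x))\<^sup>2)"
    using sq_int_integrable[OF f] \<Omega> by (simp add: integrable_restrict_space)
  then show "sq_int (lebesgue_on UNIV) (\<lambda>x. if x \<in> \<Omega> then f x else 0)"
    unfolding sq_int_def eq lebesgue_on_UNIV_eq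
    using borel_measurable_if_I[OF sq_int_measurable[OF f] \<Omega>] by blast
  show "l2norm (lebesgue_on UNIV) (\<lambda>x. if x \<in> \<Omega> then f x else 0) = l2norm (lebesgue_on \<Omega>) f"
    using \<Omega> unfolding l2norm_def eq lebesgue_on_UNIV_eq by (simp add: integral_restrict_space)
qed

lemma tendsto_integral_inner:
  assumes f: "\<And>n::nat. sq_int M (f n)" "sq_int M g" and h: "sq_int M h"
    and lim: "(\<lambda>n. l2norm M (\<lambda>x. f n x - g x)) \<longlonglongrightarrow> 0"
  shows "(\<lambda>n. LINT x|M. f n x \<bullet> h x) \<longlonglongrightarrow> (LINT x|M. g x \<bullet> h x)"
proof (rule LIM_zero_cancel, rule tendsto_rabs_zero_cancel, rule tendsto_sandwich[OF _ _ tendsto_const])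
  have "(LINT x|M. f n x \<bullet> h x) - (LINT x|M. g x \<bullet> h x) = (LINT x|M. (f n x - g x) \<bullet> h x)" for n
    using sq_int_inner[OF f(1) h] sq_int_inner[OF f(2) h] by (simp add: inner_diff_left)
  then show "\<forall>\<^sub>F n in sequentially. \<bar>(LINT x|M. f n x \<bullet> h x) - (LINT x|M. g x \<bullet> h x)\<bar>
      \<le> l2norm M (\<lambda>x. f n x - g x) * l2norm M h"
    using l2norm_inner_le[OF sq_int_diff[OF f] h] by simp
  show "(\<lambda>n. l2norm M (\<lambda>x. f n x - g x) * l2norm M h) \<longlonglongrightarrow> 0"
    using tendsto_mult_right[OF lim, of "l2norm M h"] by simp
qed simp

text \<open>A test function \<psi> on the whole space need not vanish on the boundary of \<Omega>.
  For \<open>G (\<phi> n x)\<close> with \<phi> n supported inside \<Omega> there is nevertheless no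
  boundary term, as \<open>G 0 = 0\<close>, and membership of \<open>u\<close> in \<open>H10\<close>
  allows the limit.\<close>

lemma is_weak_gradient_zero_extension_contraction:
  assumes \<Omega>: "open \<Omega>" and u: "u \<in> H10 \<Omega>" and G: "C11_contraction L G G'"
  shows "is_weak_gradient UNIV (\<lambda>x. if x \<in> \<Omega> then G (u x) else 0)
    (\<lambda>x. if x \<in> \<Omega> then G' (u x) *\<^sub>R weak_grad \<Omega> u x else 0)"
  unfolding is_weak_gradient_def
proof (intro ballI)
  fix \<psi> :: "'a \<Rightarrow> real" and b :: 'a
  assume \<psi>: "\<psi> \<in> test_functions UNIV" and b: "b \<in> Basis"
  let ?M = "lebesgue_on \<Omega>"
  note D = C11_contractionD[OF G]
  have \<Omega>m: "\<Omega> \<in> sets lebesgue" using \<Omega> by simp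
  have u1: "u \<in> H1 \<Omega>" using H10_imp_H1[OF u] .
  obtain \<phi> where \<phi>: "\<And>n::nat. \<phi> n \<in> test_functions \<Omega>" "(\<lambda>n. H1_norm \<Omega> (\<lambda>x. \<phi> n x - u x)) \<longlonglongrightarrow> 0"
    using H10_approx[OF \<Omega> u] by blast
  have \<phi>1: "\<phi> n \<in> H1 \<Omega>" for n using test_function_H1(1)[OF \<Omega> \<phi>(1)] .
  note s = H1_sq_int[OF u1] H1_sq_int[OF \<phi>1]
  note lim = H1_norm_tendsto_components[OF \<Omega> u1 \<phi>1 \<phi>(2)]
  have \<psi>s: "sq_int ?M \<psi>" "sq_int ?M (\<lambda>x. classical_grad \<psi> x \<bullet> b)"
    using test_function_sq_int[OF \<psi> \<Omega>m] by (auto intro: sq_int_inner_const)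
  have \<psi>b: "sq_int ?M (\<lambda>x. \<psi> x *\<^sub>R b)"
    by (rule sq_int_bound[OF \<psi>s(1), where C = "norm b"])
       (use sq_int_measurable[OF \<psi>s(1)] in \<open>auto simp: mult.commute\<close>)
  have parts: "(LINT x|?M. G (\<phi> n x) \<bullet> (classical_grad \<psi> x \<bullet> b))
      = - (LINT x|?M. (G' (\<phi> n x) *\<^sub>R weak_grad \<Omega> (\<phi> n) x) \<bullet> (\<psi> x *\<^sub>R b))" for n
  proof -
    note t = test_function_C1_compact[OF \<phi>(1)[of n]]
    note t' = test_function_C1_compact[OF \<psi>]
    note c = C1_compact_compose[OF t D(2) D(9) D(5)]
    have cont: "continuous_on UNIV (\<lambda>x. G (\<phi> n x))" "continuous_on UNIV (\<lambda>x. G' (\<phi> n x) *\<^sub>R classical_grad (\<phi> n) x)"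
      "continuous_on UNIV \<psi>" "continuous_on UNIV (classical_grad \<psi>)"
      using c t' C1_compact_continuous[OF c] C1_compact_continuous[OF t'] unfolding C1_compact_def by blast+
    have "(LINT x|?M. G (\<phi> n x) * (classical_grad \<psi> x \<bullet> b)) = (LINT x|lborel. G (\<phi> n x) * (classical_grad \<psi> x \<bullet> b))"
      using test_function_zero[OF \<phi>(1)] D(5)
      by (intro integral_lebesgue_on_eq_lborel[OF _ \<Omega>m] borel_measurable_continuous_onI continuous_intros cont) simp
    also have "\<dots> = - (LINT x|lborel. ((G' (\<phi> n x) *\<^sub>R classical_grad (\<phi> n) x) \<bullet> b) * \<psi> x)"
      by (rule integration_by_parts_C1_compact[OF c t'])
    also have "(LINT x|lborel. ((G' (\<phi> n x) *\<^sub>R classical_grad (\<phi> n) x) \<bullet> b) * \<psi> x)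
        = (LINT x|?M. ((G' (\<phi> n x) *\<^sub>R classical_grad (\<phi> n) x) \<bullet> b) * \<psi> x)"
      using test_function_zero[OF \<phi>(1)]
      by (intro integral_lebesgue_on_eq_lborel[OF _ \<Omega>m, symmetric] borel_measurable_continuous_onI continuous_intros cont) simp
    also have "\<dots> = (LINT x|?M. (G' (\<phi> n x) *\<^sub>R weak_grad \<Omega> (\<phi> n) x) \<bullet> (\<psi> x *\<^sub>R b))"
    proof (rule integral_cong_AE)
      show "(\<lambda>x. ((G' (\<phi> n x) *\<^sub>R classical_grad (\<phi> n) x) \<bullet> b) * \<psi> x) \<in> borel_measurable ?M"
        by (intro measurable_lebesgue_on_continuous continuous_intros cont)
      show "(\<lambda>x. (G' (\<phi> n x) *\<^sub>R weak_grad \<Omega> (\<phi> n) x) \<bullet> (\<psi> x *\<^sub>R b)) \<in> borel_measurable ?M"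
        by (intro borel_measurable_inner sq_int_measurable[OF \<psi>b] sq_int_measurable[OF C11_contraction_sq_int(2)[OF G s(4) s(5)]])
      show "AE x in ?M. ((G' (\<phi> n x) *\<^sub>R classical_grad (\<phi> n) x) \<bullet> b) * \<psi> x
          = (G' (\<phi> n x) *\<^sub>R weak_grad \<Omega> (\<phi> n) x) \<bullet> (\<psi> x *\<^sub>R b)"
        using test_function_H1(2)[OF \<Omega> \<phi>(1)[of n]] by eventually_elim simp
    qed
    finally show ?thesis by simp
  qed
  have l1: "(\<lambda>n. LINT x|?M. G (\<phi> n x) \<bullet> (classical_grad \<psi> x \<bullet> b)) \<longlonglongrightarrow>
      (LINT x|?M. G (u x) \<bullet> (classical_grad \<psi> x \<bullet> b))"
  proof (rule tendsto_integral_inner[OF _ _ \<psi>s(2)])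
    show "(\<lambda>n. l2norm ?M (\<lambda>x. G (\<phi> n x) - G (u x))) \<longlonglongrightarrow> 0"
      by (rule tendsto_sandwich[OF _ _ tendsto_const lim(1)])
         (simp_all add: l2norm_contraction_diff[OF G s(4) s(1)])
  qed (use C11_contraction_sq_int[OF G] s in blast)+
  have l2: "(\<lambda>n. LINT x|?M. (G' (\<phi> n x) *\<^sub>R weak_grad \<Omega> (\<phi> n) x) \<bullet> (\<psi> x *\<^sub>R b)) \<longlonglongrightarrow>
      (LINT x|?M. (G' (u x) *\<^sub>R weak_grad \<Omega> u x) \<bullet> (\<psi> x *\<^sub>R b))"
    by (rule tendsto_integral_inner[OF _ _ \<psi>b l2norm_chain_diff_tendsto[OF G s(1) s(4) s(2) s(5) lim]])
       (use C11_contraction_sq_int[OF G] s in blast)+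
  \<comment> \<open>Both sides of \<open>parts\<close> converge, so the identity survives for
    \<open>u\<close>; it remains to write integrals over \<Omega> as integrals of extensions by
    zero.\<close>
  have eq: "(LINT x|?M. G (u x) * (classical_grad \<psi> x \<bullet> b)) = - (LINT x|?M. (G' (u x) *\<^sub>R weak_grad \<Omega> u x) \<bullet> (\<psi> x *\<^sub>R b))"
    using LIMSEQ_unique[OF l1[unfolded parts] tendsto_minus[OF l2]] by simp
  have "(LINT x|lebesgue_on UNIV. (if x \<in> \<Omega> then G (u x) else 0) * frechet_derivative \<psi> (at x) b)
      = (LINT x|lebesgue_on UNIV. (if x \<in> \<Omega> then G (u x) * (classical_grad \<psi> x \<bullet> b) else 0))"
    by (intro Bochner_Integration.integral_cong) (auto simp: test_function_frechet_derivative[OF \<psi>])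
  also have "\<dots> = (LINT x|?M. G (u x) * (classical_grad \<psi> x \<bullet> b))"
    by (rule integral_zero_extension[OF \<Omega>m])
  also have "\<dots> = - (LINT x|lebesgue_on UNIV. (if x \<in> \<Omega> then (G' (u x) *\<^sub>R weak_grad \<Omega> u x) \<bullet> (\<psi> x *\<^sub>R b) else 0))"
    unfolding eq integral_zero_extension[OF \<Omega>m] ..
  also have "(LINT x|lebesgue_on UNIV. (if x \<in> \<Omega> then (G' (u x) *\<^sub>R weak_grad \<Omega> u x) \<bullet> (\<psi> x *\<^sub>R b) else 0))
      = (LINT x|lebesgue_on UNIV. ((if x \<in> \<Omega> then G' (u x) *\<^sub>R weak_grad \<Omega> u x else 0) \<bullet> b) * \<psi> x)"
    by (intro Bochner_Integration.integral_cong) auto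
  finally show "(LINT x|lebesgue_on UNIV. (if x \<in> \<Omega> then G (u x) else 0) * frechet_derivative \<psi> (at x) b)
      = - (LINT x|lebesgue_on UNIV. ((if x \<in> \<Omega> then G' (u x) *\<^sub>R weak_grad \<Omega> u x else 0) \<bullet> b) * \<psi> x)" .
qed

lemma zero_extension_contraction:
  assumes \<Omega>: "open \<Omega>" and u: "u \<in> H10 \<Omega>" and G: "C11_contraction L G G'"
  defines "v \<equiv> \<lambda>x. if x \<in> \<Omega> then G (u x) else 0"
  shows "v \<in> H1 UNIV" "sqrt (mass UNIV v) = l2norm (lebesgue_on \<Omega>) (\<lambda>x. G (u x))"
    "sqrt (energy UNIV v) = l2norm (lebesgue_on \<Omega>) (\<lambda>x. G' (u x) *\<^sub>R weak_grad \<Omega> u x)"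
proof -
  have \<Omega>m: "\<Omega> \<in> sets lebesgue" using \<Omega> by simp
  note s = H1_sq_int[OF H10_imp_H1[OF u]]
  note c = C11_contraction_sq_int[OF G s(1) s(2)]
  note z1 = sq_int_zero_extension[OF \<Omega>m c(1), folded v_def]
  note z2 = sq_int_zero_extension[OF \<Omega>m c(2)]
  note w = H1_weak_gradI[OF open_UNIV z1(1) z2(1) is_weak_gradient_zero_extension_contraction[OF \<Omega> u G, folded v_def]]
  show "v \<in> H1 UNIV" by (rule w(1))
  show "sqrt (mass UNIV v) = l2norm (lebesgue_on \<Omega>) (\<lambda>x. G (u x))"
    unfolding mass_eq_l2norm z1(2) by simp
  show "sqrt (energy UNIV v) = l2norm (lebesgue_on \<Omega>) (\<lambda>x. G' (u x) *\<^sub>R weak_grad \<Omega> u x)"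
    unfolding w(3) z2(2) by simp
qed

section \<open>The Borsuk--Ulam theorem for the 2-sphere\<close>

text \<open>A zero-free map restricted to the upper hemisphere, a disc, has a logarithm \<open>g\<close>. On the equator
  oddness forces the odd function \<open>z \<mapsto> Im (g (- z) - g z)\<close> to take values in the odd multiples of
  \<open>\<pi>\<close>, whereas it must vanish somewhere because the circle is connected.\<close>

theorem Borsuk_Ulam_nsphere_complex:
  fixes F :: "(nat \<Rightarrow> real) \<Rightarrow> complex"
  assumes m: "m \<ge> 2" and F: "continuous_map (nsphere m) euclidean F"
    and odd: "\<And>x. x \<in> topspace (nsphere m) \<Longrightarrow> F (\<lambda>i. - x i) = - F x"
  shows "\<exists>x\<in>topspace (nsphere m). F x = 0"
proof (rule ccontr)
  assume "\<not> ?thesis"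
  then have nz: "\<And>x. x \<in> topspace (nsphere m) \<Longrightarrow> F x \<noteq> 0" by blast
  \<comment> \<open>The closed unit disc as the upper hemisphere of the first three coordinates,
    which exist because \<open>m\<close> is at least 2; a sphere of higher dimension contains this
    2-sphere.\<close>
  define e :: "complex \<Rightarrow> nat \<Rightarrow> real" where
    "e z = (\<lambda>i. if i = 0 then Re z else if i = 1 then Im z else if i = 2 then sqrt (1 - (cmod z)\<^sup>2) else 0)" for z
  have e_in: "e z \<in> {x. (\<Sum>i\<le>m. (x i)\<^sup>2) = 1 \<and> (\<forall>i>m. x i = 0)}" if "z \<in> cball 0 1" for z
  proof -
    have z: "(cmod z)\<^sup>2 \<le> 1" using that by (simp add: abs_square_le_1)
    have "(\<Sum>i\<le>m. (e z i)\<^sup>2) = (\<Sum>i\<in>{0,1,2}. (e z i)\<^sup>2)"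
      using m by (intro sum.mono_neutral_right) (auto simp: e_def)
    also have "\<dots> = 1" using z by (simp add: e_def cmod_power2)
    finally show ?thesis using m by (auto simp: e_def)
  qed
  have top: "e z \<in> topspace (nsphere m)" if "z \<in> cball 0 1" for z
    using e_in[OF that] by (simp add: nsphere)
  have e_cont: "continuous_map (top_of_set (cball 0 1)) (nsphere m) e"
    unfolding nsphere
  proof (intro continuous_map_into_subtopology)
    show "continuous_map (top_of_set (cball 0 1)) (powertop_real UNIV) e"
      unfolding continuous_map_componentwise_UNIV
    proof
      fix k
      show "continuous_map (top_of_set (cball 0 1)) euclideanreal (\<lambda>x. e x k)"
        unfolding e_def continuous_map_iff_continuous
        by (cases "k = 0"; cases "k = 1"; cases "k = 2") (auto intro!: continuous_intros)
    qed
  qed (use e_in in auto)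
  have f: "continuous_on (cball 0 1) (F \<circ> e)"
    using continuous_map_compose[OF e_cont F] by (simp add: continuous_map_iff_continuous)
  obtain g where g: "continuous_on (cball 0 1) g" "\<And>z. z \<in> cball 0 1 \<Longrightarrow> (F \<circ> e) z = exp (g z)"
    using continuous_logarithm_on_cball[OF f] nz top by (metis comp_apply)
  define d where "d z = Im (g (- z) - g z)" for z
  have "continuous_on (sphere 0 1) (\<lambda>z. g (- z))"
    by (rule continuous_on_compose2[OF g(1)]) (auto intro!: continuous_intros)
  then have dc: "continuous_on (sphere 0 1) d"
    unfolding d_def using g(1) by (intro continuous_intros) (auto intro: continuous_on_subset)
  have d0: "d z \<noteq> 0" if "z \<in> sphere 0 1" for z
  proof
    assume "d z = 0"
    have z: "z \<in> cball 0 1" "- z \<in> cball 0 1" using that by auto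
    \<comment> \<open>On the equator the height coordinate is 0; elsewhere \<open>e\<close> is not
      odd.\<close>
    have "e (- z) = (\<lambda>i. - e z i)" using that by (auto simp: e_def)
    then have "exp (g (- z)) = - exp (g z)"
      using g(2)[OF z(1)] g(2)[OF z(2)] odd[OF top[OF z(1)]] by simp
    then have "exp (g (- z) - g z) = -1" by (simp add: exp_diff)
    moreover have "exp (g (- z) - g z) = of_real (exp (Re (g (- z) - g z)))"
      using \<open>d z = 0\<close> by (simp add: exp_eq_polar d_def)
    ultimately have "complex_of_real (exp (Re (g (- z) - g z))) = complex_of_real (-1)" by simp
    then have "exp (Re (g (- z) - g z)) = -1" by (simp only: of_real_eq_iff)
    then show False by (metis exp_gt_zero neg_0_less_iff_less not_one_less_zero)
  qed
  have "connected (sphere (0::complex) 1)" by (rule connected_sphere) simp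
  then have conn: "connected (d ` sphere 0 1)" by (rule connected_continuous_image[OF dc])
  have s: "d 1 \<in> d ` sphere 0 1" "d (-1) \<in> d ` sphere 0 1" by auto
  have "d (-1) = - d 1" by (simp add: d_def)
  then have "0 \<in> d ` sphere 0 1"
    using connectedD_interval[OF conn s(1) s(2), of 0] connectedD_interval[OF conn s(2) s(1), of 0] by linarith
  then show False using d0 by force
qed

section \<open>Balanced elements of sets of genus three\<close>

text \<open>A supremum of extended naturals reaches 3 only if some admissible \<open>m\<close> does.
  That \<open>m\<close> may be larger than 3, which is why the Borsuk-Ulam statement covers all
  \<open>nsphere m\<close> with \<open>m\<close> at least 2.\<close>

lemma genus_ge_3D:
  assumes "enat 3 \<le> genus \<Omega> A"
  obtains m h where "m \<ge> 3" "continuous_map (nsphere (m - 1)) (subtopology (H10_topology \<Omega>) A) h"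
    "\<And>x. x \<in> topspace (nsphere (m - 1)) \<Longrightarrow> AE y in lebesgue_on \<Omega>. h (\<lambda>i. - x i) y = - h x y"
proof -
  let ?P = "\<lambda>m h. continuous_map (nsphere (m - 1)) (subtopology (H10_topology \<Omega>) A) h \<and>
      (\<forall>x\<in>topspace (nsphere (m - 1)). AE y in lebesgue_on \<Omega>. h (\<lambda>i. - x i) y = - h x y)"
  have "\<exists>m h. m \<ge> 3 \<and> ?P m h"
  proof (rule ccontr)
    assume neg: "\<not> ?thesis"
    have "genus \<Omega> A \<le> enat 2"
      unfolding genus_def
    proof (rule Sup_least)
      fix z assume "z \<in> {enat m |m. 1 \<le> m \<and> (\<exists>h. ?P m h)}"
      then obtain m h where m: "z = enat m" "?P m h" by blast
      then have "\<not> m \<ge> 3" using neg by blast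
      then show "z \<le> enat 2" using m(1) by simp
    qed
    with assms have "enat 3 \<le> enat 2" by (rule order_trans)
    then show False by simp
  qed
  then show ?thesis using that by blast
qed

text \<open>The maps defining the genus are odd only almost everywhere and the gradients are
  arbitrary representatives, so the sign rule goes through uniqueness of weak gradients.\<close>

lemma weak_grad_AE_uminus:
  assumes \<Omega>: "open \<Omega>" and u: "u \<in> H1 \<Omega>" and w: "w \<in> H1 \<Omega>"
    and ae: "AE x in lebesgue_on \<Omega>. w x = - u x"
  shows "AE x in lebesgue_on \<Omega>. weak_grad \<Omega> w x = - weak_grad \<Omega> u x"
proof -
  note s = H1_sq_int[OF u] H1_sq_int[OF w]
  have \<Omega>m: "\<Omega> \<in> sets lebesgue" using \<Omega> by simp
  have "is_weak_gradient \<Omega> w (\<lambda>x. - weak_grad \<Omega> u x)"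
    unfolding is_weak_gradient_def
  proof (intro ballI)
    fix \<phi> :: "'a \<Rightarrow> real" and b :: 'a
    assume \<phi>: "\<phi> \<in> test_functions \<Omega>" and b: "b \<in> Basis"
    have m: "(\<lambda>x. classical_grad \<phi> x \<bullet> b) \<in> borel_measurable (lebesgue_on \<Omega>)"
      by (rule sq_int_measurable[OF sq_int_inner_const[OF test_function_sq_int(2)[OF \<phi> \<Omega>m]]])
    note f = test_function_frechet_derivative[OF \<phi>]
    have "(LINT x|lebesgue_on \<Omega>. w x * (classical_grad \<phi> x \<bullet> b)) = (LINT x|lebesgue_on \<Omega>. - (u x * (classical_grad \<phi> x \<bullet> b)))"
    proof (rule integral_cong_AE)
      show "AE x in lebesgue_on \<Omega>. w x * (classical_grad \<phi> x \<bullet> b) = - (u x * (classical_grad \<phi> x \<bullet> b))"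
        using ae by eventually_elim simp
    qed (intro borel_measurable_times borel_measurable_uminus m sq_int_measurable s)+
    also have "\<dots> = - (LINT x|lebesgue_on \<Omega>. u x * frechet_derivative \<phi> (at x) b)"
      by (simp add: f)
    also have "\<dots> = (LINT x|lebesgue_on \<Omega>. (weak_grad \<Omega> u x \<bullet> b) * \<phi> x)"
      using s(3) \<phi> b unfolding is_weak_gradient_def by simp
    finally show "(LINT x|lebesgue_on \<Omega>. w x * frechet_derivative \<phi> (at x) b)
        = - (LINT x|lebesgue_on \<Omega>. (- weak_grad \<Omega> u x \<bullet> b) * \<phi> x)"
      by (simp add: f)
  qed
  from H1_weak_gradI(2)[OF \<Omega> s(4) sq_int_minus[OF s(2)] this] show ?thesis .
qed

lemma genus_3_balanced:
  assumes \<Omega>: "open \<Omega>" and A: "enat 3 \<le> genus \<Omega> A" and G: "C11_contraction L G G'"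
  obtains u where "u \<in> A" "u \<in> H10 \<Omega>"
    "l2norm (lebesgue_on \<Omega>) (\<lambda>x. G (u x)) = l2norm (lebesgue_on \<Omega>) (\<lambda>x. G (- u x))"
    "l2norm (lebesgue_on \<Omega>) (\<lambda>x. G' (u x) *\<^sub>R weak_grad \<Omega> u x)
      = l2norm (lebesgue_on \<Omega>) (\<lambda>x. G' (- u x) *\<^sub>R weak_grad \<Omega> u x)"
proof -
  let ?M = "lebesgue_on \<Omega>"
  obtain m h where m: "m \<ge> 3" and h: "continuous_map (nsphere (m - 1)) (subtopology (H10_topology \<Omega>) A) h"
    and odd: "\<And>x. x \<in> topspace (nsphere (m - 1)) \<Longrightarrow> AE y in lebesgue_on \<Omega>. h (\<lambda>i. - x i) y = - h x y"
    using genus_ge_3D[OF A] by blast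
  let ?X = "nsphere (m - 1)"
  note D = C11_contractionD[OF G]
  note R = C11_contraction_reflect[OF G]
  have h1: "continuous_map ?X (H1_topology \<Omega>) h" and hA: "\<And>x. x \<in> topspace ?X \<Longrightarrow> h x \<in> A \<and> h x \<in> H10 \<Omega>"
    using h by (auto simp: H10_topology_def continuous_map_in_subtopology)
  have hH: "h x \<in> H1 \<Omega>" if "x \<in> topspace ?X" for x using hA[OF that] H10_imp_H1 by blast
  define a where "a u = l2norm ?M (\<lambda>x. G (u x)) - l2norm ?M (\<lambda>x. G (- u x))" for u
  \<comment> \<open>The second term is written with the derivative of the reflected contraction, so
    that its continuity is an instance of \<open>continuous_map_contraction_norms\<close>.\<close>
  define b where "b u = l2norm ?M (\<lambda>x. G' (u x) *\<^sub>R weak_grad \<Omega> u x)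
      - l2norm ?M (\<lambda>x. (- G' (- u x)) *\<^sub>R weak_grad \<Omega> u x)" for u
  have ac: "continuous_map (H1_topology \<Omega>) euclideanreal a"
    unfolding a_def by (intro continuous_map_diff continuous_map_contraction_norms(1)[OF \<Omega> G]
        continuous_map_contraction_norms(1)[OF \<Omega> R])
  have bc: "continuous_map (H1_topology \<Omega>) euclideanreal b"
    unfolding b_def by (intro continuous_map_diff continuous_map_contraction_norms(2)[OF \<Omega> G]
        continuous_map_contraction_norms(2)[OF \<Omega> R])
  define F where "F x = Complex (a (h x)) (b (h x))" for x
  have "continuous_map ?X (prod_topology euclideanreal euclideanreal) (\<lambda>x. (a (h x), b (h x)))"
    using continuous_map_compose[OF h1 ac] continuous_map_compose[OF h1 bc]
    unfolding continuous_map_paired o_def by blast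
  moreover have "continuous_map euclidean euclidean (\<lambda>p. Complex (fst p) (snd p))"
    unfolding continuous_map_iff_continuous2 by (intro continuous_intros)
  ultimately have "continuous_map ?X euclidean ((\<lambda>p. Complex (fst p) (snd p)) \<circ> (\<lambda>x. (a (h x), b (h x))))"
    unfolding prod_topology_euclidean by (rule continuous_map_compose)
  then have Fc: "continuous_map ?X euclidean F" by (simp add: F_def[abs_def] o_def)
  have "F (\<lambda>i. - x i) = - F x" if x: "x \<in> topspace ?X" for x
  proof -
    have x': "(\<lambda>i. - x i) \<in> topspace ?X" using x by (simp add: nsphere)
    define u w where "u = h x" and "w = h (\<lambda>i. - x i)"
    have H: "u \<in> H1 \<Omega>" "w \<in> H1 \<Omega>" using hH x x' by (simp_all add: u_def w_def)
    have ae: "AE y in ?M. w y = - u y" using odd[OF x] by (simp add: u_def w_def)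
    note aw = weak_grad_AE_uminus[OF \<Omega> H ae]
    note s = H1_sq_int[OF H(1)] H1_sq_int[OF H(2)]
    have mG: "(\<lambda>x. G (v x)) \<in> borel_measurable ?M" "(\<lambda>x. G (- v x)) \<in> borel_measurable ?M"
      "(\<lambda>x. G' (v x) *\<^sub>R weak_grad \<Omega> v x) \<in> borel_measurable ?M"
      "(\<lambda>x. (- G' (- v x)) *\<^sub>R weak_grad \<Omega> v x) \<in> borel_measurable ?M"
      if "v \<in> H1 \<Omega>" for v
      using C11_contraction_sq_int[OF G H1_sq_int(1,2)[OF that]]
        C11_contraction_sq_int[OF R H1_sq_int(1,2)[OF that]] sq_int_measurable by blast+
    have "l2norm ?M (\<lambda>x. G (w x)) = l2norm ?M (\<lambda>x. G (- u x))"
      by (rule l2norm_cong_AE[OF mG(1)[OF H(2)] mG(2)[OF H(1)]]) (use ae in \<open>eventually_elim, simp\<close>)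
    moreover have "l2norm ?M (\<lambda>x. G (- w x)) = l2norm ?M (\<lambda>x. G (u x))"
      by (rule l2norm_cong_AE[OF mG(2)[OF H(2)] mG(1)[OF H(1)]]) (use ae in \<open>eventually_elim, simp\<close>)
    moreover have "l2norm ?M (\<lambda>x. G' (w x) *\<^sub>R weak_grad \<Omega> w x) = l2norm ?M (\<lambda>x. (- G' (- u x)) *\<^sub>R weak_grad \<Omega> u x)"
      by (rule l2norm_cong_AE[OF mG(3)[OF H(2)] mG(4)[OF H(1)]]) (use ae aw in \<open>eventually_elim, simp\<close>)
    moreover have "l2norm ?M (\<lambda>x. (- G' (- w x)) *\<^sub>R weak_grad \<Omega> w x) = l2norm ?M (\<lambda>x. G' (u x) *\<^sub>R weak_grad \<Omega> u x)"
      by (rule l2norm_cong_AE[OF mG(4)[OF H(2)] mG(3)[OF H(1)]]) (use ae aw in \<open>eventually_elim, simp\<close>)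
    \<comment> \<open>Replacing \<open>u\<close> by its almost everywhere negative \<open>w\<close>
      exchanges the two norms in each difference. This makes the functionals exactly odd, as
      Borsuk-Ulam demands, although \<open>h\<close> is not.\<close>
    ultimately have "a w = - a u" "b w = - b u" by (simp_all only: a_def b_def minus_diff_eq)
    then show ?thesis by (simp add: F_def u_def w_def complex_eq_iff)
  qed
  then have "\<exists>x\<in>topspace ?X. F x = 0"
    using m by (intro Borsuk_Ulam_nsphere_complex[OF _ Fc]) simp_all
  then obtain x where x: "x \<in> topspace ?X" "F x = 0" by blast
  then have "a (h x) = 0" "b (h x) = 0" by (simp_all add: F_def complex_eq_iff)
  then show ?thesis using hA[OF x(1)] by (intro that[of "h x"]) (simp_all add: a_def b_def)
qed

section \<open>The Gagliardo-Nirenberg bound for \<open>M_level\<close>\<close>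

lemma le_Inf_mult_ennreal:
  fixes S :: "ennreal set" and r :: real
  assumes S: "\<And>C. C \<in> S \<Longrightarrow> x \<le> C * ennreal r" and fin: "Inf S \<noteq> \<infinity>" and r: "0 \<le> r"
  shows "x \<le> Inf S * ennreal r"
proof (cases "r = 0")
  case True
  \<comment> \<open>For empty \<open>S\<close> the right side would be \<infinity> * 0 = 0 and the
    bound could fail; finiteness of the infimum supplies an element.\<close>
  have "S \<noteq> {}" using fin by (auto simp: infinity_ennreal_def)
  then obtain C where "C \<in> S" by blast
  from S[OF this] show ?thesis by (simp add: True)
next
  case False
  then have r: "r > 0" using r by simp
  have "x / ennreal r \<le> Inf S"
    using S r by (intro Inf_greatest divide_le_posI_ennreal) (simp_all add: mult.commute)
  then have "x / ennreal r * ennreal r \<le> Inf S * ennreal r"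
    by (rule mult_right_mono) simp
  moreover have "x / ennreal r * ennreal r = x"
    using r by (simp add: ennreal_divide_times)
  ultimately show ?thesis by simp
qed

lemma gn_constant_bound:
  fixes v :: "'a::euclidean_space \<Rightarrow> real"
  assumes fin: "gn_constant TYPE('a) p \<noteq> \<infinity>" and v: "v \<in> H1 UNIV"
  shows "Lq_power UNIV (p + 1) v \<le> gn_constant TYPE('a) p *
    ennreal (sqrt (energy UNIV v) powr (real DIM('a) * (p - 1) / 2) *
      sqrt (mass UNIV v) powr ((p + 1) - real DIM('a) * (p - 1) / 2))"
  unfolding gn_constant_def
  by (rule le_Inf_mult_ennreal) (use v fin[unfolded gn_constant_def] in \<open>blast, blast, simp\<close>)

text \<open>An error t*t is compared with the threshold t. Below it, s^q is at most t^q; above it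
  the error is at most the fraction t of s, so (1 - t) s \<le> x.\<close>

lemma powr_le_split:
  fixes s t x q :: real
  assumes "0 < t" "t < 1" "0 \<le> x" "0 \<le> s" "s \<le> x + t\<^sup>2" "0 \<le> q"
  shows "s powr q \<le> (1 - t) powr (- q) * x powr q + t powr q"
proof (cases "s \<le> t")
  case True
  then have "s powr q \<le> t powr q" using assms by (intro powr_mono2) auto
  moreover have "0 \<le> (1 - t) powr (- q) * x powr q" by simp
  ultimately show ?thesis by linarith
next
  case False
  have "t\<^sup>2 \<le> t * s" using False assms by (simp add: power2_eq_square mult_left_mono)
  then have "(1 - t) * s \<le> x" using assms(5) by (simp add: algebra_simps)
  then have "((1 - t) * s) powr q \<le> x powr q" using assms by (intro powr_mono2) auto
  then have "(1 - t) powr (- q) * ((1 - t) powr q * s powr q) \<le> (1 - t) powr (- q) * x powr q"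
    using assms by (intro mult_left_mono) (auto simp: powr_mult)
  moreover have "(1 - t) powr (- q) * ((1 - t) powr q * s powr q) = s powr q"
    using assms by (simp add: powr_minus mult.assoc[symmetric])
  moreover have "0 \<le> t powr q" by simp
  ultimately show ?thesis by linarith
qed

lemma Lq_power_zero_extension:
  assumes "\<Omega> \<in> sets lebesgue"
  shows "Lq_power UNIV q (\<lambda>x. if x \<in> \<Omega> then f x else 0) = Lq_power \<Omega> q f"
proof -
  have "Lq_power \<Omega> q f = (\<integral>\<^sup>+x. ennreal (\<bar>f x\<bar> powr q) * indicator \<Omega> x \<partial>lebesgue)"
    using assms unfolding Lq_power_def by (subst nn_integral_restrict_space) auto
  also have "\<dots> = Lq_power UNIV q (\<lambda>x. if x \<in> \<Omega> then f x else 0)"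
    unfolding Lq_power_def lebesgue_on_UNIV_eq by (intro nn_integral_cong) (auto simp: indicator_def)
  finally show ?thesis ..
qed

text \<open>\<open>f\<close> and \<open>g\<close> stand for the two truncated parts and
  \<open>h\<close> for the whole: by the equality of norms, twice the square of one is the square of
  both parts together.\<close>

lemma sum_sq_balanced_le:
  assumes f: "sq_int M f" and g: "sq_int M g" and h: "sq_int M h"
    and le: "\<And>x. (norm (f x))\<^sup>2 + (norm (g x))\<^sup>2 \<le> (norm (h x))\<^sup>2"
    and eq: "l2norm M f = l2norm M g" and c: "(l2norm M h)\<^sup>2 \<le> c"
  shows "l2norm M f \<le> sqrt (c / 2)"
proof -
  have "(l2norm M f)\<^sup>2 + (l2norm M g)\<^sup>2 = (LINT x|M. (norm (f x))\<^sup>2 + (norm (g x))\<^sup>2)"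
    using sq_int_integrable[OF f] sq_int_integrable[OF g] by (simp add: l2norm_squared)
  also have "\<dots> \<le> (l2norm M h)\<^sup>2"
    unfolding l2norm_squared using sq_int_integrable[OF f] sq_int_integrable[OF g] sq_int_integrable[OF h] le
    by (intro integral_mono) auto
  finally have "(l2norm M f)\<^sup>2 \<le> c / 2" using c eq by simp
  then show ?thesis by (rule real_le_rsqrt)
qed

text \<open>The whole-space inequality is applied to the extension by zero. Both exponents are
  nonnegative, so the two norms may be replaced by upper bounds.\<close>

lemma H10_gn_bound:
  fixes \<Omega> :: "'a::euclidean_space set"
  defines "a p \<equiv> real DIM('a) * (p - 1) / 2"
  assumes \<Omega>: "open \<Omega>" and u: "u \<in> H10 \<Omega>" and G: "C11_contraction L G G'"
    and p: "1 < p" "a p \<le> p + 1" and fin: "gn_constant TYPE('a) p \<noteq> \<infinity>"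
    and mass: "l2norm (lebesgue_on \<Omega>) (\<lambda>x. G (u x)) \<le> sqrt c"
    and energy: "l2norm (lebesgue_on \<Omega>) (\<lambda>x. G' (u x) *\<^sub>R weak_grad \<Omega> u x) \<le> sqrt e"
  shows "Lq_power \<Omega> (p + 1) (\<lambda>x. G (u x)) \<le> gn_constant TYPE('a) p * ennreal (sqrt e powr a p * sqrt c powr (p + 1 - a p))"
proof -
  let ?v = "\<lambda>x. if x \<in> \<Omega> then G (u x) else 0"
  have \<Omega>m: "\<Omega> \<in> sets lebesgue" using \<Omega> by simp
  note z = zero_extension_contraction[OF \<Omega> u G]
  have a0: "a p \<ge> 0" using p(1) by (simp add: a_def)
  have "Lq_power \<Omega> (p + 1) (\<lambda>x. G (u x)) = Lq_power UNIV (p + 1) ?v"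
    using Lq_power_zero_extension[OF \<Omega>m] by simp
  also have "\<dots> \<le> gn_constant TYPE('a) p *
      ennreal (sqrt (energy UNIV ?v) powr a p * sqrt (mass UNIV ?v) powr (p + 1 - a p))"
    unfolding a_def by (rule gn_constant_bound[OF fin z(1)])
  also have "\<dots> \<le> gn_constant TYPE('a) p * ennreal (sqrt e powr a p * sqrt c powr (p + 1 - a p))"
    unfolding z(2,3) using mass energy a0 p(2)
    by (intro mult_left_mono ennreal_leI mult_mono powr_mono2) auto
  finally show ?thesis .
qed

text \<open>The powers of 1/2 contributed by energy and mass have exponents a/2 and (p+1-a)/2, so
  \<open>a\<close> cancels from the total power of 2.\<close>

lemma gn_exponent_eq:
  assumes "0 \<le> \<alpha>" "a \<le> p + 1"
  shows "2 * (sqrt (\<alpha> / 2) powr a * sqrt (1 / 2) powr (p + 1 - a)) = 2 powr (- ((p - 1) / 2)) * \<alpha> powr (a / 2)"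
proof -
  have 1: "sqrt x powr c = x powr (c / 2)" if "0 \<le> x" for x c :: real
    using that by (simp add: powr_half_sqrt[symmetric] powr_powr)
  have 2: "(1 / 2 :: real) powr c = 2 powr (- c)" for c :: real
    using powr_divide[of 1 2 c] by (simp add: powr_minus_divide)
  have "(\<alpha> / 2) powr (a / 2) = \<alpha> powr (a / 2) * (1 / 2) powr (a / 2)"
    using powr_mult[of \<alpha> "1/2" "a/2"] assms by simp
  then have "2 * (sqrt (\<alpha> / 2) powr a * sqrt (1 / 2) powr (p + 1 - a))
      = \<alpha> powr (a / 2) * (2 powr 1 * 2 powr (- (a / 2)) * 2 powr (- ((p + 1 - a) / 2)))"
    using assms by (simp add: 1 2 mult_ac)
  also have "2 powr 1 * 2 powr (- (a / 2)) * 2 powr (- ((p + 1 - a) / 2)) = 2 powr (1 + - (a / 2) + - ((p + 1 - a) / 2))"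
    by (simp only: powr_add)
  also have "1 + - (a / 2) + - ((p + 1 - a) / 2) = - ((p - 1) / 2)" by (simp add: field_simps)
  finally show ?thesis by (simp add: mult.commute)
qed

text \<open>The positive part is smoothed at scale \<open>\<delta> = t\<^sup>2\<close>, so that the error \<open>t powr (- q) * \<delta> powr q\<close>
  vanishes as \<open>t\<close> tends to \<open>0\<close>.\<close>

lemma genus_family_3_approx:
  fixes \<Omega> :: "'a::euclidean_space set"
  defines "a p \<equiv> real DIM('a) * (p - 1) / 2"
  assumes \<Omega>: "open \<Omega>" and bd: "bounded \<Omega>" and A: "A \<in> genus_family 3 \<Omega> \<alpha>"
    and p: "1 < p" "a p \<le> p + 1" and fin: "gn_constant TYPE('a) p \<noteq> \<infinity>"
    and t: "0 < t" "t < 1"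
  shows "(INF u\<in>A. Lq_power \<Omega> (p + 1) u) \<le> ennreal ((1 - t) powr (- (p + 1))) *
      (gn_constant TYPE('a) p * ennreal (2 powr (- ((p - 1) / 2)) * \<alpha> powr (a p / 2)))
      + ennreal (t powr (p + 1) * measure lebesgue \<Omega>)"
proof -
  let ?M = "lebesgue_on \<Omega>" and ?G = "pos_reg (t\<^sup>2)" and ?G' = "pos_reg' (t\<^sup>2)" and ?q = "p + 1"
  have \<Omega>m: "\<Omega> \<in> sets lebesgue" using \<Omega> by simp
  have t2: "t\<^sup>2 > 0" using t by simp
  note G = C11_contraction_pos_reg[OF t2]
  note R = C11_contraction_reflect[OF G]
  note D = C11_contractionD[OF G]
  have A': "enat 3 \<le> genus \<Omega> A" "A \<subseteq> energy_ball \<Omega> \<alpha>" using A by (auto simp: genus_family_def)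
  obtain u where u: "u \<in> A" "u \<in> H10 \<Omega>"
    and bal: "l2norm ?M (\<lambda>x. ?G (u x)) = l2norm ?M (\<lambda>x. ?G (- u x))"
      "l2norm ?M (\<lambda>x. ?G' (u x) *\<^sub>R weak_grad \<Omega> u x) = l2norm ?M (\<lambda>x. ?G' (- u x) *\<^sub>R weak_grad \<Omega> u x)"
    using genus_3_balanced[OF \<Omega> A'(1) G] by blast
  have ub: "(l2norm ?M u)\<^sup>2 \<le> 1" "(l2norm ?M (weak_grad \<Omega> u))\<^sup>2 \<le> \<alpha>"
    using u(1) A'(2) unfolding energy_ball_def mass_sphere_def mass_eq_l2norm energy_eq_l2norm by auto
  \<comment> \<open>Nonnegativity of \<alpha> comes from the energy of a member of \<open>A\<close>,
    which exists by the genus condition.\<close>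
  have \<alpha>0: "0 \<le> \<alpha>" using order_trans[OF zero_le_power2 ub(2)] .
  note s = H1_sq_int[OF H10_imp_H1[OF u(2)]]
  note cs = C11_contraction_sq_int[OF G s(1,2)] C11_contraction_sq_int[OF R s(1,2)]
  \<comment> \<open>One of the two parts always vanishes together with its derivative. Hence their
    squares, and those of the gradients, add up to at most the square of the whole.\<close>
  have z: "?G s = 0 \<and> ?G' s = 0 \<or> ?G (- s) = 0 \<and> ?G' (- s) = 0" for s
    using pos_reg_nonpos[OF t2, of s] pos_reg_nonpos[OF t2, of "- s"] by linarith
  have q1: "(norm (?G s))\<^sup>2 + (norm (?G (- s)))\<^sup>2 \<le> (norm s)\<^sup>2" for s
    using z[of s] D(7)[of s] D(7)[of "- s"] by (auto simp: abs_le_square_iff)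
  have q2: "(norm (?G' s *\<^sub>R y))\<^sup>2 + (norm (- ?G' (- s) *\<^sub>R y))\<^sup>2 \<le> (norm y)\<^sup>2" for s and y :: 'a
    using z[of s] D(3)[of s] D(3)[of "- s"]
    by (auto simp: power_mult_distrib abs_square_le_1 intro!: mult_left_le_one_le)
  have m1: "l2norm ?M (\<lambda>x. ?G (u x)) \<le> sqrt (1 / 2)"
    using sum_sq_balanced_le[OF cs(1) cs(3) s(1) q1 bal(1) ub(1)] .
  have e1: "l2norm ?M (\<lambda>x. ?G' (u x) *\<^sub>R weak_grad \<Omega> u x) \<le> sqrt (\<alpha> / 2)"
    using sum_sq_balanced_le[OF cs(2) cs(4) s(2) q2 _ ub(2)] bal(2) by simp
  have m2: "l2norm ?M (\<lambda>x. ?G (- u x)) \<le> sqrt (1 / 2)" using m1 bal(1) by simp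
  have e2: "l2norm ?M (\<lambda>x. (- ?G' (- u x)) *\<^sub>R weak_grad \<Omega> u x) \<le> sqrt (\<alpha> / 2)" using e1 bal(2) by simp
  let ?C = "gn_constant TYPE('a) p" and ?K = "sqrt (\<alpha> / 2) powr a p * sqrt (1 / 2) powr (p + 1 - a p)"
  have L1: "Lq_power \<Omega> ?q (\<lambda>x. ?G (u x)) \<le> ?C * ennreal ?K"
    unfolding a_def by (rule H10_gn_bound[OF \<Omega> u(2) G p[unfolded a_def] fin m1 e1])
  have L2: "Lq_power \<Omega> ?q (\<lambda>x. ?G (- u x)) \<le> ?C * ennreal ?K"
    unfolding a_def by (rule H10_gn_bound[OF \<Omega> u(2) R p[unfolded a_def] fin m2 e2])
  let ?c = "(1 - t) powr (- ?q)"
  \<comment> \<open>Splitting is applied to |s|, and \<open>?G \<bar>s\<bar>\<close> is one of the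
    two parts.\<close>
  have pt: "\<bar>s\<bar> powr ?q \<le> ?c * (\<bar>?G s\<bar> powr ?q + \<bar>?G (- s)\<bar> powr ?q) + t powr ?q" for s
  proof -
    have "\<bar>s\<bar> powr ?q \<le> ?c * (?G \<bar>s\<bar>) powr ?q + t powr ?q"
      using t p pos_reg_nonneg[OF t2] pos_reg_lower[OF t2] by (intro powr_le_split) auto
    also have "(?G \<bar>s\<bar>) powr ?q \<le> \<bar>?G s\<bar> powr ?q + \<bar>?G (- s)\<bar> powr ?q"
      unfolding abs_of_nonneg[OF pos_reg_nonneg[OF t2]] by (auto simp: abs_if)
    finally show ?thesis by (simp add: mult_left_mono)
  qed
  have Gm [measurable]: "(\<lambda>x. ?G (u x)) \<in> borel_measurable ?M" "(\<lambda>x. ?G (- u x)) \<in> borel_measurable ?M"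
    using cs sq_int_measurable by blast+
  have "(INF u\<in>A. Lq_power \<Omega> ?q u) \<le> Lq_power \<Omega> ?q u" using u(1) by (rule INF_lower)
  also have "\<dots> \<le> (\<integral>\<^sup>+x. ennreal ?c * (ennreal (\<bar>?G (u x)\<bar> powr ?q) + ennreal (\<bar>?G (- u x)\<bar> powr ?q)) + ennreal (t powr ?q) \<partial>?M)"
    unfolding Lq_power_def
  proof (rule nn_integral_mono)
    fix x
    have "ennreal (\<bar>u x\<bar> powr ?q) \<le> ennreal (?c * (\<bar>?G (u x)\<bar> powr ?q + \<bar>?G (- u x)\<bar> powr ?q) + t powr ?q)"
      by (rule ennreal_leI[OF pt])
    then show "ennreal (\<bar>u x\<bar> powr ?q)
        \<le> ennreal ?c * (ennreal (\<bar>?G (u x)\<bar> powr ?q) + ennreal (\<bar>?G (- u x)\<bar> powr ?q)) + ennreal (t powr ?q)"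
      by (simp add: ennreal_mult ennreal_plus)
  qed
  also have "\<dots> = ennreal ?c * (Lq_power \<Omega> ?q (\<lambda>x. ?G (u x)) + Lq_power \<Omega> ?q (\<lambda>x. ?G (- u x)))
      + ennreal (t powr ?q) * emeasure ?M (space ?M)"
    unfolding Lq_power_def by (simp add: nn_integral_add nn_integral_cmult)
  also have "emeasure ?M (space ?M) = ennreal (measure lebesgue \<Omega>)"
  proof -
    have "\<Omega> \<in> lmeasurable" using \<Omega>m bd by (intro bounded_set_imp_lmeasurable)
    then have "emeasure lebesgue \<Omega> = ennreal (measure lebesgue \<Omega>)" by (rule emeasure_eq_measure2)
    then show ?thesis using \<Omega>m by (simp add: emeasure_restrict_space)
  qed
  also have "ennreal ?c * (Lq_power \<Omega> ?q (\<lambda>x. ?G (u x)) + Lq_power \<Omega> ?q (\<lambda>x. ?G (- u x)))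
      \<le> ennreal ?c * (?C * ennreal ?K + ?C * ennreal ?K)"
    using L1 L2 by (intro mult_left_mono add_mono) auto
  also have "?C * ennreal ?K + ?C * ennreal ?K = ?C * ennreal (2 * ?K)"
    by (simp only: mult_2 ennreal_plus mult_nonneg_nonneg powr_ge_zero distrib_left)
  also have "2 * ?K = 2 powr (- ((p - 1) / 2)) * \<alpha> powr (a p / 2)"
    by (rule gn_exponent_eq[OF \<alpha>0 p(2)])
  also have "ennreal (t powr ?q) * ennreal (measure lebesgue \<Omega>) = ennreal (t powr ?q * measure lebesgue \<Omega>)"
    by (rule ennreal_mult[symmetric]) auto
  finally show ?thesis by (simp add: add_right_mono)
qed

text \<open>For fixed \<open>A\<close> only the error terms depend on t: (1 - t)^(-(p+1)) tends to 1
  and t^(p+1) times the volume of \<Omega> tends to 0.\<close>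

lemma M_level_3_le:
  fixes \<Omega> :: "'a::euclidean_space set"
  defines "a p \<equiv> real DIM('a) * (p - 1) / 2"
  assumes \<Omega>: "open \<Omega>" and bd: "bounded \<Omega>" and p: "1 < p" "a p \<le> p + 1" and fin: "gn_constant TYPE('a) p \<noteq> \<infinity>"
  shows "M_level 3 \<Omega> p \<alpha> \<le> gn_constant TYPE('a) p * ennreal (2 powr (- ((p - 1) / 2)) * \<alpha> powr (a p / 2))"
  unfolding M_level_def
proof (rule SUP_least)
  fix A assume A: "A \<in> genus_family 3 \<Omega> \<alpha>"
  define I where "I = (INF u\<in>A. Lq_power \<Omega> (p + 1) u)"
  define K where "K = enn2real (gn_constant TYPE('a) p) * (2 powr (- ((p - 1) / 2)) * \<alpha> powr (a p / 2))"
  have K: "gn_constant TYPE('a) p * ennreal (2 powr (- ((p - 1) / 2)) * \<alpha> powr (a p / 2)) = ennreal K"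
    using fin by (simp add: K_def ennreal_mult ennreal_enn2real_if)
  have K0: "0 \<le> K" by (simp add: K_def)
  \<comment> \<open>The double successor keeps t strictly below 1 from the start.\<close>
  define t where "t n = inverse (real (Suc (Suc n)))" for n
  have t: "0 < t n" "t n < 1" for n by (auto simp: t_def inverse_eq_divide)
  have t0: "t \<longlonglongrightarrow> 0" unfolding t_def by (rule LIMSEQ_Suc[OF LIMSEQ_inverse_real_of_nat])
  let ?b = "\<lambda>n. (1 - t n) powr (- (p + 1)) * K + t n powr (p + 1) * measure lebesgue \<Omega>"
  have "I \<le> ennreal (?b n)" for n
  proof -
    have "I \<le> ennreal ((1 - t n) powr (- (p + 1))) * ennreal K + ennreal (t n powr (p + 1) * measure lebesgue \<Omega>)"
      unfolding I_def K[symmetric] a_def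
      by (rule genus_family_3_approx[OF \<Omega> bd A p[unfolded a_def] fin t[of n]])
    also have "\<dots> = ennreal (?b n)"
      using K0 by (simp add: ennreal_mult ennreal_plus)
    finally show ?thesis .
  qed
  moreover have "?b \<longlonglongrightarrow> (1 - 0) powr (- (p + 1)) * K + 0 powr (p + 1) * measure lebesgue \<Omega>"
    using p t by (intro tendsto_intros t0) (auto intro: less_imp_le always_eventually)
  then have "(\<lambda>n. ennreal (?b n)) \<longlonglongrightarrow> ennreal K" by (intro tendsto_ennrealI) simp
  ultimately have "I \<le> ennreal K" by (intro LIMSEQ_le_const) auto
  then show "(INF u\<in>A. Lq_power \<Omega> (p + 1) u)
      \<le> gn_constant TYPE('a) p * ennreal (2 powr (- ((p - 1) / 2)) * \<alpha> powr (a p / 2))"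
    unfolding K I_def .
qed

section \<open>Mass-subcritical powers\<close>

text \<open>The increment is the integral of the directional derivative along the segment;
  Cauchy-Schwarz against the constant 1 on [0, 1] moves the square inside.\<close>

lemma C1_compact_increment:
  assumes f: "C1_compact f g S"
  shows "ennreal ((f (x + h) - f x)\<^sup>2)
    \<le> ennreal ((norm h)\<^sup>2) * (\<integral>\<^sup>+s. ennreal ((norm (g (x + s *\<^sub>R h)))\<^sup>2) * indicator {0..1} s \<partial>lborel)"
proof -
  have df: "\<And>x. GDERIV f x :> g x" and cg: "continuous_on UNIV g" using f by (auto simp: C1_compact_def)
  have cgs: "continuous_on T (\<lambda>s. g (x + s *\<^sub>R h))" for T
    by (rule continuous_on_compose2[OF cg]) (auto intro!: continuous_intros)
  have D: "((\<lambda>s. f (x + s *\<^sub>R h)) has_vector_derivative h \<bullet> g (x + s *\<^sub>R h)) (at s within T)" for s T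
  proof -
    have "((\<lambda>s. f (x + s *\<^sub>R h)) has_derivative (\<lambda>r. (r *\<^sub>R h) \<bullet> g (x + s *\<^sub>R h))) (at s)"
    proof (rule has_derivative_compose[where g = f and f = "\<lambda>s. x + s *\<^sub>R h"])
      show "((\<lambda>s. x + s *\<^sub>R h) has_derivative (\<lambda>s. s *\<^sub>R h)) (at s)"
        by (auto intro!: derivative_eq_intros)
      show "(f has_derivative (\<lambda>r. r \<bullet> g (x + s *\<^sub>R h))) (at (x + s *\<^sub>R h))"
        using df by (simp add: gderiv_def)
    qed
    then show ?thesis
      by (simp add: has_vector_derivative_def has_derivative_at_withinI)
  qed
  let ?d = "\<lambda>s. indicator {0..1} s *\<^sub>R (h \<bullet> g (x + s *\<^sub>R h))" and ?e = "\<lambda>s::real. indicator {0..1} s :: real"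
  let ?n = "\<lambda>s. indicator {0..1} s *\<^sub>R ((norm (g (x + s *\<^sub>R h)))\<^sup>2)"
  have ftc: "(LINT s|lborel. ?d s) = f (x + h) - f x"
    using integral_FTC_Icc[OF zero_le_one D continuous_on_inner[OF continuous_on_const cgs]] by simp
  have i1: "integrable lborel ?e" by (intro integrable_real_indicator) auto
  have i2: "integrable lborel (\<lambda>s. indicator {0..1} s *\<^sub>R (h \<bullet> g (x + s *\<^sub>R h))\<^sup>2)"
    by (intro borel_integrable_compact continuous_intros cgs) simp
  have i3: "integrable lborel ?n" by (intro borel_integrable_compact continuous_intros cgs) simp
  have i4: "integrable lborel ?d" by (intro borel_integrable_compact continuous_intros cgs) simp
  have sq: "(\<lambda>s. (norm (?d s))\<^sup>2) = (\<lambda>s. indicator {0..1} s *\<^sub>R (h \<bullet> g (x + s *\<^sub>R h))\<^sup>2)"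
    "(\<lambda>s. (norm (?e s))\<^sup>2) = ?e" by (auto simp: indicator_def)
  have s1: "sq_int lborel ?d" unfolding sq_int_def sq using i2 i4 borel_measurable_integrable by blast
  have s2: "sq_int lborel ?e" unfolding sq_int_def sq using i1 borel_measurable_integrable by blast
  have "f (x + h) - f x = (LINT s|lborel. ?e s \<bullet> ?d s)"
    unfolding ftc[symmetric] by (intro Bochner_Integration.integral_cong) (auto simp: indicator_def)
  then have "\<bar>f (x + h) - f x\<bar> \<le> l2norm lborel ?e * l2norm lborel ?d"
    by (simp only: l2norm_inner_le[OF s2 s1])
  also have "l2norm lborel ?e = 1" unfolding l2norm_def sq by simp
  finally have "\<bar>f (x + h) - f x\<bar> \<le> \<bar>l2norm lborel ?d\<bar>" by simp
  then have "(f (x + h) - f x)\<^sup>2 \<le> (l2norm lborel ?d)\<^sup>2" by (simp only: abs_le_square_iff)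
  also have "\<dots> = (LINT s|lborel. indicator {0..1} s *\<^sub>R (h \<bullet> g (x + s *\<^sub>R h))\<^sup>2)"
    unfolding l2norm_squared sq ..
  also have "\<dots> \<le> (LINT s|lborel. (norm h)\<^sup>2 * ?n s)"
  proof (rule integral_mono[OF i2])
    fix s
    have "(h \<bullet> g (x + s *\<^sub>R h))\<^sup>2 \<le> (norm h * norm (g (x + s *\<^sub>R h)))\<^sup>2"
      unfolding abs_le_square_iff[symmetric] using Cauchy_Schwarz_ineq2[of h "g (x + s *\<^sub>R h)"] by simp
    then show "indicator {0..1} s *\<^sub>R (h \<bullet> g (x + s *\<^sub>R h))\<^sup>2 \<le> (norm h)\<^sup>2 * ?n s"
      by (simp add: indicator_def power_mult_distrib)
  qed (use i3 in simp)
  also have "\<dots> = (norm h)\<^sup>2 * (LINT s|lborel. ?n s)" by simp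
  finally have "ennreal ((f (x + h) - f x)\<^sup>2) \<le> ennreal ((norm h)\<^sup>2) * ennreal (LINT s|lborel. ?n s)"
    by (simp add: ennreal_mult[symmetric] ennreal_leI)
  also have "ennreal (LINT s|lborel. ?n s) = (\<integral>\<^sup>+s. ennreal (?n s) \<partial>lborel)"
    by (rule nn_integral_eq_integral[symmetric, OF i3]) auto
  also have "\<dots> = (\<integral>\<^sup>+s. ennreal ((norm (g (x + s *\<^sub>R h)))\<^sup>2) * indicator {0..1} s \<partial>lborel)"
    by (intro nn_integral_cong) (auto simp: indicator_def)
  finally show ?thesis .
qed

lemma nn_integral_translate_lborel:
  fixes f :: "'a::euclidean_space \<Rightarrow> ennreal"
  assumes "f \<in> borel_measurable borel"
  shows "(\<integral>\<^sup>+x. f (x + c) \<partial>lborel) = (\<integral>\<^sup>+x. f x \<partial>lborel)"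
proof -
  have "(\<integral>\<^sup>+x. f x \<partial>lborel) = (\<integral>\<^sup>+x. f x \<partial>distr lborel borel ((+) c))"
    by (simp add: lborel_distr_plus)
  also have "\<dots> = (\<integral>\<^sup>+x. f (c + x) \<partial>lborel)"
    using assms by (subst nn_integral_distr) auto
  finally show ?thesis by (simp add: add.commute)
qed

text \<open>After exchanging the integrals, each point s of the segment contributes the full
  Dirichlet integral, by translation invariance.\<close>

lemma C1_compact_translation_estimate:
  assumes f: "C1_compact f g S"
  shows "(\<integral>\<^sup>+x. ennreal ((f (x + h) - f x)\<^sup>2) \<partial>lborel)
    \<le> ennreal ((norm h)\<^sup>2) * (\<integral>\<^sup>+x. ennreal ((norm (g x))\<^sup>2) \<partial>lborel)"
proof -
  have cg: "continuous_on UNIV g" using f by (auto simp: C1_compact_def)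
  have mg [measurable]: "g \<in> borel_measurable borel" using cg by (rule borel_measurable_continuous_onI)
  let ?E = "\<integral>\<^sup>+x. ennreal ((norm (g x))\<^sup>2) \<partial>lborel"
  have "(\<integral>\<^sup>+x. ennreal ((f (x + h) - f x)\<^sup>2) \<partial>lborel)
      \<le> (\<integral>\<^sup>+x. ennreal ((norm h)\<^sup>2) * (\<integral>\<^sup>+s. ennreal ((norm (g (x + s *\<^sub>R h)))\<^sup>2) * indicator {0..1} s \<partial>lborel) \<partial>lborel)"
    by (intro nn_integral_mono C1_compact_increment[OF f])
  also have "\<dots> = ennreal ((norm h)\<^sup>2) *
      (\<integral>\<^sup>+x. (\<integral>\<^sup>+s. ennreal ((norm (g (x + s *\<^sub>R h)))\<^sup>2) * indicator {0..1} s \<partial>lborel) \<partial>lborel)"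
    by (rule nn_integral_cmult) measurable
  also have "(\<integral>\<^sup>+x. (\<integral>\<^sup>+s. ennreal ((norm (g (x + s *\<^sub>R h)))\<^sup>2) * indicator {0..1} s \<partial>lborel) \<partial>lborel)
      = (\<integral>\<^sup>+s. (\<integral>\<^sup>+x. ennreal ((norm (g (x + s *\<^sub>R h)))\<^sup>2) * indicator {0..1} s \<partial>lborel) \<partial>lborel)"
    by (rule lborel_pair.Fubini'[symmetric]) measurable
  also have "\<dots> = (\<integral>\<^sup>+s. ?E * indicator {0..1::real} s \<partial>lborel)"
  proof (intro nn_integral_cong)
    fix s :: real
    have "(\<integral>\<^sup>+x. ennreal ((norm (g (x + s *\<^sub>R h)))\<^sup>2) * indicator {0..1} s \<partial>lborel)
        = (\<integral>\<^sup>+x. ennreal ((norm (g (x + s *\<^sub>R h)))\<^sup>2) \<partial>lborel) * indicator {0..1} s"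
      by (rule nn_integral_multc) measurable
    also have "(\<integral>\<^sup>+x. ennreal ((norm (g (x + s *\<^sub>R h)))\<^sup>2) \<partial>lborel) = ?E"
      by (rule nn_integral_translate_lborel[of "\<lambda>y. ennreal ((norm (g y))\<^sup>2)"]) measurable
    finally show "(\<integral>\<^sup>+x. ennreal ((norm (g (x + s *\<^sub>R h)))\<^sup>2) * indicator {0..1} s \<partial>lborel) = ?E * indicator {0..1} s" .
  qed
  also have "\<dots> = ?E" by (simp add: nn_integral_cmult_indicator)
  finally show ?thesis .
qed

text \<open>Where \<open>f\<^sup>2\<close> exceeds four times its largest possible average over a ball of radius \<open>r\<close>, the
  oscillation of \<open>f\<close> on that ball controls \<open>f\<^sup>2\<close>.\<close>

lemma C1_compact_tail_estimate:
  fixes f :: "'a::euclidean_space \<Rightarrow> real"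
  assumes f: "C1_compact f g S" and r: "r > 0" and \<sigma>0: "\<sigma> \<ge> 0"
    and m: "(\<integral>\<^sup>+x. ennreal ((f x)\<^sup>2) \<partial>lborel) \<le> ennreal m" "m \<ge> 0"
    and \<sigma>: "4 * m / (unit_ball_vol (real DIM('a)) * r ^ DIM('a)) \<le> \<sigma>\<^sup>2"
  shows "(\<integral>\<^sup>+x. ennreal ((f x)\<^sup>2) * indicator {x. \<sigma> \<le> \<bar>f x\<bar>} x \<partial>lborel)
    \<le> ennreal (4 * r\<^sup>2) * (\<integral>\<^sup>+x. ennreal ((norm (g x))\<^sup>2) \<partial>lborel)"
proof -
  define B where "B = ball (0::'a) r"
  define V where "V = unit_ball_vol (real DIM('a)) * r ^ DIM('a)"
  have V: "V > 0" unfolding V_def using r by (intro mult_pos_pos unit_ball_vol_pos) auto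
  have eB: "emeasure lborel B = ennreal V" unfolding B_def V_def using r by (simp add: emeasure_ball)
  have [measurable]: "B \<in> sets borel" by (simp add: B_def)
  have mf [measurable]: "f \<in> borel_measurable borel"
    using C1_compact_continuous[OF f] by (rule borel_measurable_continuous_onI)
  let ?E = "\<integral>\<^sup>+x. ennreal ((norm (g x))\<^sup>2) \<partial>lborel"
  let ?D = "\<lambda>x. \<integral>\<^sup>+h. ennreal ((f (x + h) - f x)\<^sup>2) * indicator B h \<partial>lborel"
  have pt: "ennreal ((f x)\<^sup>2) * indicator {x. \<sigma> \<le> \<bar>f x\<bar>} x \<le> ennreal (4 / V) * ?D x" for x
  proof (cases "\<sigma> \<le> \<bar>f x\<bar>")
    case False
    then show ?thesis by simp
  next
    case fx: True
    have "\<sigma>\<^sup>2 \<le> (f x)\<^sup>2" using fx \<sigma>0 power_mono[of \<sigma> "\<bar>f x\<bar>" 2] by simp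
    with \<sigma> have "4 * m / V \<le> (f x)\<^sup>2" unfolding V_def by linarith
    then have mV: "m \<le> V * (f x)\<^sup>2 / 4" using V by (simp add: field_simps)
    \<comment> \<open>Averaging f(x)^2 / 2 \<le> (f(x+h) - f(x))^2 + f(x+h)^2 over the ball: by
      \<open>mV\<close> the last term costs at most V f(x)^2 / 4, half of the left side, and can be
      absorbed.\<close>
    have "ennreal (V * (f x)\<^sup>2 / 2) = (\<integral>\<^sup>+h. ennreal ((f x)\<^sup>2 / 2) * indicator B h \<partial>lborel)"
    proof -
      have "(\<integral>\<^sup>+h. ennreal ((f x)\<^sup>2 / 2) * indicator B h \<partial>lborel) = ennreal ((f x)\<^sup>2 / 2) * ennreal V"
        by (simp add: nn_integral_cmult_indicator eB)
      also have "\<dots> = ennreal ((f x)\<^sup>2 / 2 * V)" using V by (intro ennreal_mult[symmetric]) auto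
      finally show ?thesis by (simp add: mult.commute)
    qed
    also have "\<dots> \<le> (\<integral>\<^sup>+h. ennreal ((f (x + h) - f x)\<^sup>2) * indicator B h + ennreal ((f (h + x))\<^sup>2) \<partial>lborel)"
    proof (rule nn_integral_mono)
      fix h
      have "(f x)\<^sup>2 / 2 \<le> (f (x + h) - f x)\<^sup>2 + (f (h + x))\<^sup>2"
        using zero_le_power2[of "f x - 2 * f (x + h)"] by (simp add: power2_eq_square algebra_simps)
      then have "ennreal ((f x)\<^sup>2 / 2) \<le> ennreal ((f (x + h) - f x)\<^sup>2) + ennreal ((f (h + x))\<^sup>2)"
        by (simp add: ennreal_plus[symmetric] ennreal_leI del: ennreal_plus)
      then show "ennreal ((f x)\<^sup>2 / 2) * indicator B h
          \<le> ennreal ((f (x + h) - f x)\<^sup>2) * indicator B h + ennreal ((f (h + x))\<^sup>2)"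
        by (simp add: indicator_def)
    qed
    also have "\<dots> = ?D x + (\<integral>\<^sup>+h. ennreal ((f (h + x))\<^sup>2) \<partial>lborel)"
      by (rule nn_integral_add) measurable
    also have "(\<integral>\<^sup>+h. ennreal ((f (h + x))\<^sup>2) \<partial>lborel) = (\<integral>\<^sup>+h. ennreal ((f h)\<^sup>2) \<partial>lborel)"
      by (rule nn_integral_translate_lborel[of "\<lambda>y. ennreal ((f y)\<^sup>2)"]) measurable
    also have "?D x + \<dots> \<le> ?D x + ennreal (V * (f x)\<^sup>2 / 4)"
      using order_trans[OF m(1) ennreal_leI[OF mV]] by (rule add_left_mono)
    finally have "ennreal (V * (f x)\<^sup>2 / 4) + ennreal (V * (f x)\<^sup>2 / 4) \<le> ?D x + ennreal (V * (f x)\<^sup>2 / 4)"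
      using V by (simp add: ennreal_plus[symmetric] del: ennreal_plus)
    then have "ennreal (V * (f x)\<^sup>2 / 4) \<le> ?D x"
      by (simp add: ennreal_add_left_cancel_le add.commute[of "?D x"])
    then have "ennreal (4 / V) * ennreal (V * (f x)\<^sup>2 / 4) \<le> ennreal (4 / V) * ?D x"
      by (rule mult_left_mono) simp
    then show ?thesis using V fx by (simp add: ennreal_mult[symmetric])
  qed
  have "(\<integral>\<^sup>+x. ennreal ((f x)\<^sup>2) * indicator {x. \<sigma> \<le> \<bar>f x\<bar>} x \<partial>lborel) \<le> (\<integral>\<^sup>+x. ennreal (4 / V) * ?D x \<partial>lborel)"
    by (intro nn_integral_mono pt)
  also have "\<dots> = ennreal (4 / V) * (\<integral>\<^sup>+x. ?D x \<partial>lborel)"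
    by (rule nn_integral_cmult) measurable
  also have "(\<integral>\<^sup>+x. ?D x \<partial>lborel) = (\<integral>\<^sup>+h. (\<integral>\<^sup>+x. ennreal ((f (x + h) - f x)\<^sup>2) * indicator B h \<partial>lborel) \<partial>lborel)"
    by (rule lborel_pair.Fubini'[symmetric]) measurable
  also have "\<dots> \<le> (\<integral>\<^sup>+h. ennreal (r\<^sup>2) * ?E * indicator B h \<partial>lborel)"
  proof (rule nn_integral_mono)
    fix h
    have "(\<integral>\<^sup>+x. ennreal ((f (x + h) - f x)\<^sup>2) \<partial>lborel) \<le> ennreal (r\<^sup>2) * ?E" if "h \<in> B"
    proof -
      have "(norm h)\<^sup>2 \<le> r\<^sup>2" using that r by (intro power_mono) (auto simp: B_def)
      then show ?thesis
        using order_trans[OF C1_compact_translation_estimate[OF f, of h] mult_right_mono[OF ennreal_leI zero_le]]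
        by blast
    qed
    then show "(\<integral>\<^sup>+x. ennreal ((f (x + h) - f x)\<^sup>2) * indicator B h \<partial>lborel) \<le> ennreal (r\<^sup>2) * ?E * indicator B h"
      by (simp add: indicator_def)
  qed
  also have "\<dots> = ennreal (r\<^sup>2) * ?E * ennreal V" by (simp add: nn_integral_cmult_indicator eB)
  also have "ennreal (4 / V) * (ennreal (r\<^sup>2) * ?E * ennreal V) = ennreal (4 / V * r\<^sup>2 * V) * ?E"
  proof -
    have "ennreal (4 / V * r\<^sup>2 * V) = ennreal (4 / V) * ennreal (r\<^sup>2) * ennreal V"
      using V by (simp only: ennreal_mult divide_nonneg_pos zero_le_power2 less_imp_le mult_nonneg_nonneg zero_le_numeral)
    then show ?thesis by (simp only: mult_ac)
  qed
  also have "4 / V * r\<^sup>2 * V = 4 * r\<^sup>2" using V by simp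
  finally show ?thesis by (simp add: mult_left_mono)
qed

text \<open>The radius is optimised for the level \<sigma>, which gives r^2 proportional to
  \<sigma>^(-4/N). The mass bound is 2 because the functions to which this is applied only
  approximate one of mass 1.\<close>

lemma C1_compact_tail_power:
  obtains A where "A \<ge> 0"
    "\<And>(f :: 'a::euclidean_space \<Rightarrow> real) g S \<sigma>. C1_compact f g S \<Longrightarrow> \<sigma> > 0 \<Longrightarrow>
      (\<integral>\<^sup>+x. ennreal ((f x)\<^sup>2) \<partial>lborel) \<le> ennreal 2 \<Longrightarrow>
      (\<integral>\<^sup>+x. ennreal ((f x)\<^sup>2) * indicator {x. \<sigma> \<le> \<bar>f x\<bar>} x \<partial>lborel)
        \<le> ennreal (A * \<sigma> powr (- (4 / real DIM('a)))) * (\<integral>\<^sup>+x. ennreal ((norm (g x))\<^sup>2) \<partial>lborel)"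
proof
  let ?N = "real DIM('a)"
  define \<omega> where "\<omega> = unit_ball_vol ?N"
  have \<omega>: "\<omega> > 0" by (simp add: \<omega>_def)
  have N: "?N > 0" by simp
  show "0 \<le> 4 * (8 / \<omega>) powr (2 / ?N)" by simp
  fix f :: "'a \<Rightarrow> real" and g S and \<sigma> :: real
  assume f: "C1_compact f g S" and \<sigma>: "\<sigma> > 0" and m: "(\<integral>\<^sup>+x. ennreal ((f x)\<^sup>2) \<partial>lborel) \<le> ennreal 2"
  \<comment> \<open>The radius for which the level condition holds with equality when m = 2.\<close>
  define r where "r = (8 / (\<omega> * \<sigma>\<^sup>2)) powr (1 / ?N)"
  have pos: "8 / (\<omega> * \<sigma>\<^sup>2) > 0" using \<omega> \<sigma> by simp
  have "8 / (\<omega> * \<sigma>\<^sup>2) \<noteq> 0" using pos by linarith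
  then have r: "r > 0" unfolding r_def powr_gt_zero .
  have "r ^ DIM('a) = r powr ?N" using r by (simp add: powr_realpow)
  also have "\<dots> = 8 / (\<omega> * \<sigma>\<^sup>2)" using pos N by (simp add: r_def powr_powr)
  finally have rN: "r ^ DIM('a) = 8 / (\<omega> * \<sigma>\<^sup>2)" .
  have c: "4 * 2 / (unit_ball_vol ?N * r ^ DIM('a)) \<le> \<sigma>\<^sup>2"
    unfolding rN \<omega>_def[symmetric] using \<omega> \<sigma> by simp
  have "r\<^sup>2 = r powr 2" using r by (simp add: powr_realpow[of r 2, simplified])
  also have "\<dots> = (8 / \<omega> * \<sigma> powr (-2)) powr (2 / ?N)"
    using \<sigma> pos by (simp add: r_def powr_powr powr_minus powr_realpow[of \<sigma> 2, simplified] field_simps)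
  also have "\<dots> = (8 / \<omega>) powr (2 / ?N) * \<sigma> powr (- (4 / ?N))"
    using \<omega> \<sigma> by (subst powr_mult) (simp_all add: powr_powr)
  finally have eq: "4 * r\<^sup>2 = 4 * (8 / \<omega>) powr (2 / ?N) * \<sigma> powr (- (4 / ?N))" by simp
  show "(\<integral>\<^sup>+x. ennreal ((f x)\<^sup>2) * indicator {x. \<sigma> \<le> \<bar>f x\<bar>} x \<partial>lborel)
      \<le> ennreal (4 * (8 / \<omega>) powr (2 / ?N) * \<sigma> powr (- (4 / ?N))) * (\<integral>\<^sup>+x. ennreal ((norm (g x))\<^sup>2) \<partial>lborel)"
    unfolding eq[symmetric] by (rule C1_compact_tail_estimate[OF f r less_imp_le[OF \<sigma>] m _ c]) simp
qed

text \<open>If |y| lies between 2^k \<sigma> and 2^(k+1) \<sigma>, then |y|^\<theta> is at most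
  (2^(k+1) \<sigma>)^\<theta>. The indicators are of superlevel sets instead of shells, since these
  are the sets that the tail estimate controls.\<close>

lemma powr_le_dyadic_sum:
  fixes y \<sigma> \<theta> :: real
  assumes \<sigma>: "\<sigma> > 0" and \<theta>: "\<theta> \<ge> 0"
  shows "ennreal (\<bar>y\<bar> powr (\<theta> + 2)) \<le> ennreal (\<sigma> powr \<theta>) * ennreal (y\<^sup>2) +
    (suminf (\<lambda>k. ennreal ((2 ^ Suc k * \<sigma>) powr \<theta>) * (ennreal (y\<^sup>2) * indicator {z. 2 ^ k * \<sigma> \<le> \<bar>z\<bar>} y)))"
    (is "_ \<le> ?a + suminf ?f")
proof -
  have b: "ennreal (\<bar>y\<bar> powr (\<theta> + 2)) \<le> ennreal (c powr \<theta>) * ennreal (y\<^sup>2)" if "\<bar>y\<bar> \<le> c" for c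
  proof -
    have "\<bar>y\<bar> powr (\<theta> + 2) = \<bar>y\<bar> powr \<theta> * y\<^sup>2"
      by (cases "y = 0") (simp_all add: powr_add powr_realpow[of "\<bar>y\<bar>" 2, simplified])
    also have "\<dots> \<le> c powr \<theta> * y\<^sup>2" using that \<theta> by (intro mult_right_mono powr_mono2) auto
    finally show ?thesis by (simp add: ennreal_mult[symmetric] ennreal_leI)
  qed
  show ?thesis
  proof (cases "\<bar>y\<bar> \<le> \<sigma>")
    case True
    have "?a \<le> ?a + suminf ?f" by simp
    then show ?thesis using b[OF True] by (rule order_trans[rotated])
  next
    case False
    obtain n where "\<bar>y\<bar> / \<sigma> < 2 ^ n" using real_arch_pow[of 2 "\<bar>y\<bar> / \<sigma>"] by auto
    then have ex: "\<exists>n. \<bar>y\<bar> < 2 ^ n * \<sigma>" using \<sigma> by (auto simp: field_simps)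
    define n where "n = (LEAST n. \<bar>y\<bar> < 2 ^ n * \<sigma>)"
    have n: "\<bar>y\<bar> < 2 ^ n * \<sigma>" unfolding n_def using ex by (rule LeastI_ex)
    have "n \<noteq> 0" using n False by (intro notI) simp
    then obtain k where k: "n = Suc k" by (cases n) auto
    have "\<not> \<bar>y\<bar> < 2 ^ k * \<sigma>" using not_less_Least[of k] k unfolding n_def by (metis lessI)
    then have "?f k = ennreal ((2 ^ Suc k * \<sigma>) powr \<theta>) * ennreal (y\<^sup>2)" by simp
    moreover have "\<bar>y\<bar> \<le> 2 ^ Suc k * \<sigma>" using n k by simp
    ultimately have "ennreal (\<bar>y\<bar> powr (\<theta> + 2)) \<le> ?f k" using b by metis
    also have "\<dots> = (\<Sum>i\<in>{k}. ?f i)" by simp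
    also have "\<dots> \<le> suminf ?f" by (rule sum_le_suminf) auto
    also have "\<dots> \<le> ?a + suminf ?f" by simp
    finally show ?thesis .
  qed
qed

text \<open>Level k contributes a multiple of (2^k \<sigma>)^(\<theta> - 4/N) times the Dirichlet
  integral. Subcriticality makes this exponent negative: the levels form a convergent geometric
  series, and its sum tends to 0 as \<sigma> grows.\<close>

lemma C1_compact_subcritical_bound:
  fixes \<theta> \<epsilon> :: real
  assumes \<theta>: "0 \<le> \<theta>" "\<theta> < 4 / real DIM('a::euclidean_space)" and \<epsilon>: "\<epsilon> > 0"
  obtains K where "K \<ge> 0"
    "\<And>(f :: 'a \<Rightarrow> real) g S. C1_compact f g S \<Longrightarrow> (\<integral>\<^sup>+x. ennreal ((f x)\<^sup>2) \<partial>lborel) \<le> ennreal 2 \<Longrightarrow>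
      (\<integral>\<^sup>+x. ennreal (\<bar>f x\<bar> powr (\<theta> + 2)) \<partial>lborel)
        \<le> ennreal K + ennreal \<epsilon> * (\<integral>\<^sup>+x. ennreal ((norm (g x))\<^sup>2) \<partial>lborel)"
proof -
  obtain A where A: "A \<ge> 0"
    "\<And>(f :: 'a::euclidean_space \<Rightarrow> real) g S \<sigma>. C1_compact f g S \<Longrightarrow> \<sigma> > 0 \<Longrightarrow>
      (\<integral>\<^sup>+x. ennreal ((f x)\<^sup>2) \<partial>lborel) \<le> ennreal 2 \<Longrightarrow>
      (\<integral>\<^sup>+x. ennreal ((f x)\<^sup>2) * indicator {x. \<sigma> \<le> \<bar>f x\<bar>} x \<partial>lborel)
        \<le> ennreal (A * \<sigma> powr (- (4 / real DIM('a)))) * (\<integral>\<^sup>+x. ennreal ((norm (g x))\<^sup>2) \<partial>lborel)"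
    by (rule C1_compact_tail_power) blast
  define \<eta> where "\<eta> = \<theta> - 4 / real DIM('a)"
  have \<eta>: "\<eta> < 0" using \<theta> by (simp add: \<eta>_def)
  define \<rho> :: real where "\<rho> = 2 powr \<eta>"
  have \<rho>: "0 \<le> \<rho>" "\<rho> < 1" using \<eta> powr_less_mono[of \<eta> 0 2] by (simp_all add: \<rho>_def)
  \<comment> \<open>The sum of the geometric series with ratio \<rho>; a large \<sigma> brings it
    below \<epsilon>.\<close>
  define C where "C \<sigma> = 2 powr \<theta> * A * \<sigma> powr \<eta> * (1 / (1 - \<rho>))" for \<sigma>
  have "((\<lambda>\<sigma>. \<sigma> powr \<eta>) \<longlongrightarrow> 0) at_top" by (rule tendsto_neg_powr[OF \<eta> filterlim_ident])
  then have "(C \<longlongrightarrow> 2 powr \<theta> * A * 0 * (1 / (1 - \<rho>))) at_top"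
    unfolding C_def by (intro tendsto_intros)
  then have "\<forall>\<^sub>F \<sigma> in at_top. C \<sigma> < \<epsilon>" using \<epsilon> by (intro order_tendstoD(2)) auto
  then have "\<forall>\<^sub>F \<sigma> in at_top. C \<sigma> < \<epsilon> \<and> 0 < \<sigma>" by (intro eventually_conj eventually_gt_at_top)
  then obtain \<sigma> where \<sigma>: "C \<sigma> < \<epsilon>" "0 < \<sigma>"
    by (metis (mono_tags, lifting) eventually_happens trivial_limit_at_top_linorder)
  show thesis
  \<comment> \<open>Below the level \<sigma> the power costs at most \<sigma>^\<theta> times the
    mass, which is at most 2.\<close>
  proof (rule that[of "2 * \<sigma> powr \<theta>"])
    show "0 \<le> 2 * \<sigma> powr \<theta>" by simp
    fix f :: "'a \<Rightarrow> real" and g S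
    assume f: "C1_compact f g S" and m: "(\<integral>\<^sup>+x. ennreal ((f x)\<^sup>2) \<partial>lborel) \<le> ennreal 2"
    let ?E = "\<integral>\<^sup>+x. ennreal ((norm (g x))\<^sup>2) \<partial>lborel"
    have mf [measurable]: "f \<in> borel_measurable borel"
      using C1_compact_continuous[OF f] by (rule borel_measurable_continuous_onI)
    let ?I = "\<lambda>k x. ennreal ((f x)\<^sup>2) * indicator {x. 2 ^ k * \<sigma> \<le> \<bar>f x\<bar>} x"
    have "(\<integral>\<^sup>+x. ennreal (\<bar>f x\<bar> powr (\<theta> + 2)) \<partial>lborel)
        \<le> (\<integral>\<^sup>+x. ennreal (\<sigma> powr \<theta>) * ennreal ((f x)\<^sup>2) + (suminf (\<lambda>k. ennreal ((2 ^ Suc k * \<sigma>) powr \<theta>) * ?I k x)) \<partial>lborel)"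
    proof (rule nn_integral_mono)
      fix x
      show "ennreal (\<bar>f x\<bar> powr (\<theta> + 2))
          \<le> ennreal (\<sigma> powr \<theta>) * ennreal ((f x)\<^sup>2) + (suminf (\<lambda>k. ennreal ((2 ^ Suc k * \<sigma>) powr \<theta>) * ?I k x))"
        using powr_le_dyadic_sum[OF \<sigma>(2) \<theta>(1), of "f x"] by (simp add: indicator_def)
    qed
    also have "\<dots> = ennreal (\<sigma> powr \<theta>) * (\<integral>\<^sup>+x. ennreal ((f x)\<^sup>2) \<partial>lborel) +
        (suminf (\<lambda>k. ennreal ((2 ^ Suc k * \<sigma>) powr \<theta>) * (\<integral>\<^sup>+x. ?I k x \<partial>lborel)))"
      by (simp add: nn_integral_add nn_integral_cmult nn_integral_suminf)
    also have "\<dots> \<le> ennreal (\<sigma> powr \<theta>) * ennreal 2 + (suminf (\<lambda>k. ennreal (2 powr \<theta> * A * \<sigma> powr \<eta> * \<rho> ^ k) * ?E))"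
    proof (intro add_mono mult_left_mono m suminf_le)
      fix k
      have p: "2 ^ k * \<sigma> > 0" using \<sigma>(2) by simp
      have "ennreal ((2 ^ Suc k * \<sigma>) powr \<theta>) * (\<integral>\<^sup>+x. ?I k x \<partial>lborel)
          \<le> ennreal ((2 ^ Suc k * \<sigma>) powr \<theta>) * (ennreal (A * (2 ^ k * \<sigma>) powr (- (4 / real DIM('a)))) * ?E)"
        by (intro mult_left_mono A(2)[OF f p m]) simp
      also have "\<dots> = ennreal ((2 ^ Suc k * \<sigma>) powr \<theta> * (A * (2 ^ k * \<sigma>) powr (- (4 / real DIM('a))))) * ?E"
        using A(1) by (simp add: ennreal_mult mult.assoc)
      also have "(2 ^ Suc k * \<sigma>) powr \<theta> * (A * (2 ^ k * \<sigma>) powr (- (4 / real DIM('a))))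
          = 2 powr \<theta> * A * \<sigma> powr \<eta> * \<rho> ^ k"
      proof -
        have "(2 ^ Suc k * \<sigma>) powr \<theta> = 2 powr \<theta> * (2 ^ k * \<sigma>) powr \<theta>"
          using powr_mult[of 2 "2 ^ k * \<sigma>" \<theta>] \<sigma>(2) by (simp add: mult.assoc)
        moreover have "(2 ^ k * \<sigma>) powr \<theta> * (2 ^ k * \<sigma>) powr (- (4 / real DIM('a))) = (2 ^ k * \<sigma>) powr \<eta>"
          by (simp add: \<eta>_def powr_add[symmetric])
        moreover have "(2 ^ k * \<sigma>) powr \<eta> = \<rho> ^ k * \<sigma> powr \<eta>"
          using \<sigma>(2) by (simp add: powr_mult \<rho>_def powr_power powr_realpow[symmetric] powr_powr mult.commute)
        ultimately show ?thesis by (simp add: mult_ac)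
      qed
      finally show "ennreal ((2 ^ Suc k * \<sigma>) powr \<theta>) * (\<integral>\<^sup>+x. ?I k x \<partial>lborel)
          \<le> ennreal (2 powr \<theta> * A * \<sigma> powr \<eta> * \<rho> ^ k) * ?E" .
    qed auto
    also have "(suminf (\<lambda>k. ennreal (2 powr \<theta> * A * \<sigma> powr \<eta> * \<rho> ^ k) * ?E)) = (suminf (\<lambda>k. ennreal (2 powr \<theta> * A * \<sigma> powr \<eta> * \<rho> ^ k))) * ?E"
      by (rule ennreal_suminf_multc)
    also have "(suminf (\<lambda>k. ennreal (2 powr \<theta> * A * \<sigma> powr \<eta> * \<rho> ^ k))) = ennreal (C \<sigma>)"
      unfolding C_def using A(1) \<rho> by (intro suminf_ennreal_eq sums_mult geometric_sums) auto
    also have "ennreal (C \<sigma>) * ?E \<le> ennreal \<epsilon> * ?E" using \<sigma>(1) by (intro mult_right_mono ennreal_leI) auto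
    also have "ennreal (\<sigma> powr \<theta>) * ennreal 2 = ennreal (2 * \<sigma> powr \<theta>)"
      by (simp add: ennreal_mult mult.commute)
    finally show "(\<integral>\<^sup>+x. ennreal (\<bar>f x\<bar> powr (\<theta> + 2)) \<partial>lborel) \<le> ennreal (2 * \<sigma> powr \<theta>) + ennreal \<epsilon> * ?E"
      by (simp add: add_left_mono)
  qed
qed

section \<open>From test functions to elements of the energy ball\<close>

lemma nn_integral_lebesgue_on_eq_lborel:
  fixes f :: "'a::euclidean_space \<Rightarrow> ennreal"
  assumes "\<Omega> \<in> sets lebesgue" "\<And>x. x \<notin> \<Omega> \<Longrightarrow> f x = 0"
  shows "(\<integral>\<^sup>+x. f x \<partial>lebesgue_on \<Omega>) = (\<integral>\<^sup>+x. f x \<partial>lborel)"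
proof -
  have "(\<integral>\<^sup>+x. f x \<partial>lebesgue_on \<Omega>) = (\<integral>\<^sup>+x. f x * indicator \<Omega> x \<partial>lebesgue)"
    using assms(1) by (subst nn_integral_restrict_space) auto
  also have "(\<lambda>x. f x * indicator \<Omega> x) = f" using assms(2) by (auto simp: indicator_def fun_eq_iff)
  finally show ?thesis by (simp add: nn_integral_completion)
qed

lemma nn_integral_l2norm:
  assumes "sq_int M f"
  shows "(\<integral>\<^sup>+x. ennreal ((norm (f x))\<^sup>2) \<partial>M) = ennreal ((l2norm M f)\<^sup>2)"
  unfolding l2norm_squared by (rule nn_integral_eq_integral[OF sq_int_integrable[OF assms]]) simp

lemma l2norm_tendsto_AE_subseq:
  fixes f :: "nat \<Rightarrow> 'a \<Rightarrow> 'b::euclidean_space"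
  assumes f: "\<And>n. sq_int M (f n)" and lim: "(\<lambda>n. l2norm M (f n)) \<longlonglongrightarrow> 0"
  shows "\<exists>r::nat\<Rightarrow>nat. strict_mono r \<and> (AE x in M. (\<lambda>n. f (r n) x) \<longlonglongrightarrow> 0)"
proof -
  have "(\<lambda>n. (l2norm M (f n))\<^sup>2) \<longlonglongrightarrow> 0\<^sup>2" by (intro tendsto_power lim)
  then have "(\<lambda>n. LINT x|M. norm ((norm (f n x))\<^sup>2)) \<longlonglongrightarrow> 0" by (simp add: l2norm_squared)
  from tendsto_L1_AE_subseq[OF sq_int_integrable[OF f] this]
  obtain r :: "nat \<Rightarrow> nat" where r: "strict_mono r" "AE x in M. (\<lambda>n. (norm (f (r n) x))\<^sup>2) \<longlonglongrightarrow> 0" by blast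
  have "AE x in M. (\<lambda>n. f (r n) x) \<longlonglongrightarrow> 0"
    using r(2)
  proof eventually_elim
    case (elim x)
    from tendsto_real_sqrt[OF elim] have "(\<lambda>n. norm (f (r n) x)) \<longlonglongrightarrow> 0" by simp
    then show ?case by (rule tendsto_norm_zero_cancel)
  qed
  with r(1) show ?thesis by blast
qed

text \<open>Approximating test functions eventually have mass below 2 and energy below \<alpha> + 1,
  and Fatou's lemma along an almost everywhere convergent subsequence transfers their bound to
  \<open>u\<close>. \<open>K\<close> is chosen before \<alpha>, which makes the growth in \<alpha>
  visible.\<close>

lemma energy_ball_subcritical_bound:
  fixes \<Omega> :: "'a::euclidean_space set" and \<theta> \<epsilon> :: real
  assumes \<Omega>: "open \<Omega>" and \<theta>: "0 \<le> \<theta>" "\<theta> < 4 / real DIM('a)" and \<epsilon>: "\<epsilon> > 0"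
  obtains K where "K \<ge> 0" "\<And>\<alpha> u. u \<in> energy_ball \<Omega> \<alpha> \<Longrightarrow> Lq_power \<Omega> (\<theta> + 2) u \<le> ennreal (K + \<epsilon> * (\<alpha> + 1))"
proof -
  obtain K where K: "K \<ge> 0"
    "\<And>(f :: 'a \<Rightarrow> real) g S. C1_compact f g S \<Longrightarrow> (\<integral>\<^sup>+x. ennreal ((f x)\<^sup>2) \<partial>lborel) \<le> ennreal 2 \<Longrightarrow>
      (\<integral>\<^sup>+x. ennreal (\<bar>f x\<bar> powr (\<theta> + 2)) \<partial>lborel)
        \<le> ennreal K + ennreal \<epsilon> * (\<integral>\<^sup>+x. ennreal ((norm (g x))\<^sup>2) \<partial>lborel)"
    by (rule C1_compact_subcritical_bound[OF \<theta> \<epsilon>]) blast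
  have \<Omega>m: "\<Omega> \<in> sets lebesgue" using \<Omega> by simp
  let ?M = "lebesgue_on \<Omega>"
  have "Lq_power \<Omega> (\<theta> + 2) u \<le> ennreal (K + \<epsilon> * (\<alpha> + 1))" if u: "u \<in> energy_ball \<Omega> \<alpha>" for u \<alpha>
  proof -
    have u0: "u \<in> H10 \<Omega>" "(l2norm ?M u)\<^sup>2 = 1" "(l2norm ?M (weak_grad \<Omega> u))\<^sup>2 \<le> \<alpha>"
      using u unfolding energy_ball_def mass_sphere_def mass_eq_l2norm energy_eq_l2norm by auto
    have u1: "u \<in> H1 \<Omega>" using H10_imp_H1[OF u0(1)] .
    have \<alpha>0: "0 \<le> \<alpha>" using order_trans[OF zero_le_power2 u0(3)] .
    obtain \<phi> where \<phi>: "\<And>n::nat. \<phi> n \<in> test_functions \<Omega>" "(\<lambda>n. H1_norm \<Omega> (\<lambda>x. \<phi> n x - u x)) \<longlonglongrightarrow> 0"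
      using H10_approx[OF \<Omega> u0(1)] by blast
    have \<phi>1: "\<phi> n \<in> H1 \<Omega>" for n using test_function_H1(1)[OF \<Omega> \<phi>(1)] .
    note s = H1_sq_int[OF u1] H1_sq_int[OF \<phi>1]
    note lim = H1_norm_tendsto_components[OF \<Omega> u1 \<phi>1 \<phi>(2)]
    have "(\<lambda>n. (l2norm ?M (\<phi> n))\<^sup>2) \<longlonglongrightarrow> (l2norm ?M u)\<^sup>2"
      by (intro tendsto_power l2norm_tendsto[OF s(1) s(4) lim(1)])
    then have ev1: "\<forall>\<^sub>F n in sequentially. (l2norm ?M (\<phi> n))\<^sup>2 < 2"
      using u0(2) by (intro order_tendstoD(2)) auto
    have "(\<lambda>n. (l2norm ?M (weak_grad \<Omega> (\<phi> n)))\<^sup>2) \<longlonglongrightarrow> (l2norm ?M (weak_grad \<Omega> u))\<^sup>2"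
      by (intro tendsto_power l2norm_tendsto[OF s(2) s(5) lim(2)])
    then have ev2: "\<forall>\<^sub>F n in sequentially. (l2norm ?M (weak_grad \<Omega> (\<phi> n)))\<^sup>2 < \<alpha> + 1"
      using u0(3) by (intro order_tendstoD(2)) auto
    have ev: "\<forall>\<^sub>F n in sequentially. Lq_power \<Omega> (\<theta> + 2) (\<phi> n) \<le> ennreal (K + \<epsilon> * (\<alpha> + 1))"
      using ev1 ev2
    proof eventually_elim
      case (elim n)
      note t = test_function_sq_int[OF \<phi>(1)[of n] \<Omega>m]
      have g: "(l2norm ?M (classical_grad (\<phi> n)))\<^sup>2 \<le> \<alpha> + 1"
        using test_function_H1(3)[OF \<Omega> \<phi>(1)[of n]] elim(2) by (simp add: energy_eq_l2norm)
      have "(\<integral>\<^sup>+x. ennreal ((\<phi> n x)\<^sup>2) \<partial>lborel) = (\<integral>\<^sup>+x. ennreal ((\<phi> n x)\<^sup>2) \<partial>?M)"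
        using test_function_zero[OF \<phi>(1)] by (intro nn_integral_lebesgue_on_eq_lborel[symmetric] \<Omega>m) simp
      also have "\<dots> = ennreal ((l2norm ?M (\<phi> n))\<^sup>2)" using nn_integral_l2norm[OF t(1)] by simp
      finally have m: "(\<integral>\<^sup>+x. ennreal ((\<phi> n x)\<^sup>2) \<partial>lborel) \<le> ennreal 2"
        using elim(1) by (simp add: ennreal_leI del: ennreal_numeral)
      have "(\<integral>\<^sup>+x. ennreal ((norm (classical_grad (\<phi> n) x))\<^sup>2) \<partial>lborel)
          = (\<integral>\<^sup>+x. ennreal ((norm (classical_grad (\<phi> n) x))\<^sup>2) \<partial>?M)"
        using test_function_zero[OF \<phi>(1)] by (intro nn_integral_lebesgue_on_eq_lborel[symmetric] \<Omega>m) simp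
      also have "\<dots> = ennreal ((l2norm ?M (classical_grad (\<phi> n)))\<^sup>2)" by (rule nn_integral_l2norm[OF t(2)])
      also have "\<dots> \<le> ennreal (\<alpha> + 1)" using g by (rule ennreal_leI)
      finally have e: "(\<integral>\<^sup>+x. ennreal ((norm (classical_grad (\<phi> n) x))\<^sup>2) \<partial>lborel) \<le> ennreal (\<alpha> + 1)" .
      have "Lq_power \<Omega> (\<theta> + 2) (\<phi> n) = (\<integral>\<^sup>+x. ennreal (\<bar>\<phi> n x\<bar> powr (\<theta> + 2)) \<partial>lborel)"
        unfolding Lq_power_def using test_function_zero[OF \<phi>(1)]
        by (intro nn_integral_lebesgue_on_eq_lborel \<Omega>m) simp
      also have "\<dots> \<le> ennreal K + ennreal \<epsilon> * (\<integral>\<^sup>+x. ennreal ((norm (classical_grad (\<phi> n) x))\<^sup>2) \<partial>lborel)"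
        by (rule K(2)[OF test_function_C1_compact[OF \<phi>(1)] m])
      also have "\<dots> \<le> ennreal K + ennreal \<epsilon> * ennreal (\<alpha> + 1)" by (intro add_left_mono mult_left_mono e) simp
      also have "\<dots> = ennreal (K + \<epsilon> * (\<alpha> + 1))" using K(1) \<epsilon> \<alpha>0 by (simp add: ennreal_mult ennreal_plus)
      finally show ?case .
    qed
    obtain r :: "nat \<Rightarrow> nat" where r: "strict_mono r" "AE x in ?M. (\<lambda>n. \<phi> (r n) x - u x) \<longlonglongrightarrow> 0"
      using l2norm_tendsto_AE_subseq[OF sq_int_diff[OF s(4) s(1)] lim(1)] by blast
    have [measurable]: "\<phi> n \<in> borel_measurable ?M" for n using sq_int_measurable[OF s(4)] .
    have "Lq_power \<Omega> (\<theta> + 2) u = (\<integral>\<^sup>+x. liminf (\<lambda>n. ennreal (\<bar>\<phi> (r n) x\<bar> powr (\<theta> + 2))) \<partial>?M)"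
      unfolding Lq_power_def
    proof (rule nn_integral_cong_AE)
      show "AE x in ?M. ennreal (\<bar>u x\<bar> powr (\<theta> + 2)) = liminf (\<lambda>n. ennreal (\<bar>\<phi> (r n) x\<bar> powr (\<theta> + 2)))"
        using r(2)
      proof eventually_elim
        case (elim x)
        then have "(\<lambda>n. \<phi> (r n) x) \<longlonglongrightarrow> u x" by (rule LIM_zero_cancel)
        then have "(\<lambda>n. ennreal (\<bar>\<phi> (r n) x\<bar> powr (\<theta> + 2))) \<longlonglongrightarrow> ennreal (\<bar>u x\<bar> powr (\<theta> + 2))"
          using \<theta>(1) by (intro tendsto_ennrealI tendsto_powr' tendsto_intros) auto
        then show ?case by (intro lim_imp_Liminf[symmetric]) simp_all
      qed
    qed
    also have "\<dots> \<le> liminf (\<lambda>n. Lq_power \<Omega> (\<theta> + 2) (\<phi> (r n)))"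
      unfolding Lq_power_def by (rule nn_integral_liminf) measurable
    also have "\<dots> \<le> ennreal (K + \<epsilon> * (\<alpha> + 1))"
      using eventually_subseq[OF r(1) ev] by (intro Liminf_le) simp_all
    finally show ?thesis .
  qed
  with K(1) show ?thesis by (rule that)
qed

text \<open>The infimum over an empty set would be \<infinity>; the genus condition excludes this.
  Any truncation serves in \<open>genus_3_balanced\<close>, here the one with scale 1.\<close>

lemma genus_family_3_nonempty:
  assumes "open \<Omega>" "A \<in> genus_family 3 \<Omega> \<alpha>"
  obtains u where "u \<in> A" "u \<in> energy_ball \<Omega> \<alpha>"
proof -
  have "enat 3 \<le> genus \<Omega> A" "A \<subseteq> energy_ball \<Omega> \<alpha>" using assms(2) by (auto simp: genus_family_def)
  then obtain u where "u \<in> A" by (elim genus_3_balanced[OF assms(1) _ C11_contraction_pos_reg[OF zero_less_one]])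
  with \<open>A \<subseteq> energy_ball \<Omega> \<alpha>\<close> show ?thesis using that by blast
qed

lemma M_level_3_subcritical:
  fixes \<Omega> :: "'a::euclidean_space set" and p \<epsilon> :: real
  assumes \<Omega>: "open \<Omega>" and p: "1 < p" "real DIM('a) * (p - 1) / 4 < 1" and \<epsilon>: "\<epsilon> > 0"
  obtains K where "K \<ge> 0" "\<And>\<alpha>. M_level 3 \<Omega> p \<alpha> \<le> ennreal (K + \<epsilon> * (\<alpha> + 1))"
proof -
  have \<theta>: "0 \<le> p - 1" "p - 1 < 4 / real DIM('a)" using p by (simp_all add: field_simps)
  obtain K where K: "K \<ge> 0"
    "\<And>\<alpha> u. u \<in> energy_ball \<Omega> \<alpha> \<Longrightarrow> Lq_power \<Omega> (p - 1 + 2) u \<le> ennreal (K + \<epsilon> * (\<alpha> + 1))"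
    by (rule energy_ball_subcritical_bound[OF \<Omega> \<theta> \<epsilon>]) blast
  have eq: "p - 1 + 2 = p + 1" by simp
  have "M_level 3 \<Omega> p \<alpha> \<le> ennreal (K + \<epsilon> * (\<alpha> + 1))" for \<alpha>
    unfolding M_level_def
  proof (rule SUP_least)
    fix A assume A: "A \<in> genus_family 3 \<Omega> \<alpha>"
    obtain u where "u \<in> A" "u \<in> energy_ball \<Omega> \<alpha>" using genus_family_3_nonempty[OF \<Omega> A] by blast
    then show "(INF u\<in>A. Lq_power \<Omega> (p + 1) u) \<le> ennreal (K + \<epsilon> * (\<alpha> + 1))"
      using K(2)[of u \<alpha>] unfolding eq by (intro INF_lower2)
  qed
  with K(1) show ?thesis by (rule that)
qed

section \<open>Lower bounds for the threshold\<close>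

text \<open>\<open>Y\<close> may be 0, in which case the right side is infinite because
  \<open>a\<close> is positive.\<close>

lemma ennreal_divide_mono:
  assumes "0 < X" "0 < a" "Y \<le> ennreal X"
  shows "ennreal (a / X) \<le> ennreal a / Y"
proof (cases Y)
  case (real y)
  show ?thesis
  proof (cases "y = 0")
    case True
    then show ?thesis using real assms(2) by (simp add: ennreal_divide_zero)
  next
    case False
    then have "0 < y" "y \<le> X" using real assms by (auto simp: ennreal_le_iff)
    then show ?thesis using real assms by (simp add: divide_ennreal ennreal_leI frac_le)
  qed
qed (use assms in \<open>simp add: top_unique\<close>)

lemma ennreal_eq_top_if_ge:
  assumes "\<And>B::real. 0 < B \<Longrightarrow> ennreal B \<le> x"
  shows "x = \<infinity>"
proof (cases x)
  case (real r)
  have "ennreal (r + 1) \<le> ennreal r" using assms[of "r + 1"] real by simp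
  then show ?thesis using real by (simp add: ennreal_le_iff)
qed simp

text \<open>A single \<alpha> bounds the supremum from below. Dropping the subtracted power of the
  volume only enlarges the denominator, so any positive upper bound for \<open>M_level\<close> may
  replace it.\<close>

lemma mu_hat_ge:
  assumes \<alpha>: "dirichlet_eigenvalue k \<Omega> < \<alpha>" and p: "1 < p" and X: "0 < X" "M_level k \<Omega> p \<alpha> \<le> ennreal X"
  shows "ennreal ((p + 1) / 2 * ((\<alpha> - dirichlet_eigenvalue k \<Omega>) / X)) \<le> mu_hat k \<Omega> p"
proof -
  let ?d = "M_level k \<Omega> p \<alpha> - ennreal (measure lebesgue \<Omega> powr (- ((p - 1) / 2)))"
  have "?d \<le> ennreal X" using X(2) by (meson diff_le_self_ennreal order_trans)
  then have "ennreal ((\<alpha> - dirichlet_eigenvalue k \<Omega>) / X) \<le> ennreal (\<alpha> - dirichlet_eigenvalue k \<Omega>) / ?d"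
    using \<alpha> X(1) by (intro ennreal_divide_mono) auto
  then have "ennreal ((p + 1) / 2) * ennreal ((\<alpha> - dirichlet_eigenvalue k \<Omega>) / X)
      \<le> ennreal ((p + 1) / 2) * (ennreal (\<alpha> - dirichlet_eigenvalue k \<Omega>) / ?d)"
    by (rule mult_left_mono) simp
  also have "\<dots> \<le> mu_hat k \<Omega> p" unfolding mu_hat_def using \<alpha> by (intro SUP_upper) simp
  finally show ?thesis using p \<alpha> X(1) by (simp add: ennreal_mult[symmetric])
qed

lemma mu_hat_top:
  assumes \<alpha>: "dirichlet_eigenvalue k \<Omega> < \<alpha>" and p: "1 < p" and M: "M_level k \<Omega> p \<alpha> = 0"
  shows "mu_hat k \<Omega> p = \<infinity>"
proof (rule ennreal_eq_top_if_ge)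
  fix B :: real assume B: "0 < B"
  \<comment> \<open>Chosen so that the resulting lower bound is exactly \<open>B\<close>.\<close>
  let ?X = "(p + 1) / 2 * (\<alpha> - dirichlet_eigenvalue k \<Omega>) / B"
  have "ennreal ((p + 1) / 2 * ((\<alpha> - dirichlet_eigenvalue k \<Omega>) / ?X)) \<le> mu_hat k \<Omega> p"
    using p \<alpha> B M by (intro mu_hat_ge) auto
  then show "ennreal B \<le> mu_hat k \<Omega> p" using p \<alpha> B by simp
qed

text \<open>For N \<ge> 3, clearing denominators in p < 2N/(N-2) - 1 gives this inequality, which
  says that the mass exponent in the Gagliardo-Nirenberg inequality is nonnegative.\<close>

lemma subcritical_exponent_le:
  assumes "ereal p < critical_exponent N - 1" "1 < p"
  shows "real N * (p - 1) / 2 \<le> p + 1"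
proof (cases "N \<ge> 3")
  case True
  then have "p < 2 * real N / (real N - 2) - 1"
    using assms(1) by (simp add: critical_exponent_def one_ereal_def)
  then have "(p + 1) * (real N - 2) < 2 * real N" using True by (simp add: field_simps)
  then show ?thesis by (simp add: field_simps)
next
  case False
  then have "real N * (p - 1) \<le> 2 * (p - 1)" using assms(2) by (intro mult_right_mono) auto
  then show ?thesis by simp
qed

lemma mu_hat_3_top_subcritical:
  fixes \<Omega> :: "'a::euclidean_space set"
  assumes \<Omega>: "open \<Omega>" and p: "1 < p" "real DIM('a) * (p - 1) / 4 < 1" and \<Lambda>: "0 < dirichlet_eigenvalue 3 \<Omega>"
  shows "mu_hat 3 \<Omega> p = \<infinity>"
proof (rule ennreal_eq_top_if_ge)
  fix B :: real assume B: "0 < B"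
  define c where "c = (p + 1) / 2"
  define \<Lambda> where "\<Lambda> = dirichlet_eigenvalue 3 \<Omega>"
  have c: "c > 0" using p by (simp add: c_def)
  have l0: "\<Lambda> > 0" using assms by (simp add: \<Lambda>_def)
  \<comment> \<open>With this \<epsilon> the quantity B * (K + \<epsilon> * (\<alpha> + 1)) grows in
    \<alpha> at the rate c/2, half that of c * (\<alpha> - \<Lambda>).\<close>
  define \<epsilon> where "\<epsilon> = c / (2 * B)"
  have \<epsilon>: "\<epsilon> > 0" using c B by (simp add: \<epsilon>_def)
  obtain K where K: "K \<ge> 0" "\<And>\<alpha>. M_level 3 \<Omega> p \<alpha> \<le> ennreal (K + \<epsilon> * (\<alpha> + 1))"
    by (rule M_level_3_subcritical[OF \<Omega> p \<epsilon>]) blast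
  \<comment> \<open>The point where the two linear functions meet, that is, the solution of B * X =
    c * (\<alpha> - \<Lambda>).\<close>
  define \<alpha> where "\<alpha> = 2 * B * K / c + 1 + 2 * \<Lambda>"
  have "2 * B * K / c \<ge> 0" using B K c by simp
  then have \<alpha>: "\<Lambda> < \<alpha>" "0 < \<alpha>" using l0 by (simp_all add: \<alpha>_def)
  define X where "X = K + \<epsilon> * (\<alpha> + 1)"
  have X: "X > 0" unfolding X_def using K(1) \<epsilon> \<alpha>(2) by (intro add_nonneg_pos mult_pos_pos) auto
  have "B * X = B * K + c * (\<alpha> + 1) / 2" using B by (simp add: X_def \<epsilon>_def field_simps)
  moreover have "c * \<alpha> = 2 * B * K + c + 2 * c * \<Lambda>" using c by (simp add: \<alpha>_def field_simps)
  ultimately have "B * X = c * (\<alpha> - \<Lambda>)" by (simp add: field_simps)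
  then have "B = c * ((\<alpha> - \<Lambda>) / X)" using X by (simp add: field_simps)
  then show "ennreal B \<le> mu_hat 3 \<Omega> p"
    using mu_hat_ge[of 3 \<Omega> \<alpha> p X] \<alpha>(1) p(1) X K(2)[of \<alpha>] by (simp add: c_def \<Lambda>_def X_def)
qed

lemma M_level_3_negative:
  assumes "open \<Omega>" "\<alpha> < 0"
  shows "M_level 3 \<Omega> p \<alpha> = 0"
proof -
  have "genus_family 3 \<Omega> \<alpha> = {}"
  proof (rule ccontr)
    assume "genus_family 3 \<Omega> \<alpha> \<noteq> {}"
    then obtain A where "A \<in> genus_family 3 \<Omega> \<alpha>" by blast
    then obtain u where "u \<in> energy_ball \<Omega> \<alpha>" using genus_family_3_nonempty[OF assms(1)] by blast
    then have "(l2norm (lebesgue_on \<Omega>) (weak_grad \<Omega> u))\<^sup>2 \<le> \<alpha>"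
      by (simp add: energy_ball_def energy_eq_l2norm)
    from order_trans[OF zero_le_power2 this] show False using assms(2) by simp
  qed
  then show ?thesis by (simp add: M_level_def bot_ennreal)
qed

text \<open>The factor with \<beta> is the supremum of (\<alpha> - 1) / \<alpha>^\<beta> over
  \<alpha> > 1, and rescaling by \<Lambda> produces the power 1 - \<beta>.\<close>

lemma mu_hat_3_ge_critical:
  fixes \<Omega> :: "'a::euclidean_space set" and p C :: real
  defines "\<beta> \<equiv> real DIM('a) * (p - 1) / 4"
    and "\<Lambda> \<equiv> dirichlet_eigenvalue 3 \<Omega>"
  assumes p: "1 < p" and \<beta>: "1 \<le> \<beta>" and \<Lambda>: "0 < \<Lambda>" and C: "0 < C"
    and M: "\<And>\<alpha>. M_level 3 \<Omega> p \<alpha> \<le> ennreal (C * (2 powr (- ((p - 1) / 2)) * \<alpha> powr \<beta>))"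
  shows "ennreal (2 powr ((p - 1) / 2) * ((p + 1) / (2 * C) *
      ((if \<beta> = 1 then 1 else (\<beta> - 1) powr (\<beta> - 1)) / \<beta> powr \<beta>)) * \<Lambda> powr (1 - \<beta>)) \<le> mu_hat 3 \<Omega> p"
proof -
  let ?P = "2 powr ((p - 1) / 2)"
  have ge: "ennreal (?P * ((p + 1) / (2 * C)) * ((\<alpha> - \<Lambda>) * \<alpha> powr (- \<beta>))) \<le> mu_hat 3 \<Omega> p" if \<alpha>: "\<Lambda> < \<alpha>" for \<alpha>
  proof -
    let ?X = "C * (2 powr (- ((p - 1) / 2)) * \<alpha> powr \<beta>)"
    have \<alpha>0: "0 < \<alpha>" using \<alpha> \<Lambda> by simp
    then have "0 < ?X" using C by (intro mult_pos_pos) auto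
    then have "ennreal ((p + 1) / 2 * ((\<alpha> - \<Lambda>) / ?X)) \<le> mu_hat 3 \<Omega> p"
      using mu_hat_ge[of 3 \<Omega> \<alpha> p ?X] \<alpha> p M[of \<alpha>] unfolding \<Lambda>_def by blast
    also have "(p + 1) / 2 * ((\<alpha> - \<Lambda>) / ?X) = ?P * ((p + 1) / (2 * C)) * ((\<alpha> - \<Lambda>) * \<alpha> powr (- \<beta>))"
      using C \<alpha>0 by (simp only: powr_minus) (simp add: field_simps)
    finally show ?thesis .
  qed
  show ?thesis
  proof (cases "\<beta> = 1")
    case True
    let ?R = "?P * ((p + 1) / (2 * C))"
    \<comment> \<open>For \<beta> = 1 the quotient is 1 - \<Lambda>/\<alpha>, whose supremum 1 is
      not attained, so \<alpha> runs through the multiples (n + 2) \<Lambda>.\<close>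
    define a where "a n = \<Lambda> * real (Suc (Suc n))" for n
    have a: "\<Lambda> < a n" for n using \<Lambda> by (simp add: a_def)
    have "(a n - \<Lambda>) * a n powr (- \<beta>) = 1 - inverse (real (Suc (Suc n)))" for n
      using \<Lambda> a[of n] by (simp add: True powr_minus a_def field_simps)
    then have "ennreal (?R * (1 - inverse (real (Suc (Suc n))))) \<le> mu_hat 3 \<Omega> p" for n
      using ge[OF a[of n]] by simp
    moreover have "(\<lambda>n. ennreal (?R * (1 - inverse (real (Suc (Suc n)))))) \<longlonglongrightarrow> ennreal (?R * (1 - 0))"
      by (intro tendsto_ennrealI tendsto_intros LIMSEQ_Suc[OF LIMSEQ_inverse_real_of_nat])
    ultimately have "ennreal (?R * (1 - 0)) \<le> mu_hat 3 \<Omega> p" by (intro LIMSEQ_le_const2) auto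
    then show ?thesis using \<Lambda> by (simp add: True)
  next
    case False
    then have b: "0 < \<beta> - 1" "0 < \<beta>" using \<beta> by auto
    define \<alpha> where "\<alpha> = \<beta> * \<Lambda> / (\<beta> - 1)"
      \<comment> \<open>the maximiser of \<open>(\<alpha> - \<Lambda>) / \<alpha> powr \<beta>\<close>\<close>
    have d: "\<alpha> - \<Lambda> = \<Lambda> / (\<beta> - 1)" using b by (simp add: \<alpha>_def field_simps)
    then have \<alpha>: "\<Lambda> < \<alpha>" using divide_pos_pos[OF \<Lambda> b(1)] by linarith
    have \<alpha>\<beta>: "\<alpha> powr \<beta> = \<beta> powr \<beta> * \<Lambda> powr \<beta> / (\<beta> - 1) powr \<beta>"
      unfolding \<alpha>_def using b \<Lambda> by (simp add: powr_mult powr_divide)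
    \<comment> \<open>The linear factors are written as powers with exponent 1 so that
      \<open>powr_diff\<close> can merge them.\<close>
    have "(\<alpha> - \<Lambda>) * \<alpha> powr (- \<beta>) = (\<Lambda> powr 1 / \<Lambda> powr \<beta>) * ((\<beta> - 1) powr \<beta> / (\<beta> - 1) powr 1) / \<beta> powr \<beta>"
      unfolding d powr_minus \<alpha>\<beta> using b \<Lambda> by (simp add: field_simps)
    also have "\<dots> = \<Lambda> powr (1 - \<beta>) * ((\<beta> - 1) powr (\<beta> - 1) / \<beta> powr \<beta>)"
      by (simp only: powr_diff times_divide_eq_right)
    finally show ?thesis using ge[OF \<alpha>] False by (simp add: mult_ac)
  qed
qed

section \<open>From the energy threshold to the mass threshold\<close>

lemma ennpowr_mono:
  assumes "ennreal R \<le> x" "0 \<le> R" "0 \<le> s"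
  shows "ennreal (R powr s) \<le> ennpowr x s"
proof (cases x)
  case (real r)
  then have "R \<le> r" using assms by (simp add: ennreal_le_iff)
  then show ?thesis using real assms by (simp add: ennpowr_def ennreal_leI powr_mono2)
qed (simp add: ennpowr_def)

text \<open>The exponents (p-1)/2 and 2/(p-1) are reciprocal, which leaves exactly the factor
  2.\<close>

lemma scaling_exponent_eq:
  fixes p \<Lambda> Q d :: real
  assumes p: "1 < p" and Q: "0 \<le> Q" and \<Lambda>: "0 < \<Lambda>"
  shows "(2 powr ((p - 1) / 2) * Q * \<Lambda> powr (1 - d * (p - 1) / 4)) powr (2 / (p - 1))
    = 2 * Q powr (2 / (p - 1)) * \<Lambda> powr (2 / (p - 1) - d / 2)"
proof -
  have eq: "(2 powr ((p - 1) / 2) * Q * \<Lambda> powr (1 - d * (p - 1) / 4)) powr (2 / (p - 1))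
      = 2 powr ((p - 1) / 2 * (2 / (p - 1))) * Q powr (2 / (p - 1)) *
        \<Lambda> powr ((1 - d * (p - 1) / 4) * (2 / (p - 1)))"
    using Q by (simp only: powr_mult powr_powr mult_nonneg_nonneg powr_ge_zero)
  have exps: "(p - 1) / 2 * (2 / (p - 1)) = 1" "(1 - d * (p - 1) / 4) * (2 / (p - 1)) = 2 / (p - 1) - d / 2"
    using p by (simp_all add: field_simps)
  show ?thesis unfolding eq exps by simp
qed

theorem proposition1p10:
  fixes \<Omega> :: "'a::euclidean_space set" and p :: real
  assumes "bounded \<Omega>" and "lipschitz_domain \<Omega>"
    and "1 < p" and "ereal p < critical_exponent DIM('a) - 1"
  shows "rho_hat 3 \<Omega> p \<ge>
    2 * D_constant TYPE('a) p *
      ennreal (dirichlet_eigenvalue 3 \<Omega> powr (2 / (p - 1) - real DIM('a) / 2))"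
proof -
  define \<beta> where "\<beta> = real DIM('a) * (p - 1) / 4"
  define \<Lambda> where "\<Lambda> = dirichlet_eigenvalue 3 \<Omega>"
  have \<Omega>: "open \<Omega>" using assms(2) by (simp add: lipschitz_domain_def)
  have s: "0 \<le> 2 / (p - 1)" using assms(3) by simp
  have top: ?thesis if "mu_hat 3 \<Omega> p = \<infinity>"
    using that by (simp add: rho_hat_def ennpowr_def)
  consider "\<Lambda> = 0" | "\<Lambda> < 0" | "\<Lambda> > 0" "\<beta> < 1" | "\<Lambda> > 0" "\<beta> \<ge> 1" by linarith
  then show ?thesis
  proof cases
    case 1
    then show ?thesis by (simp add: \<Lambda>_def)
  next
    case 2
    then show ?thesis
      using mu_hat_top[of 3 \<Omega> "\<Lambda> / 2" p] M_level_3_negative[OF \<Omega>, of "\<Lambda> / 2" p] assms(3)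
      by (intro top) (simp add: \<Lambda>_def)
  next
    case 3
    then show ?thesis
      using mu_hat_3_top_subcritical[OF \<Omega> assms(3)] by (intro top) (simp add: \<Lambda>_def \<beta>_def)
  next
    case 4
    define w where "w = (if \<beta> = 1 then 1 else (\<beta> - 1) powr (\<beta> - 1)) / \<beta> powr \<beta>"
    have w: "w \<ge> 0" by (simp add: w_def)
    have D: "D_constant TYPE('a) p =
        ennpowr (ennreal (p + 1) / (2 * gn_constant TYPE('a) p) * ennreal w) (2 / (p - 1))"
      using 4(2) unfolding D_constant_def Let_def \<beta>_def[symmetric] w_def by simp
    note M = M_level_3_le[OF \<Omega> assms(1) assms(3) subcritical_exponent_le[OF assms(4) assms(3)]]
    have e: "real DIM('a) * (p - 1) / 2 / 2 = \<beta>" by (simp add: \<beta>_def)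
    show ?thesis
    proof (cases "gn_constant TYPE('a) p")
      \<comment> \<open>Division by an infinite constant makes \<open>D_constant\<close> equal to
        0.\<close>
      case top
      then show ?thesis by (simp add: D ennpowr_def)
    next
      case (real C)
      have M': "M_level 3 \<Omega> p \<alpha> \<le> ennreal (C * (2 powr (- ((p - 1) / 2)) * \<alpha> powr \<beta>))" for \<alpha>
        using M[of \<alpha>] real unfolding e by (simp add: ennreal_mult)
      show ?thesis
      proof (cases "C = 0")
        \<comment> \<open>A zero constant forces \<open>M_level\<close> to vanish at \<Lambda> + 1,
          so the threshold is infinite and dominates whatever value the division by 0 gives on the
          other side.\<close>
        case True
        then show ?thesis
          using M'[of "\<Lambda> + 1"] mu_hat_top[of 3 \<Omega> "\<Lambda> + 1" p] assms(3) by (intro top) (simp add: \<Lambda>_def)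
      next
        case False
        then have C: "0 < C" using real by simp
        define Q where "Q = (p + 1) / (2 * C) * w"
        have Q: "0 \<le> Q" using C assms(3) w by (simp add: Q_def)
        have "ennreal (p + 1) / (2 * gn_constant TYPE('a) p) * ennreal w = ennreal Q"
        proof -
          have gC: "gn_constant TYPE('a) p = ennreal C" by (fact real)
          have "2 * ennreal C = ennreal (2 * C)" using C by (simp add: ennreal_mult)
          then have "ennreal (p + 1) / (2 * gn_constant TYPE('a) p) = ennreal (p + 1) / ennreal (2 * C)"
            by (simp only: gC)
          also have "\<dots> = ennreal ((p + 1) / (2 * C))" using C assms(3) by (intro divide_ennreal) auto
          also have "\<dots> * ennreal w = ennreal ((p + 1) / (2 * C) * w)"
            using C assms(3) w by (intro ennreal_mult[symmetric]) auto
          finally show ?thesis by (simp only: Q_def)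
        qed
        then have D': "D_constant TYPE('a) p = ennreal (Q powr (2 / (p - 1)))"
          using Q by (simp add: D ennpowr_def)
        have "ennreal (2 powr ((p - 1) / 2) * Q * \<Lambda> powr (1 - \<beta>)) \<le> mu_hat 3 \<Omega> p"
          unfolding Q_def w_def \<beta>_def \<Lambda>_def
          by (rule mu_hat_3_ge_critical[OF assms(3) 4(2)[unfolded \<beta>_def] 4(1)[unfolded \<Lambda>_def] C M'[unfolded \<beta>_def]])
        then have "ennreal ((2 powr ((p - 1) / 2) * Q * \<Lambda> powr (1 - \<beta>)) powr (2 / (p - 1))) \<le> rho_hat 3 \<Omega> p"
          unfolding rho_hat_def using Q s by (intro ennpowr_mono) auto
        then show ?thesis
          unfolding D' \<Lambda>_def[symmetric] \<beta>_def scaling_exponent_eq[OF assms(3) Q 4(1)]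
          by (simp add: ennreal_mult)
      qed
    qed
  qed
qed

end
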